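(* Let $F_\omega$ be the free group with countably infinite basis $X=\{x_1,x_2,\dots\}$, let $G=\mathrm{BF}(\mathcal E;\mathcal S)$, let $\Psi:G\to\mathrm{Aut}(F_\omega)$ be the epimorphism $[f]\mapsto\alpha_f$, let $\mathfrak T$ be the topology on $G$ and $\mathcal R_{\mathrm{fin}}\subseteq G$ the set of words of types $(\mathcal R1)$–$(\mathcal R5)$, all as defined in the context. Then $\ker\Psi$ coincides with the closure in the topology $\mathfrak T$ of the normal closure of $\mathcal R_{\mathrm{fin}}$ in $G$: $$\ker\Psi=\overline{\langle\!\langle\mathcal R_{\mathrm{fin}}\rangle\!\rangle_G}^{\,\mathfrak T}.$$ In particular, $(\mathcal E,\mathcal S,\mathfrak T,\mathcal R_{\mathrm{fin}})$ is a generalized presentation of $\mathrm{Aut}(F_\omega)$ of type $\aleph_0$.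
   Context: **Big free groups.** For a set $\Lambda$ with a fixed-point-free involution $\lambda\mapsto\lambda^{-1}$, let $\mathcal T(\Lambda)$ be the set of all maps $f:S\to\Lambda$ with $S$ totally ordered and $f^{-1}(\lambda)$ finite for every $\lambda\in\Lambda$; $f:S\to\Lambda$ and $f':S'\to\Lambda$ are identified if $f=f'\circ\varphi$ for an order-preserving bijection $\varphi:S\to S'$. Write $f\searrow g$ if there are $T\subseteq S$ with $g=f|_{S\setminus T}$ and an involution $*$ on $T$ such that for all $t\in T$: $f(t^* )=f(t)^{-1}$, $[t,t^*]\subseteq T$, and $([t,t^*])^*=[t,t^*]$, where $[s,s']=\{x\in S\mid s\le x\le s'\}$. Let $\approx$ be the equivalence relation generated by $\searrow$; $\mathrm{BF}(\Lambda)=\mathcal T(\Lambda)/\!\approx$ is a group under concatenation, with class of $f$ denoted $[f]$. For $f:S\to\Lambda$ let $\bar f:\bar S\to\Lambda$, $\bar f(s)=f(s)^{-1}$, where $\bar S$ is $S$ with reversed order. A subset $\mathcal S\subseteq\mathcal T(\Lambda)$ is admissible if it is closed under concatenation, under $f\mapsto\bar f$, and under $f\searrow g$; then $\mathrm{BF}(\Lambda;\mathcal S)=\mathcal S/\!\approx$ is a subgroup of $\mathrm{BF}(\Lambda)$. $\Lambda$ is regarded as a subset of $\mathrm{BF}(\Lambda)$ via one-letter maps, and $\mathcal F(\Lambda)$ is the subgroup generated by $\Lambda$. **Topologies.** For $A=A^{-1}\subseteq\Lambda$, restriction of $f$ to $f^{-1}(A)$ induces a homomorphism $\varphi_A:\mathrm{BF}(\Lambda)\to\mathrm{BF}(A)$.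 The natural topology on $\mathrm{BF}(\Lambda)$ and its subgroups has the subgroups $\ker\varphi_A$, $A$ finite, (intersected with the subgroup) as a basis of neighborhoods of $1$. If $\Lambda\subseteq\mathcal S$, a topology on $\mathrm{BF}(\Lambda;\mathcal S)$ is admissible if it makes it a topological group, is finer than (or equal to) the natural topology, and $\mathcal F(\Lambda)$ is dense. **Generalized presentations.** A generalized presentation of a group $H$ is a tuple $(\Lambda,\mathcal S,\mathfrak T,R)$ where $\Lambda$ is a set with a free involution, $\mathcal S\subseteq\mathcal T(\Lambda)$ is admissible with $\Lambda\subseteq\mathcal S$, $\mathfrak T$ is an admissible topology on $\mathrm{BF}(\Lambda;\mathcal S)$, $R\subseteq\mathrm{BF}(\Lambda;\mathcal S)$, and there is an epimorphism $p:\mathrm{BF}(\Lambda;\mathcal S)\to H$ such that $\ker p$ is the smallest $\mathfrak T$-closed normal subgroup containing $R$. It is of type $c$ if $|\Lambda|\le c$ and $|R|\le c$. **The data.** Let $X^{\pm}=X\cup X^{-1}$. Automorphisms act on the right: $w\varphi$ is the image of $w$, and $w(\varphi\psi)=(w\varphi)\psi$. For $x,y\in X^\pm$, $y\ne x^{\pm1}$, $E_{xy}$ is the automorphism of $F_\omega$ with $x\mapsto xy$ fixing all elements of $X^\pm\setminus\{x,x^{-1}\}$. $\mathcal E$ is the set of all $E_{xy}$, with free involution $E_{xy}^{-1}=E_{xy^{-1}}$. For $f:S\to\mathcal E$ write $f(s)=E_{f_1(s)f_2(s)}$. Let $\mathcal S_0=\{f\in\mathcal T(\mathcal E)\mid f_1^{-1}(x)\text{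 is finite for each }x\in X^\pm\}$; let $\mathcal S_1$ be the set of $f:S\to\mathcal E$ in $\mathcal T(\mathcal E)$ for which there is no injective order-preserving $\varphi:\mathbb N\to S$ with $f_1(\varphi(n+1))=(f_2(\varphi(n)))^{\pm1}$ for all $n$; let $\mathcal S=\{f\in\mathcal T(\mathcal E)\mid f\in\mathcal S_0,\ f\in\mathcal S_1,\ \bar f\in\mathcal S_1\}$ (an admissible set). For $f:S\to\mathcal E$ in $\mathcal S$ and $x\in X^\pm$ put $A_0=\{x,x^{-1}\}$, $s_1=\min f_1^{-1}(A_0)$, $A_k=A_{k-1}\cup\{f_2(s_k),f_2(s_k)^{-1}\}$, $s_{k+1}=\min\{s\in S\mid s>s_k,\ f_1(s)\in A_k\}$, as long as the relevant sets are non-empty; this stops after finitely many steps with a finite set $C(f,x)=\{s_1<\dots<s_m\}$ (possibly empty). Define $x\alpha_f=x\,f(s_1)f(s_2)\cdots f(s_m)$ (product of automorphisms of $F_\omega$). Then $\alpha_f\in\mathrm{Aut}(F_\omega)$, and $\Psi([f])=\alpha_f$ is a well-defined epimorphism $\mathrm{BF}(\mathcal E;\mathcal S)\to\mathrm{Aut}(F_\omega)$. The topology $\mathfrak T$ on $G$: a basis of neighborhoods of $1$ is given by the subgroups $\mathcal U_{Y,A}=\Psi^{-1}(\mathrm{St}(Y))\cap\ker\varphi_A$, where $Y$ runs over finite subsets of $X$, $A$ over finite subsets of $\mathcal E$ (closed under the involution), and $\mathrm{St}(Y)=\{\alpha\in\mathrm{Aut}(F_\omega)\mid y\alpha=y\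 \forall y\in Y\}$. $\mathcal R_{\mathrm{fin}}$ is the set of all words $UV^{-1}\in G$ where $U=V$ is one of the following relations, with all letters $a,b,c,d\in X^\pm$ such that the symbols $E_{\cdot\cdot}$ occurring are defined, and $[u,v]=uvu^{-1}v^{-1}$: $(\mathcal R1)$ $E_{ab}^{-1}=E_{ab^{-1}}$; $(\mathcal R2)$ $[E_{ab},E_{cd}]=1$ for $a\ne c,d,d^{-1}$ and $b\ne c,c^{-1}$; $(\mathcal R3)$ $[E_{ab},E_{bc}]=E_{ac}$ for $a\ne c,c^{-1}$; $(\mathcal R4)$ $\mathrm w_{ab}^{-1}E_{cd}\mathrm w_{ab}=E_{\sigma(c)\sigma(d)}$, where $\mathrm w_{ab}:=E_{ba}E_{a^{-1}b}E_{b^{-1}a}^{-1}$ and $\sigma$ is the monomial map $a\mapsto b^{-1}$, $b\mapsto a$ (compatible with inversion, fixing the other letters); $(\mathcal R5)$ $\mathrm w_{ab}^4=1$. *)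

theory Defs
  imports
    "HOL-Algebra.Bij"
    "HOL-Algebra.Generated_Groups"
    "HOL-Analysis.Product_Topology"
begin

unbundle cardinal_syntax

section \<open>Words over a set with a free involution\<close>

text \<open>
  A map \<open>f : S \<rightarrow> \<Lambda>\<close> with \<open>S\<close> totally ordered and finite fibres is determined up to isomorphism by
  a copy of it whose index set lies in \<open>\<Lambda> \<times> \<nat>\<close> (lemma \<open>index_universe\<close> below). Hence index sets are
  taken to be arbitrary subsets of \<open>'l \<times> nat\<close>, with an arbitrary linear order. Values of \<open>lab\<close>
  outside \<open>idx\<close> are irrelevant.
\<close>

record 'l word =
  idx :: "('l \<times> nat) set"
  le :: "('l \<times> nat) rel"
  lab :: "'l \<times> nat \<Rightarrow> 'l"

definition free_involution :: "'l set \<Rightarrow> ('l \<Rightarrow> 'l) \<Rightarrow> bool" where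
  "free_involution \<Lambda> i \<longleftrightarrow> (\<forall>l\<in>\<Lambda>. i l \<in> \<Lambda> \<and> i (i l) = l \<and> i l \<noteq> l)"

definition words :: "'l set \<Rightarrow> 'l word set" where
  "words \<Lambda> = {f. linear_order_on (idx f) (le f) \<and> lab f ` idx f \<subseteq> \<Lambda> \<and>
                 (\<forall>l\<in>\<Lambda>. finite {s \<in> idx f. lab f s = l})}"

definition word_iso :: "'l word \<Rightarrow> 'l word \<Rightarrow> bool" where
  "word_iso f g \<longleftrightarrow> (\<exists>\<phi>. bij_betw \<phi> (idx f) (idx g) \<and>
     (\<forall>s\<in>idx f. \<forall>t\<in>idx f. (s, t) \<in> le f \<longleftrightarrow> (\<phi> s, \<phi> t) \<in> le g) \<and>
     (\<forall>s\<in>idx f. lab f s = lab g (\<phi> s)))"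

definition word_restrict :: "'l word \<Rightarrow> ('l \<times> nat) set \<Rightarrow> 'l word" where
  "word_restrict f T = \<lparr>idx = idx f \<inter> T, le = le f \<inter> (T \<times> T), lab = lab f\<rparr>"

definition empty_word :: "'l word" where
  "empty_word = \<lparr>idx = {}, le = {}, lab = fst\<rparr>"

definition one_letter :: "'l \<Rightarrow> 'l word" where
  "one_letter l = \<lparr>idx = {(l, 0)}, le = {((l, 0), (l, 0))}, lab = (\<lambda>_. l)\<rparr>"

text \<open>In a concatenation the two index sets are made disjoint by doubling the second component.\<close>

definition inL :: "'l \<times> nat \<Rightarrow> 'l \<times> nat" where "inL = map_prod id (\<lambda>n. 2 * n)"
definition inR :: "'l \<times> nat \<Rightarrow> 'l \<times> nat" where "inR = map_prod id (\<lambda>n. 2 * n + 1)"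

definition concat_word :: "'l word \<Rightarrow> 'l word \<Rightarrow> 'l word" where
  "concat_word f g =
     \<lparr>idx = inL ` idx f \<union> inR ` idx g,
      le = map_prod inL inL ` le f \<union> map_prod inR inR ` le g \<union> (inL ` idx f) \<times> (inR ` idx g),
      lab = (\<lambda>(l, n). if even n then lab f (l, n div 2) else lab g (l, n div 2))\<rparr>"

definition bar_word :: "('l \<Rightarrow> 'l) \<Rightarrow> 'l word \<Rightarrow> 'l word" where
  "bar_word i f = \<lparr>idx = idx f, le = (le f)\<inverse>, lab = (\<lambda>s. i (lab f s))\<rparr>"

definition word_interval :: "'l word \<Rightarrow> 'l \<times> nat \<Rightarrow> 'l \<times> nat \<Rightarrow> ('l \<times> nat) set" where
  "word_interval f s t = {x \<in> idx f. (s, x) \<in> le f \<and> (x, t) \<in> le f}"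

text \<open>
  The relation \<open>f \<searrow> g\<close> between isomorphism types of words. The case \<open>T = {}\<close> shows that it contains
  \<open>word_iso\<close>, so closure under it includes closure under isomorphism.
\<close>

definition cancels :: "('l \<Rightarrow> 'l) \<Rightarrow> 'l word \<Rightarrow> 'l word \<Rightarrow> bool" where
  "cancels i f g \<longleftrightarrow>
     (\<exists>T star. T \<subseteq> idx f \<and> word_iso (word_restrict f (idx f - T)) g \<and>
        (\<forall>t\<in>T. star t \<in> T \<and> star (star t) = t \<and>
           lab f (star t) = i (lab f t) \<and>
           word_interval f t (star t) \<subseteq> T \<and>
           star ` word_interval f t (star t) = word_interval f t (star t)))"

definition word_equiv :: "'l set \<Rightarrow> ('l \<Rightarrow> 'l) \<Rightarrow> 'l word \<Rightarrow> 'l word \<Rightarrow> bool" where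
  "word_equiv \<Lambda> i = equivclp (\<lambda>f g. f \<in> words \<Lambda> \<and> g \<in> words \<Lambda> \<and> cancels i f g)"

definition word_class :: "'l set \<Rightarrow> ('l \<Rightarrow> 'l) \<Rightarrow> 'l word \<Rightarrow> 'l word set" where
  "word_class \<Lambda> i f = {g \<in> words \<Lambda>. word_equiv \<Lambda> i f g}"

section \<open>Big free groups\<close>

definition BF :: "'l set \<Rightarrow> ('l \<Rightarrow> 'l) \<Rightarrow> 'l word set monoid" where
  "BF \<Lambda> i =
     \<lparr>carrier = word_class \<Lambda> i ` words \<Lambda>,
      mult = (\<lambda>C D. \<Union>f\<in>C. \<Union>g\<in>D. word_class \<Lambda> i (concat_word f g)),
      one = word_class \<Lambda> i empty_word\<rparr>"

definition admissible :: "'l set \<Rightarrow> ('l \<Rightarrow> 'l) \<Rightarrow> 'l word set \<Rightarrow> bool" where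
  "admissible \<Lambda> i S \<longleftrightarrow> S \<subseteq> words \<Lambda> \<and>
     (\<forall>f\<in>S. \<forall>g\<in>S. concat_word f g \<in> S) \<and>
     (\<forall>f\<in>S. bar_word i f \<in> S) \<and>
     (\<forall>f\<in>S. \<forall>g\<in>words \<Lambda>. cancels i f g \<longrightarrow> g \<in> S)"

definition BF_sub :: "'l set \<Rightarrow> ('l \<Rightarrow> 'l) \<Rightarrow> 'l word set \<Rightarrow> 'l word set monoid" where
  "BF_sub \<Lambda> i S = (BF \<Lambda> i)\<lparr>carrier := word_class \<Lambda> i ` S\<rparr>"

definition finitary_part :: "'l set \<Rightarrow> ('l \<Rightarrow> 'l) \<Rightarrow> 'l word set set" where
  "finitary_part \<Lambda> i = generate (BF \<Lambda> i) ((\<lambda>l. word_class \<Lambda> i (one_letter l)) ` \<Lambda>)"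

definition letter_proj :: "('l \<Rightarrow> 'l) \<Rightarrow> 'l set \<Rightarrow> 'l word set \<Rightarrow> 'l word set" where
  "letter_proj i A C = (\<Union>f\<in>C. word_class A i (word_restrict f {s. lab f s \<in> A}))"

definition ker_proj :: "'l set \<Rightarrow> ('l \<Rightarrow> 'l) \<Rightarrow> 'l set \<Rightarrow> 'l word set set" where
  "ker_proj \<Lambda> i A = kernel (BF \<Lambda> i) (BF A i) (letter_proj i A)"

definition finite_symmetric :: "'l set \<Rightarrow> ('l \<Rightarrow> 'l) \<Rightarrow> 'l set \<Rightarrow> bool" where
  "finite_symmetric \<Lambda> i A \<longleftrightarrow> A \<subseteq> \<Lambda> \<and> finite A \<and> i ` A = A"

section \<open>Topologies\<close>

definition topological_group :: "('g, 'm) monoid_scheme \<Rightarrow> 'g topology \<Rightarrow> bool" where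
  "topological_group G T \<longleftrightarrow> group G \<and> topspace T = carrier G \<and>
     continuous_map (prod_topology T T) T (\<lambda>(x, y). x \<otimes>\<^bsub>G\<^esub> y) \<and>
     continuous_map T T (\<lambda>x. inv\<^bsub>G\<^esub> x)"

text \<open>The topology in which the sets in \<open>B\<close> form a basis of neighborhoods of the unit.\<close>

definition subgroup_topology :: "('g, 'm) monoid_scheme \<Rightarrow> 'g set set \<Rightarrow> 'g topology" where
  "subgroup_topology G B =
     topology (\<lambda>U. U \<subseteq> carrier G \<and> (\<forall>g\<in>U. \<exists>N\<in>B. g <#\<^bsub>G\<^esub> N \<subseteq> U))"

definition natural_topology ::
    "'l set \<Rightarrow> ('l \<Rightarrow> 'l) \<Rightarrow> 'l word set \<Rightarrow> 'l word set topology" where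
  "natural_topology \<Lambda> i S = subgroup_topology (BF_sub \<Lambda> i S)
     {ker_proj \<Lambda> i A \<inter> carrier (BF_sub \<Lambda> i S) | A. finite_symmetric \<Lambda> i A}"

definition admissible_topology ::
    "'l set \<Rightarrow> ('l \<Rightarrow> 'l) \<Rightarrow> 'l word set \<Rightarrow> 'l word set topology \<Rightarrow> bool" where
  "admissible_topology \<Lambda> i S T \<longleftrightarrow>
     topological_group (BF_sub \<Lambda> i S) T \<and>
     (\<forall>U. openin (natural_topology \<Lambda> i S) U \<longrightarrow> openin T U) \<and>
     T closure_of (finitary_part \<Lambda> i) = carrier (BF_sub \<Lambda> i S)"

section \<open>Generalized presentations\<close>

definition normal_closure :: "('g, 'm) monoid_scheme \<Rightarrow> 'g set \<Rightarrow> 'g set" where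
  "normal_closure G R = \<Inter>{N. N \<lhd> G \<and> R \<subseteq> N}"

definition smallest_closed_normal ::
    "('g, 'm) monoid_scheme \<Rightarrow> 'g topology \<Rightarrow> 'g set \<Rightarrow> 'g set \<Rightarrow> bool" where
  "smallest_closed_normal G T R K \<longleftrightarrow>
     K \<lhd> G \<and> closedin T K \<and> R \<subseteq> K \<and>
     (\<forall>N. N \<lhd> G \<and> closedin T N \<and> R \<subseteq> N \<longrightarrow> K \<subseteq> N)"

definition generalized_presentation ::
    "('h, 'm) monoid_scheme \<Rightarrow> 'l set \<Rightarrow> ('l \<Rightarrow> 'l) \<Rightarrow> 'l word set \<Rightarrow>
     'l word set topology \<Rightarrow> 'l word set set \<Rightarrow> bool" where
  "generalized_presentation H \<Lambda> i S T R \<longleftrightarrow>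
     group H \<and> free_involution \<Lambda> i \<and> admissible \<Lambda> i S \<and> one_letter ` \<Lambda> \<subseteq> S \<and>
     admissible_topology \<Lambda> i S T \<and> R \<subseteq> carrier (BF_sub \<Lambda> i S) \<and>
     (\<exists>p \<in> epi (BF_sub \<Lambda> i S) H.
        smallest_closed_normal (BF_sub \<Lambda> i S) T R (kernel (BF_sub \<Lambda> i S) H p))"

definition generalized_presentation_of_type ::
    "'c rel \<Rightarrow> ('h, 'm) monoid_scheme \<Rightarrow> 'l set \<Rightarrow> ('l \<Rightarrow> 'l) \<Rightarrow> 'l word set \<Rightarrow>
     'l word set topology \<Rightarrow> 'l word set set \<Rightarrow> bool" where
  "generalized_presentation_of_type c H \<Lambda> i S T R \<longleftrightarrow>
     generalized_presentation H \<Lambda> i S T R \<and> |\<Lambda>| \<le>o c \<and> |R| \<le>o c"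

section \<open>The free group of countably infinite rank\<close>

text \<open>\<open>(n, True)\<close> is the basis element with number \<open>n\<close>, and \<open>(n, False)\<close> is its inverse.\<close>

type_synonym letter = "nat \<times> bool"

definition linv :: "letter \<Rightarrow> letter" where
  "linv x = (fst x, \<not> snd x)"

definition basis :: "letter set" where
  "basis = {x. snd x}"

definition reduced :: "letter list \<Rightarrow> bool" where
  "reduced = successively (\<lambda>x y. y \<noteq> linv x)"

fun cancel_cons :: "letter \<Rightarrow> letter list \<Rightarrow> letter list" where
  "cancel_cons x [] = [x]"
| "cancel_cons x (y # w) = (if y = linv x then w else x # y # w)"

definition reduce :: "letter list \<Rightarrow> letter list" where
  "reduce w = foldr cancel_cons w []"

definition F_omega :: "letter list monoid" where
  "F_omega = \<lparr>carrier = {w. reduced w}, mult = (\<lambda>u v. reduce (u @ v)), one = []\<rparr>"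

text \<open>
  Extension of a map \<open>h\<close> on letters to an endomorphism, provided that \<open>h (linv x)\<close> is inverse to
  \<open>h x\<close>.
\<close>

definition extend :: "(letter \<Rightarrow> letter list) \<Rightarrow> letter list \<Rightarrow> letter list" where
  "extend h = (\<lambda>w \<in> carrier F_omega. reduce (concat (map h w)))"

text \<open>Automorphisms act on the right: in \<open>\<phi> \<otimes> \<psi>\<close> the factor \<open>\<phi>\<close> is applied first.\<close>

definition Aut_F_omega :: "(letter list \<Rightarrow> letter list) monoid" where
  "Aut_F_omega = (AutoGroup F_omega)
     \<lparr>mult := (\<lambda>\<phi> \<psi>. \<psi> \<otimes>\<^bsub>AutoGroup F_omega\<^esub> \<phi>)\<rparr>"

definition stabilizer_of :: "letter set \<Rightarrow> (letter list \<Rightarrow> letter list) set" where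
  "stabilizer_of Y = {\<alpha> \<in> carrier Aut_F_omega. \<forall>y\<in>Y. \<alpha> [y] = [y]}"

section \<open>The alphabet of elementary automorphisms\<close>

text \<open>
  The automorphism \<open>E_xy\<close> is encoded by the pair \<open>(x, y)\<close>; the encoding is faithful by lemma
  \<open>inj_on_elem_aut\<close> below.
\<close>

definition independent :: "letter \<Rightarrow> letter \<Rightarrow> bool" where
  "independent x y \<longleftrightarrow> y \<noteq> x \<and> y \<noteq> linv x"

definition Elem :: "(letter \<times> letter) set" where
  "Elem = {(x, y). independent x y}"

definition elem_inv :: "letter \<times> letter \<Rightarrow> letter \<times> letter" where
  "elem_inv = map_prod id linv"

definition elem_aut :: "letter \<times> letter \<Rightarrow> letter list \<Rightarrow> letter list" where
  "elem_aut = (\<lambda>(x, y). extend (\<lambda>z. if z = x then [x, y]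
                                   else if z = linv x then [linv y, linv x]
                                   else [z]))"

abbreviation lab1 :: "(letter \<times> letter) word \<Rightarrow> (letter \<times> letter) \<times> nat \<Rightarrow> letter" where
  "lab1 f s \<equiv> fst (lab f s)"
abbreviation lab2 :: "(letter \<times> letter) word \<Rightarrow> (letter \<times> letter) \<times> nat \<Rightarrow> letter" where
  "lab2 f s \<equiv> snd (lab f s)"

definition S0 :: "(letter \<times> letter) word set" where
  "S0 = {f \<in> words Elem. \<forall>x. finite {s \<in> idx f. lab1 f s = x}}"

definition S1 :: "(letter \<times> letter) word set" where
  "S1 = {f \<in> words Elem.
     \<not> (\<exists>\<phi> :: nat \<Rightarrow> (letter \<times> letter) \<times> nat.
          range \<phi> \<subseteq> idx f \<and> inj \<phi> \<and> (\<forall>m n. m \<le> n \<longrightarrow> (\<phi> m, \<phi> n) \<in> le f) \<and>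
          (\<forall>n. lab1 f (\<phi> (Suc n)) \<in> {lab2 f (\<phi> n), linv (lab2 f (\<phi> n))}))}"

definition S_Elem :: "(letter \<times> letter) word set" where
  "S_Elem = {f \<in> words Elem. f \<in> S0 \<and> f \<in> S1 \<and> bar_word elem_inv f \<in> S1}"

definition G_Elem :: "(letter \<times> letter) word set monoid" where
  "G_Elem = BF_sub Elem elem_inv S_Elem"

section \<open>The epimorphism onto the automorphism group\<close>

definition first_in :: "'l word \<Rightarrow> ('l \<times> nat) set \<Rightarrow> ('l \<times> nat) option" where
  "first_in f M = (if M = {} then None
                   else Some (THE s. s \<in> M \<and> (\<forall>t\<in>M. (s, t) \<in> le f)))"

text \<open>\<open>stage f x k\<close> is the pair of \<open>A_k\<close> and \<open>s_(k+1)\<close>, the latter being \<open>None\<close> once the process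
  has stopped.\<close>

primrec stage :: "(letter \<times> letter) word \<Rightarrow> letter \<Rightarrow> nat \<Rightarrow>
    letter set \<times> ((letter \<times> letter) \<times> nat) option" where
  "stage f x 0 = ({x, linv x}, first_in f {s \<in> idx f. lab1 f s \<in> {x, linv x}})"
| "stage f x (Suc k) = (case stage f x k of
     (A, None) \<Rightarrow> (A, None)
   | (A, Some s) \<Rightarrow>
       (let A' = A \<union> {lab2 f s, linv (lab2 f s)}
        in (A', first_in f {t \<in> idx f. (s, t) \<in> le f \<and> t \<noteq> s \<and> lab1 f t \<in> A'})))"

definition C_list :: "(letter \<times> letter) word \<Rightarrow> letter \<Rightarrow> ((letter \<times> letter) \<times> nat) list" where
  "C_list f x = map (\<lambda>k. the (snd (stage f x k))) [0..<(LEAST k. snd (stage f x k) = None)]"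

definition alpha :: "(letter \<times> letter) word \<Rightarrow> letter list \<Rightarrow> letter list" where
  "alpha f = extend (\<lambda>x. fold (\<lambda>s. elem_aut (lab f s)) (C_list f x) [x])"

text \<open>On \<open>G_Elem\<close> the set \<open>alpha ` (C \<inter> S_Elem)\<close> is a singleton, because \<open>alpha f\<close> depends only on the
  class of \<open>f \<in> S_Elem\<close>.\<close>

definition Psi :: "(letter \<times> letter) word set \<Rightarrow> letter list \<Rightarrow> letter list" where
  "Psi C = the_elem (alpha ` (C \<inter> S_Elem))"

definition U_nbhd :: "letter set \<Rightarrow> (letter \<times> letter) set \<Rightarrow> (letter \<times> letter) word set set" where
  "U_nbhd Y A = {g \<in> carrier G_Elem. Psi g \<in> stabilizer_of Y} \<inter> ker_proj Elem elem_inv A"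

definition T_Elem :: "(letter \<times> letter) word set topology" where
  "T_Elem = subgroup_topology G_Elem
     {U_nbhd Y A | Y A. finite Y \<and> Y \<subseteq> basis \<and> finite_symmetric Elem elem_inv A}"

section \<open>The relators\<close>

definition Egen :: "letter \<Rightarrow> letter \<Rightarrow> (letter \<times> letter) word set" where
  "Egen a b = word_class Elem elem_inv (one_letter (a, b))"

definition commutator :: "('g, 'm) monoid_scheme \<Rightarrow> 'g \<Rightarrow> 'g \<Rightarrow> 'g" where
  "commutator G u v = u \<otimes>\<^bsub>G\<^esub> v \<otimes>\<^bsub>G\<^esub> inv\<^bsub>G\<^esub> u \<otimes>\<^bsub>G\<^esub> inv\<^bsub>G\<^esub> v"

definition wgen :: "letter \<Rightarrow> letter \<Rightarrow> (letter \<times> letter) word set" where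
  "wgen a b = Egen b a \<otimes>\<^bsub>G_Elem\<^esub> Egen (linv a) b \<otimes>\<^bsub>G_Elem\<^esub> inv\<^bsub>G_Elem\<^esub> (Egen (linv b) a)"

definition sigma :: "letter \<Rightarrow> letter \<Rightarrow> letter \<Rightarrow> letter" where
  "sigma a b c = (if c = a then linv b else if c = linv a then b
                  else if c = b then a else if c = linv b then linv a else c)"

text \<open>The pair \<open>(U, V)\<close> stands for the relation \<open>U = V\<close>.\<close>

inductive_set relations ::
    "((letter \<times> letter) word set \<times> (letter \<times> letter) word set) set" where
  R1: "independent a b \<Longrightarrow> (inv\<^bsub>G_Elem\<^esub> (Egen a b), Egen a (linv b)) \<in> relations"
| R2: "\<lbrakk>independent a b; independent c d; a \<notin> {c, d, linv d}; b \<notin> {c, linv c}\<rbrakk> \<Longrightarrow>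
       (commutator G_Elem (Egen a b) (Egen c d), \<one>\<^bsub>G_Elem\<^esub>) \<in> relations"
| R3: "\<lbrakk>independent a b; independent b c; a \<notin> {c, linv c}\<rbrakk> \<Longrightarrow>
       (commutator G_Elem (Egen a b) (Egen b c), Egen a c) \<in> relations"
| R4: "\<lbrakk>independent a b; independent c d\<rbrakk> \<Longrightarrow>
       (inv\<^bsub>G_Elem\<^esub> (wgen a b) \<otimes>\<^bsub>G_Elem\<^esub> Egen c d \<otimes>\<^bsub>G_Elem\<^esub> wgen a b,
        Egen (sigma a b c) (sigma a b d)) \<in> relations"
| R5: "independent a b \<Longrightarrow> (wgen a b [^]\<^bsub>G_Elem\<^esub> (4::nat), \<one>\<^bsub>G_Elem\<^esub>) \<in> relations"

definition R_fin :: "(letter \<times> letter) word set set" where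
  "R_fin = (\<lambda>(U, V). U \<otimes>\<^bsub>G_Elem\<^esub> inv\<^bsub>G_Elem\<^esub> V) ` relations"

section \<open>Adequacy of the encodings\<close>

lemma index_universe:
  fixes f :: "'s \<Rightarrow> 'l"
  assumes "\<And>l. finite {s \<in> S. f s = l}"
  shows "\<exists>e :: 's \<Rightarrow> 'l \<times> nat. inj_on e S"
proof -
  have "\<exists>h :: 's \<Rightarrow> nat. inj_on h {s \<in> S. f s = l}" for l
    using finite_imp_inj_to_nat_seg[OF assms[of l]] by blast
  then obtain h :: "'l \<Rightarrow> 's \<Rightarrow> nat" where h: "\<And>l. inj_on (h l) {s \<in> S. f s = l}"
    by metis
  have "inj_on (\<lambda>s. (f s, h (f s) s)) S"
    by (rule inj_onI) (use h in \<open>auto simp: inj_on_def\<close>)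
  then show ?thesis by blast
qed

lemma inj_on_elem_aut: "inj_on elem_aut Elem"
proof (rule inj_onI)
  fix p q assume "p \<in> Elem" "q \<in> Elem" and eq: "elem_aut p = elem_aut q"
  then obtain x y x' y' where pq: "p = (x, y)" "q = (x', y')"
    and ind: "independent x y" "independent x' y'"
    by (auto simp: Elem_def)
  have "elem_aut (x, y) [x] = elem_aut (x', y') [x]"
    using eq pq by simp
  then show "p = q"
    using ind pq
    by (auto simp: elem_aut_def extend_def F_omega_def reduced_def reduce_def independent_def
        linv_def prod_eq_iff split: if_splits)
qed

end

theory Submission
  imports Defs "HOL-Library.Multiset" "HOL-Library.Countable_Set_Type"
begin

text \<open>
  Everything rests on one observation: the value of \<open>alpha f\<close> at a word is already computed by every
  sufficiently large finite subword of \<open>f\<close>. It makes \<open>Psi\<close> a well-defined homomorphism and gives the density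
  of the finitary part.

  The normal closure \<open>N\<close> of the relators lies in the kernel of \<open>Psi\<close>, which is closed. Conversely, for a finite
  \<open>A\<close> and a letter \<open>b\<close> that does not occur in \<open>A\<close>, relation \<open>R3\<close> reads \<open>E_ac = 1\<close> after projection to \<open>A\<close>;
  hence \<open>N\<close> projects onto the whole free group on \<open>A\<close>. As elements of \<open>N\<close> act trivially on all letters, this is enough
  to approximate every element of the kernel in the finer topology.

  For surjectivity, Nielsen reduction shows that an automorphism fixing \<open>x_1, \<dots>, x_m\<close> can be corrected by
  finitely many \<open>E_xy\<close>, with \<open>x\<close> not among \<open>x_1, \<dots>, x_m\<close>, so as to fix \<open>x_1, \<dots>, x_n\<close>. Applying this alternately
  to an automorphism and its inverse writes it as a product of two infinite products that are block triangular,
  and block triangular words belong to \<open>S_Elem\<close>.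
\<close>

text \<open>The natural topology is too coarse for the theorem: the normal closure of the relators
  is dense in it. The stabilizers in \<open>U_nbhd\<close> keep the kernel closed; they are not
  normal, so that being a group topology has to be verified through conjugates of neighborhoods.

  The obstacle to surjectivity is overlap. Raising the level of fixed letters from m to n uses
  corrections whose letters reach up to some N that is known only afterwards and may exceed n.
  Repeated on one side, the next correction would start at n, below N, and the infinite product need
  not be block triangular. Alternating sides repairs this: the step on the other side takes a level
  above N as its target, so the next correction on the first side starts beyond everything used
  there before, and the ranges of each side tile the letters.

  Nielsen reduction is therefore needed in a relative form: only letters from m on are altered, but
  fixed letters may still serve as multipliers.\<close>

declare split_paired_All [simp del] split_paired_Ex [simp del]

section \<open>The free group\<close>

definition finv :: "letter list \<Rightarrow> letter list" where
  "finv w = rev (map linv w)"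

lemma linv_linv [simp]: "linv (linv x) = x"
  by (simp add: linv_def prod_eq_iff)

lemma linv_neq [simp]: "linv x \<noteq> x" "x \<noteq> linv x"
  by (simp_all add: linv_def prod_eq_iff)

lemma linv_eq_iff [simp]: "linv x = linv y \<longleftrightarrow> x = y"
  by (metis linv_linv)

lemma linv_swap: "linv x = y \<longleftrightarrow> x = linv y"
  by (metis linv_linv)

lemma fst_linv [simp]: "fst (linv x) = fst x"
  by (simp add: linv_def)

lemma fst_eq_letter: "fst x = fst y \<longleftrightarrow> x = y \<or> x = linv y"
  by (auto simp: linv_def prod_eq_iff)

lemma independent_iff: "independent x y \<longleftrightarrow> fst x \<noteq> fst y"
  by (auto simp: independent_def fst_eq_letter linv_swap)

lemma independent_neqs:
  assumes "independent x y"
  shows "x \<noteq> y" "y \<noteq> x" "linv x \<noteq> y" "y \<noteq> linv x" "linv y \<noteq> x" "x \<noteq> linv y"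
  using assms by (auto simp: independent_iff fst_eq_letter)

lemma finv_simps [simp]:
  "finv [] = []" "finv (x # w) = finv w @ [linv x]" "finv (u @ v) = finv v @ finv u"
  "finv (finv w) = w" "length (finv w) = length w"
  by (simp_all add: finv_def rev_map comp_def)

lemma reduced_Nil [simp]: "reduced []"
  by (simp add: reduced_def)

lemma reduced_single [simp]: "reduced [x]"
  by (simp add: reduced_def)

lemma reduced_Cons: "reduced (x # w) \<longleftrightarrow> reduced w \<and> (w = [] \<or> hd w \<noteq> linv x)"
  by (cases w) (auto simp: reduced_def)

lemma reduced_append:
  "reduced (u @ v) \<longleftrightarrow> reduced u \<and> reduced v \<and> (u = [] \<or> v = [] \<or> hd v \<noteq> linv (last u))"
  by (auto simp: reduced_def successively_append_iff)

lemma reduced_append_overlap: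
  "reduced (u @ s) \<Longrightarrow> reduced (s @ v) \<Longrightarrow> s \<noteq> [] \<Longrightarrow> reduced (u @ s @ v)"
  by (auto simp: reduced_append)

lemma reduced_finv [simp]: "reduced (finv w) \<longleftrightarrow> reduced w"
proof -
  have "reduced (finv w)" if "reduced w" for w
    using that
  proof (induction w)
    case (Cons x w)
    then show ?case
      by (cases w) (auto simp: reduced_append reduced_Cons)
  qed simp
  from this[of w] this[of "finv w"] show ?thesis by auto
qed

lemma reduced_cancel_cons: "reduced w \<Longrightarrow> reduced (cancel_cons x w)"
  by (cases w) (auto simp: reduced_Cons)

text \<open>Van der Waerden's device: every letter permutes the reduced words, and its inverse
  letter acts as the inverse permutation. As \<open>reduce\<close> is the action on the empty word,
  associativity follows without a confluence argument.\<close>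

lemma cancel_cons_linv: "reduced w \<Longrightarrow> cancel_cons (linv x) (cancel_cons x w) = w"
  by (cases w rule: remdups_adj.cases) (auto simp: reduced_Cons)

lemma cancel_cons_linv': "reduced w \<Longrightarrow> cancel_cons x (cancel_cons (linv x) w) = w"
  using cancel_cons_linv[of w "linv x"] by simp

lemma reduced_foldr: "reduced v \<Longrightarrow> reduced (foldr cancel_cons u v)"
  by (induction u) (auto simp: reduced_cancel_cons)

lemma reduced_reduce [simp]: "reduced (reduce w)"
  by (simp add: reduce_def reduced_foldr)

lemma reduce_Nil [simp]: "reduce [] = []"
  by (simp add: reduce_def)

lemma reduce_Cons: "reduce (x # w) = cancel_cons x (reduce w)"
  by (simp add: reduce_def)

lemma reduce_id [simp]: "reduced w \<Longrightarrow> reduce w = w"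
proof (induction w)
  case (Cons x w)
  then show ?case by (cases w) (auto simp: reduce_Cons reduced_Cons)
qed simp

lemma reduce_append: "reduce (u @ v) = foldr cancel_cons u (reduce v)"
  by (simp add: reduce_def)

lemma foldr_cancel_cons:
  assumes "reduced w"
  shows "foldr cancel_cons (cancel_cons x u) w = cancel_cons x (foldr cancel_cons u w)"
  using assms by (cases u) (auto simp: cancel_cons_linv' reduced_foldr)

text \<open>A word and its reduced form induce the same permutation of the reduced words; hence
  inner reductions can always be dropped.\<close>

lemma foldr_reduce: "reduced w \<Longrightarrow> foldr cancel_cons (reduce u) w = foldr cancel_cons u w"
  by (induction u) (auto simp: reduce_Cons foldr_cancel_cons)

lemma reduce_reduce1 [simp]: "reduce (reduce u @ v) = reduce (u @ v)"
  by (simp add: reduce_append foldr_reduce)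

lemma reduce_reduce2 [simp]: "reduce (u @ reduce v) = reduce (u @ v)"
  by (simp add: reduce_append)

lemma reduce_reduce_mid: "reduce (u @ reduce v @ w) = reduce (u @ v @ w)"
  by (metis reduce_reduce1 reduce_reduce2)

lemma reduce_finv_left [simp]: "reduce (finv w @ w) = []"
proof (induction w)
  case (Cons x w)
  have "reduce (finv (x # w) @ (x # w)) = reduce (finv w @ reduce ([linv x] @ [x] @ w))"
    by simp
  also have "reduce ([linv x] @ [x] @ w) = reduce w"
    by (simp add: reduce_Cons cancel_cons_linv)
  finally show ?case by (simp add: Cons)
qed simp

lemma reduce_finv_right [simp]: "reduce (w @ finv w) = []"
  using reduce_finv_left[of "finv w"] by simp

lemma reduce_cancel: "reduce (u @ w @ finv w @ v) = reduce (u @ v)"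
  using reduce_reduce_mid[of u "w @ finv w" v] by simp

lemma reduce_cancel': "reduce (u @ finv w @ w @ v) = reduce (u @ v)"
  using reduce_cancel[of u "finv w" v] by simp

lemma reduce_finv: "reduce (finv w) = finv (reduce w)"
proof -
  have "finv (reduce w) = reduce (finv (reduce w))"
    by simp
  also have "\<dots> = reduce (finv (reduce w) @ reduce (w @ finv w))"
    by simp
  also have "\<dots> = reduce (finv (reduce w) @ w @ finv w)"
    by (simp only: reduce_reduce2)
  also have "\<dots> = reduce (finv (reduce w) @ reduce w @ finv w)"
    by (metis reduce_reduce1 reduce_reduce2)
  also have "\<dots> = reduce (finv w)"
    using reduce_cancel'[of "[]" "reduce w" "finv w"] by simp
  finally show ?thesis by simp
qed

lemma reduce_prod_eq_Nil: "reduce (u @ v) = [] \<Longrightarrow> reduce v = finv (reduce u)"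
proof -
  assume h: "reduce (u @ v) = []"
  have "reduce v = reduce (finv u @ u @ v)"
    using reduce_cancel'[of "[]" u v] by simp
  also have "\<dots> = reduce (finv u @ reduce (u @ v))"
    by simp
  finally show ?thesis
    using h by (simp add: reduce_finv)
qed

lemma carrier_F [simp]: "w \<in> carrier F_omega \<longleftrightarrow> reduced w"
  by (simp add: F_omega_def)

lemma mult_F [simp]: "u \<otimes>\<^bsub>F_omega\<^esub> v = reduce (u @ v)"
  by (simp add: F_omega_def)

lemma one_F [simp]: "\<one>\<^bsub>F_omega\<^esub> = []"
  by (simp add: F_omega_def)

lemma group_F: "group F_omega"
proof (rule groupI)
  fix x assume "x \<in> carrier F_omega"
  then show "\<exists>y\<in>carrier F_omega. y \<otimes>\<^bsub>F_omega\<^esub> x = \<one>\<^bsub>F_omega\<^esub>"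
    by (intro bexI[of _ "finv x"]) auto
qed auto

text \<open>The segment that disappears is recorded as \<open>p\<close>, oriented as at the head of
  \<open>v\<close>. Peeling letters off the end of \<open>u\<close> decides at each step whether the
  seam still cancels.\<close>

lemma cancellation:
  assumes "reduced u" "reduced v"
  obtains u' p v' where "u = u' @ finv p" "v = p @ v'" "reduced (u' @ v')" "reduce (u @ v) = u' @ v'"
proof -
  have "\<exists>u' p v'. u = u' @ finv p \<and> v = p @ v' \<and> reduced (u' @ v') \<and> reduce (u @ v) = u' @ v'"
    using assms
  proof (induction u arbitrary: v rule: rev_induct)
    case Nil
    then show ?case by (auto intro!: exI[of _ "[]"])
  next
    case (snoc x u)
    show ?case
    proof (cases "v \<noteq> [] \<and> hd v = linv x")
      case True
      then obtain v1 where v: "v = linv x # v1" by (cases v) auto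
      have "reduced u" "reduced v1"
        using snoc.prems v by (auto simp: reduced_append reduced_Cons)
      from snoc.IH[OF this] obtain u' p v' where
        *: "u = u' @ finv p" "v1 = p @ v'" "reduced (u' @ v')" "reduce (u @ v1) = u' @ v'"
        by blast
      have "reduce ((u @ [x]) @ v) = reduce (u @ v1)"
        using reduce_cancel[of u "[x]" v1] v by simp
      then show ?thesis
        using * v by (intro exI[of _ u'] exI[of _ "linv x # p"] exI[of _ v']) auto
    next
      case False
      then have "reduced ((u @ [x]) @ v)"
        using snoc.prems by (subst reduced_append) auto
      then show ?thesis
        by (intro exI[of _ "u @ [x]"] exI[of _ "[]"] exI[of _ v]) (auto simp del: append_assoc)
    qed
  qed
  then show ?thesis using that by blast
qed

section \<open>Endomorphisms and automorphisms\<close>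

definition subst_word :: "(letter \<Rightarrow> letter list) \<Rightarrow> letter list \<Rightarrow> letter list" where
  "subst_word h w = reduce (concat (map h w))"

text \<open>The only relations to be respected when a map on letters is extended to the free group,
  because inverses of basis elements are letters of their own.\<close>

definition inv_compat :: "(letter \<Rightarrow> letter list) \<Rightarrow> bool" where
  "inv_compat h \<longleftrightarrow> (\<forall>x. reduce (h x @ h (linv x)) = [])"

lemma subst_word_append: "subst_word h (u @ v) = reduce (subst_word h u @ subst_word h v)"
  by (simp add: subst_word_def)

lemma subst_word_Cons: "subst_word h (x # v) = reduce (h x @ subst_word h v)"
  by (simp add: subst_word_def)

lemma subst_word_Nil [simp]: "subst_word h [] = []"
  by (simp add: subst_word_def)

lemma reduced_subst_word [simp]: "reduced (subst_word h w)"
  by (simp add: subst_word_def)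

lemma subst_word_cancel_cons:
  assumes "inv_compat h"
  shows "subst_word h (cancel_cons x w) = subst_word h (x # w)"
proof (cases w)
  case (Cons y v)
  show ?thesis
  proof (cases "y = linv x")
    case True
    have "subst_word h (x # w) = reduce (reduce (h x @ h (linv x)) @ concat (map h v))"
      unfolding Cons True by (simp add: subst_word_def)
    also have "reduce (h x @ h (linv x)) = []"
      using assms unfolding inv_compat_def by blast
    finally show ?thesis
      using Cons True by (simp add: subst_word_def)
  qed (use Cons in simp)
qed simp

lemma subst_word_reduce: "inv_compat h \<Longrightarrow> subst_word h (reduce w) = subst_word h w"
  by (induction w) (auto simp: reduce_Cons subst_word_cancel_cons subst_word_Cons)

lemma extend_eq: "reduced w \<Longrightarrow> extend h w = subst_word h w"
  by (simp add: extend_def subst_word_def)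

lemma extend_in_hom:
  assumes "inv_compat h"
  shows "extend h \<in> hom F_omega F_omega"
  using subst_word_reduce[OF assms] by (auto simp: hom_def extend_eq subst_word_append)

lemma hom_F_Nil: "\<phi> \<in> hom F_omega F_omega \<Longrightarrow> \<phi> [] = []"
  using hom_one[OF _ group_F group_F, of \<phi>] by simp

lemma hom_F_reduced: "\<phi> \<in> hom F_omega F_omega \<Longrightarrow> reduced w \<Longrightarrow> reduced (\<phi> w)"
  by (auto simp: hom_def Pi_def)

lemma hom_F_mult:
  "\<phi> \<in> hom F_omega F_omega \<Longrightarrow> reduced u \<Longrightarrow> reduced v \<Longrightarrow> \<phi> (reduce (u @ v)) = reduce (\<phi> u @ \<phi> v)"
  by (auto simp: hom_def)

lemma hom_F_reduce:
  assumes "\<phi> \<in> hom F_omega F_omega"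
  shows "\<phi> (reduce w) = subst_word (\<lambda>x. \<phi> [x]) w"
proof (induction w)
  case (Cons x w)
  have "\<phi> (reduce (x # w)) = \<phi> (reduce ([x] @ reduce w))"
    using reduce_reduce2[of "[x]" w] by simp
  also have "\<dots> = reduce (\<phi> [x] @ \<phi> (reduce w))"
    by (rule hom_F_mult[OF assms]) auto
  finally show ?case by (simp add: Cons subst_word_Cons)
qed (simp add: hom_F_Nil assms)

lemma hom_F_subst_word: "\<phi> \<in> hom F_omega F_omega \<Longrightarrow> reduced w \<Longrightarrow> \<phi> w = subst_word (\<lambda>x. \<phi> [x]) w"
  using hom_F_reduce[of \<phi> w] by simp

lemma hom_F_finv:
  assumes "\<phi> \<in> hom F_omega F_omega" "reduced w"
  shows "\<phi> (finv w) = finv (\<phi> w)"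
proof -
  have "reduce (\<phi> w @ \<phi> (finv w)) = []"
    using hom_F_mult[OF assms(1), of w "finv w"] assms by (simp add: hom_F_Nil)
  from reduce_prod_eq_Nil[OF this] show ?thesis
    using assms by (simp add: hom_F_reduced)
qed

lemma hom_F_linv:
  "\<phi> \<in> hom F_omega F_omega \<Longrightarrow> \<phi> [linv x] = finv (\<phi> [x])"
  using hom_F_finv[of \<phi> "[x]"] by simp

lemma subst_word_cong: "(\<And>x. x \<in> set w \<Longrightarrow> h x = k x) \<Longrightarrow> subst_word h w = subst_word k w"
  unfolding subst_word_def by (metis map_cong)

lemma subst_word_single: "subst_word (\<lambda>x. [x]) w = reduce w"
  by (simp add: subst_word_def concat_map_singleton[of "\<lambda>x. x", simplified])

lemma hom_F_eqI:
  assumes "\<phi> \<in> hom F_omega F_omega" "\<psi> \<in> hom F_omega F_omega" "reduced w"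
    and "\<And>x. x \<in> set w \<Longrightarrow> \<phi> [x] = \<psi> [x]"
  shows "\<phi> w = \<psi> w"
  using hom_F_subst_word[OF assms(1,3)] hom_F_subst_word[OF assms(2,3)] subst_word_cong[of w "\<lambda>x. \<phi> [x]" "\<lambda>x. \<psi> [x]"]
    assms(4) by simp

lemma carrier_Aut:
  "\<alpha> \<in> carrier Aut_F_omega \<longleftrightarrow>
     \<alpha> \<in> hom F_omega F_omega \<and> \<alpha> \<in> extensional (carrier F_omega) \<and>
     bij_betw \<alpha> (carrier F_omega) (carrier F_omega)"
  by (auto simp: Aut_F_omega_def AutoGroup_def auto_def Bij_def)

abbreviation aut_mult (infixl "\<cdot>" 70) where
  "\<alpha> \<cdot> \<beta> \<equiv> \<alpha> \<otimes>\<^bsub>Aut_F_omega\<^esub> \<beta>"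

abbreviation aut_inv ("inv\<^sub>A _" [81] 80) where
  "inv\<^sub>A \<alpha> \<equiv> inv\<^bsub>Aut_F_omega\<^esub> \<alpha>"

abbreviation aut_one ("\<one>\<^sub>A") where
  "\<one>\<^sub>A \<equiv> \<one>\<^bsub>Aut_F_omega\<^esub>"

lemma mult_Aut:
  assumes "\<alpha> \<in> carrier Aut_F_omega" "\<beta> \<in> carrier Aut_F_omega"
  shows "\<alpha> \<cdot> \<beta> = compose (carrier F_omega) \<beta> \<alpha>"
  using assms by (auto simp: Aut_F_omega_def AutoGroup_def auto_def BijGroup_def)

lemma one_Aut: "\<one>\<^sub>A = (\<lambda>x\<in>carrier F_omega. x)"
  by (simp add: Aut_F_omega_def AutoGroup_def BijGroup_def)

lemma group_Aut: "group Aut_F_omega"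
proof -
  interpret A: group "AutoGroup F_omega"
    by (rule group.AutoGroup[OF group_F])
  have c: "carrier Aut_F_omega = carrier (AutoGroup F_omega)"
    and m: "\<And>x y. x \<cdot> y = y \<otimes>\<^bsub>AutoGroup F_omega\<^esub> x"
    and o: "\<one>\<^sub>A = \<one>\<^bsub>AutoGroup F_omega\<^esub>"
    by (simp_all add: Aut_F_omega_def)
  show ?thesis
  proof (rule groupI, unfold c m o)
    fix x assume x: "x \<in> carrier (AutoGroup F_omega)"
    then show "\<exists>y\<in>carrier (AutoGroup F_omega). x \<otimes>\<^bsub>AutoGroup F_omega\<^esub> y = \<one>\<^bsub>AutoGroup F_omega\<^esub>"
      by (intro bexI[of _ "inv\<^bsub>AutoGroup F_omega\<^esub> x"]) auto
  qed (auto simp: A.m_assoc)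
qed

lemma mult_Aut_apply:
  "\<alpha> \<in> carrier Aut_F_omega \<Longrightarrow> \<beta> \<in> carrier Aut_F_omega \<Longrightarrow> reduced w \<Longrightarrow>
   (\<alpha> \<cdot> \<beta>) w = \<beta> (\<alpha> w)"
  by (simp add: mult_Aut compose_eq)

lemma one_Aut_apply: "reduced w \<Longrightarrow> \<one>\<^sub>A w = w"
  by (simp add: one_Aut)

lemma Aut_hom: "\<alpha> \<in> carrier Aut_F_omega \<Longrightarrow> \<alpha> \<in> hom F_omega F_omega"
  by (simp add: carrier_Aut)

lemma Aut_inj: "\<alpha> \<in> carrier Aut_F_omega \<Longrightarrow> reduced u \<Longrightarrow> reduced v \<Longrightarrow> \<alpha> u = \<alpha> v \<Longrightarrow> u = v"
  by (auto simp: carrier_Aut bij_betw_def inj_on_def)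

lemma Aut_surj:
  assumes "\<alpha> \<in> carrier Aut_F_omega" "reduced v"
  obtains u where "reduced u" "\<alpha> u = v"
proof -
  have "v \<in> \<alpha> ` carrier F_omega"
    using assms by (simp add: carrier_Aut bij_betw_def)
  then show ?thesis using that by auto
qed

lemma Aut_eqI:
  assumes "\<alpha> \<in> carrier Aut_F_omega" "\<beta> \<in> carrier Aut_F_omega" "\<And>x. \<alpha> [x] = \<beta> [x]"
  shows "\<alpha> = \<beta>"
proof
  fix w
  show "\<alpha> w = \<beta> w"
  proof (cases "reduced w")
    case True
    then show ?thesis
      using hom_F_eqI[OF Aut_hom Aut_hom] assms by blast
  next
    case False
    then show ?thesis
      using assms by (auto simp: carrier_Aut extensional_def)
  qed
qed

lemma Aut_inv_apply:
  assumes "\<alpha> \<in> carrier Aut_F_omega" "reduced w" "\<alpha> w = v"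
  shows "(inv\<^sub>A \<alpha>) v = w"
proof -
  interpret A: group Aut_F_omega by (rule group_Aut)
  have "(inv\<^sub>A \<alpha>) (\<alpha> w) = (\<alpha> \<cdot> inv\<^sub>A \<alpha>) w"
    by (rule mult_Aut_apply[symmetric]) (use assms in auto)
  also have "\<dots> = \<one>\<^sub>A w"
    using assms by (simp only: A.r_inv)
  finally show ?thesis using assms by (simp add: one_Aut_apply)
qed

text \<open>Both composites are the identity as soon as they fix all letters, so
  \<open>extend k\<close> is a two-sided inverse.\<close>

lemma extend_in_AutI:
  assumes "inv_compat h" "inv_compat k"
    and hk: "\<And>x. subst_word k (h x) = [x]" and kh: "\<And>x. subst_word h (k x) = [x]"
  shows "extend h \<in> carrier Aut_F_omega"
proof -
  have *: "subst_word k (subst_word h w) = w" if "reduced w" "inv_compat k" "\<And>x. subst_word k (h x) = [x]" for h k w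
  proof -
    have "subst_word k (subst_word h w) = reduce w"
      using that
    proof (induction w)
      case (Cons x w)
      have "subst_word k (subst_word h (x # w)) = subst_word k (h x @ subst_word h w)"
        by (simp add: subst_word_Cons subst_word_reduce Cons.prems)
      also have "\<dots> = reduce ([x] @ w)"
        using Cons by (simp add: subst_word_append reduced_Cons)
      finally show ?case by simp
    qed simp
    then show ?thesis using that by simp
  qed
  have "bij_betw (extend h) (carrier F_omega) (carrier F_omega)"
    by (rule bij_betwI[where g = "extend k"]) (auto simp: extend_eq * assms)
  moreover have "extend h \<in> extensional (carrier F_omega)"
    by (simp add: extend_def)
  ultimately show ?thesis
    using extend_in_hom[OF assms(1)] by (simp add: carrier_Aut)
qed

subsection \<open>Elementary automorphisms\<close>

lemma elem_aut_extend:
  "elem_aut (x, y) = extend (\<lambda>z. if z = x then [x, y] else if z = linv x then [linv y, linv x] else [z])"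
  by (simp add: elem_aut_def)

lemma inv_compat_elem:
  "inv_compat (\<lambda>z. if z = x then [x, y] else if z = linv x then [linv y, linv x] else [z])"
  unfolding inv_compat_def by (auto simp: reduce_Cons)

lemma elem_aut_letter:
  assumes "independent x y"
  shows "elem_aut (x, y) [z] =
    (if z = x then [x, y] else if z = linv x then [linv y, linv x] else [z])"
  using independent_neqs[OF assms] unfolding elem_aut_extend
  by (auto simp: extend_eq subst_word_def reduce_Cons)

lemma elem_aut_in_Aut [simp]:
  assumes "e \<in> Elem"
  shows "elem_aut e \<in> carrier Aut_F_omega"
proof -
  obtain x y where e: "e = (x, y)" "independent x y"
    using assms by (auto simp: Elem_def)
  note n = independent_neqs[OF e(2)]
  show ?thesis
    unfolding e(1) elem_aut_extend
    by (rule extend_in_AutI[OF inv_compat_elem inv_compat_elem[of x "linv y"]])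
       (use n in \<open>auto simp: subst_word_def reduce_Cons\<close>)
qed

lemma elem_aut_fix:
  assumes "e \<in> Elem" "fst z \<noteq> fst (fst e)"
  shows "elem_aut e [z] = [z]"
proof -
  have "elem_aut (fst e, snd e) [z] = [z]"
    using assms by (subst elem_aut_letter) (auto simp: Elem_def)
  then show ?thesis by simp
qed

lemma elem_inv_Elem [simp]: "e \<in> Elem \<Longrightarrow> elem_inv e \<in> Elem"
  by (auto simp: Elem_def elem_inv_def independent_iff linv_def)

lemma elem_inv_elem_inv [simp]: "elem_inv (elem_inv e) = e"
  by (cases e) (simp add: elem_inv_def)

lemma fst_elem_inv [simp]: "fst (elem_inv e) = fst e"
  by (simp add: elem_inv_def)

lemma snd_elem_inv [simp]: "snd (elem_inv e) = linv (snd e)"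
  by (simp add: elem_inv_def)

lemma elem_aut_inv_mult:
  assumes "e \<in> Elem"
  shows "elem_aut e \<cdot> elem_aut (elem_inv e) = \<one>\<^sub>A"
proof -
  interpret A: group Aut_F_omega by (rule group_Aut)
  obtain x y where e: "e = (x, y)" "independent x y"
    using assms by (auto simp: Elem_def)
  then have i: "independent x (linv y)" by (simp add: independent_iff)
  note n = independent_neqs[OF e(2)]
  show ?thesis
  proof (rule Aut_eqI)
    fix z
    have "elem_aut (x, linv y) [x, y] = [x]" "elem_aut (x, linv y) [linv y, linv x] = [linv x]"
      using n unfolding elem_aut_extend
      by (auto simp: extend_eq subst_word_def reduce_Cons reduced_Cons)
    then show "(elem_aut e \<cdot> elem_aut (elem_inv e)) [z] = \<one>\<^sub>A [z]"
      using e i elem_aut_in_Aut[of "(x, y)"] elem_aut_in_Aut[of "(x, linv y)"]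
      by (auto simp: mult_Aut_apply elem_aut_letter elem_inv_def one_Aut_apply Elem_def)
  qed (use assms in auto)
qed

lemma inv_elem_aut:
  assumes "e \<in> Elem"
  shows "inv\<^sub>A (elem_aut e) = elem_aut (elem_inv e)"
proof -
  interpret A: group Aut_F_omega by (rule group_Aut)
  show ?thesis
    using elem_aut_inv_mult[of "elem_inv e"] assms by (intro A.inv_equality) auto
qed

section \<open>Finite products of elementary automorphisms\<close>

fun elem_prod :: "(letter \<times> letter) list \<Rightarrow> letter list \<Rightarrow> letter list" where
  "elem_prod [] = \<one>\<^sub>A"
| "elem_prod (e # es) = elem_aut e \<cdot> elem_prod es"

definition einv :: "(letter \<times> letter) list \<Rightarrow> (letter \<times> letter) list" where
  "einv es = rev (map elem_inv es)"

lemma elem_prod_in_Aut [simp]: "set es \<subseteq> Elem \<Longrightarrow> elem_prod es \<in> carrier Aut_F_omega"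
proof (induction es)
  case Nil
  then show ?case using group_Aut by (simp add: group.is_monoid)
next
  case (Cons e es)
  then show ?case by (simp add: group.is_monoid group_Aut monoid.m_closed)
qed

lemma elem_prod_append:
  "set es \<subseteq> Elem \<Longrightarrow> set fs \<subseteq> Elem \<Longrightarrow> elem_prod (es @ fs) = elem_prod es \<cdot> elem_prod fs"
proof (induction es)
  case (Cons e es)
  interpret A: group Aut_F_omega by (rule group_Aut)
  show ?case using Cons by (simp add: A.m_assoc)
qed (simp add: group_Aut group.is_monoid)

lemma set_einv [simp]: "set es \<subseteq> Elem \<Longrightarrow> set (einv es) \<subseteq> Elem"
  by (auto simp: einv_def)

lemma elem_prod_einv:
  assumes "set es \<subseteq> Elem"
  shows "elem_prod (einv es) = inv\<^sub>A (elem_prod es)"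
  using assms
proof (induction es)
  case Nil
  interpret A: group Aut_F_omega by (rule group_Aut)
  show ?case by (simp add: einv_def)
next
  case (Cons e es)
  interpret A: group Aut_F_omega by (rule group_Aut)
  have "einv (e # es) = einv es @ [elem_inv e]"
    by (simp add: einv_def)
  then show ?case
    using Cons set_einv[of es] by (simp add: elem_prod_append A.inv_mult_group inv_elem_aut)
qed

lemma fold_elem_aut: "set es \<subseteq> Elem \<Longrightarrow> reduced w \<Longrightarrow> fold elem_aut es w = elem_prod es w"
proof (induction es arbitrary: w)
  case (Cons e es)
  have "reduced (elem_aut e w)"
    by (rule hom_F_reduced[OF Aut_hom]) (use Cons in auto)
  then show ?case using Cons by (simp add: mult_Aut_apply)
qed (simp add: one_Aut_apply)

lemma elem_prod_fix:
  assumes "set es \<subseteq> Elem" "\<And>e. e \<in> set es \<Longrightarrow> fst (fst e) \<noteq> fst z"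
  shows "elem_prod es [z] = [z]"
  using assms
proof (induction es)
  case (Cons e es)
  have "elem_aut e [z] = [z]"
    using Cons.prems(1) Cons.prems(2)[of e] by (intro elem_aut_fix) auto
  then show ?case using Cons by (simp add: mult_Aut_apply)
qed (simp add: one_Aut_apply)

section \<open>Nielsen reduction\<close>

text \<open>A numbering of the letters by twice the index plus the sign; what matters is that it
  yields a total well-founded order.\<close>

definition letter_ord :: "letter rel" where
  "letter_ord = inv_image less_than (\<lambda>x. 2 * fst x + of_bool (snd x))"

lemma wf_letter_ord: "wf letter_ord"
  by (simp add: letter_ord_def wf_inv_image)

lemma irrefl_letter_ord: "irrefl letter_ord"
  by (simp add: letter_ord_def irrefl_def)

lemma total_letter_ord: "total letter_ord"
proof -
  have "x = y" if "2 * fst x + of_bool (snd x) = (2 * fst y + of_bool (snd y) :: nat)" for x y :: letter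
  proof -
    have "snd x = snd y"
      using arg_cong[OF that, of even] by (cases "snd x"; cases "snd y") simp_all
    then show ?thesis using that by (simp add: prod_eq_iff)
  qed
  then show ?thesis
    unfolding letter_ord_def total_on_def in_inv_image less_than_iff
    using linorder_neqE_nat by blast
qed

definition half :: "letter list \<Rightarrow> letter list" where
  "half w = take ((length w + 1) div 2) w"

lemma half_append: "length y \<le> length x \<Longrightarrow> half (x @ y) = take ((length x + length y + 1) div 2) x"
  by (simp add: half_def)

text \<open>The moves of relative Nielsen reduction: only letters with index from \<open>m\<close>
  on are altered, while the multiplier may have any index below \<open>N\<close>, so that fixed
  letters still help to shorten the others.\<close>

definition elem_range :: "nat \<Rightarrow> nat \<Rightarrow> (letter \<times> letter) set" where
  "elem_range m N = {(a, b). fst a \<noteq> fst b \<and> m \<le> fst a \<and> fst a < N \<and> fst b < N}"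

lemma elem_range_Elem: "elem_range m N \<subseteq> Elem"
  by (auto simp: elem_range_def Elem_def independent_iff)

lemma elem_range_mono: "m' \<le> m \<Longrightarrow> N \<le> N' \<Longrightarrow> elem_range m N \<subseteq> elem_range m' N'"
  by (auto simp: elem_range_def)

definition letter_range :: "nat \<Rightarrow> nat \<Rightarrow> letter set" where
  "letter_range m N = {m..<N} \<times> UNIV"

lemma finite_letter_range [simp]: "finite (letter_range m N)"
  by (simp add: letter_range_def)

lemma mem_letter_range: "a \<in> letter_range m N \<longleftrightarrow> m \<le> fst a \<and> fst a < N"
  by (cases a) (auto simp: letter_range_def)

lemma sum_letter_range:
  assumes "a \<in> letter_range m N"
  shows "sum f (letter_range m N) = f a + f (linv a) + sum f (letter_range m N - {a, linv a})"
proof -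
  have "linv a \<in> letter_range m N" using assms by (simp add: mem_letter_range)
  then show ?thesis
    using sum.subset_diff[of "{a, linv a}" "letter_range m N" f] assms by (simp add: add.commute)
qed

text \<open>Once the total length is minimal, no letter loses more than half of its image against a neighbour; the
  multiset of initial halves breaks the ties in which an image is cancelled half by half by its two neighbours.\<close>

definition potential :: "nat \<Rightarrow> nat \<Rightarrow> (letter list \<Rightarrow> letter list) \<Rightarrow> nat \<times> letter list multiset" where
  "potential m N \<gamma> = (\<Sum>a\<in>letter_range m N. length (\<gamma> [a]), \<Sum>a\<in>letter_range m N. {#half (\<gamma> [a])#})"

text \<open>Total length decides first; ties are resolved by the multiset extension of the
  length-lexicographic order on words.\<close>

definition potential_ord :: "(nat \<times> letter list multiset) rel" where
  "potential_ord = less_than <*lex*> mult (lenlex letter_ord)"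

lemma wf_potential_ord: "wf potential_ord"
  unfolding potential_ord_def by (intro wf_lex_prod wf_less_than wf_mult wf_lenlex wf_letter_ord)

text \<open>A free group has no element of order two. Stripping the first and last letter, which are
  inverse to each other, leads to a single self-inverse letter or to an adjacent cancelling pair,
  both impossible.\<close>

lemma finv_fixpoint: "reduced s \<Longrightarrow> s = finv s \<Longrightarrow> s = []"
proof (induction "length s" arbitrary: s rule: less_induct)
  case less
  show ?case
  proof (cases s)
    case (Cons x w)
    show ?thesis
    proof (cases w rule: rev_cases)
      case Nil
      have "[x] = [linv x]"
        using less.prems(2) unfolding Cons Nil finv_simps append_Nil .
      then show ?thesis
        using linv_neq(2)[of x] by blast
    next
      case (snoc w' y)
      have "x # (w' @ [y]) = linv y # (finv w' @ [linv x])"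
        using less.prems(2) unfolding Cons snoc finv_simps append_Cons append_Nil .
      from iffD1[OF append1_eq_conv conjunct2[OF iffD1[OF list.inject this]]]
      have w': "w' = finv w'" and y: "y = linv x" by blast+
      moreover have "reduced w'"
        using less.prems(1) unfolding Cons snoc by (simp add: reduced_Cons reduced_append)
      moreover have "length w' < length s" unfolding Cons snoc by simp
      ultimately have "w' = []"
        using less.hyps[OF _ _ w'] by blast
      then show ?thesis
        using less.prems(1) y unfolding Cons snoc by (simp add: reduced_Cons)
    qed
  qed
qed

text \<open>Covers the product of a letter's image with itself, for which there is no elementary
  move. If more than half of \<open>u\<close> cancelled in the square, the two cancelled pieces of
  \<open>u\<close> would overlap in a word equal to its own inverse.\<close>

lemma length_square: "reduced u \<Longrightarrow> length u \<le> length (reduce (u @ u))"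
proof -
  assume u: "reduced u"
  obtain u' p v' where *: "u = u' @ finv p" "u = p @ v'" "reduce (u @ u) = u' @ v'"
    using cancellation[OF u u] by blast
  have "length p \<le> length u'"
  proof (rule ccontr)
    assume n: "\<not> length p \<le> length u'"
    obtain s where "p = u' @ s" "finv p = s @ v'"
    proof -
      have "u' @ finv p = p @ v'" using * by simp
      then obtain us where "(u' = p @ us \<and> us @ finv p = v') \<or> (u' @ us = p \<and> finv p = us @ v')"
        by (auto simp: append_eq_append_conv2)
      then show ?thesis using n that by auto
    qed
    \<comment> \<open>Two descriptions of \<open>finv p\<close>; their initial segments of equal
      length must agree.\<close>
    moreover from this have "finv s @ finv u' = s @ v'" by simp
    then have "finv s = s" by (simp add: append_eq_append_conv)
    moreover have "reduced s"
      using u \<open>p = u' @ s\<close> unfolding *(2) by (simp add: reduced_append)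
    ultimately show False
      using finv_fixpoint[of s] n by simp
  qed
  moreover have "length u = length u' + length p"
    using arg_cong[OF *(1), of length] by simp
  moreover have "length u = length p + length v'"
    using arg_cong[OF *(2), of length] by simp
  ultimately show ?thesis using *(3) by simp
qed

text \<open>Minimality is a local condition here: the automorphism is compared only with those
  obtained by one further move. All length estimates rest on this comparison.\<close>

locale nielsen_minimal =
  fixes m N :: nat and \<gamma> :: "letter list \<Rightarrow> letter list"
  assumes Aut: "\<gamma> \<in> carrier Aut_F_omega"
    and fix_below: "\<And>a. fst a < m \<Longrightarrow> \<gamma> [a] = [a]"
    and minimal: "\<And>e. e \<in> elem_range m N \<Longrightarrow> (potential m N (elem_aut e \<cdot> \<gamma>), potential m N \<gamma>) \<notin> potential_ord"
begin

abbreviation z :: "letter \<Rightarrow> letter list" where "z a \<equiv> \<gamma> [a]"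

lemma hom: "\<gamma> \<in> hom F_omega F_omega"
  using Aut by (rule Aut_hom)

lemma z_reduced [simp]: "reduced (z a)"
  by (rule hom_F_reduced[OF hom]) simp

lemma z_linv: "z (linv a) = finv (z a)"
  by (rule hom_F_linv[OF hom])

lemma z_inj: "z a = z b \<Longrightarrow> a = b"
  using Aut_inj[OF Aut, of "[a]" "[b]"] by simp

lemma z_nonempty [simp]: "z a \<noteq> []"
  using Aut_inj[OF Aut, of "[a]" "[]"] hom_F_Nil[OF hom] by auto

lemma elem_step:
  assumes "independent a b"
  shows "(elem_aut (a, b) \<cdot> \<gamma>) [x] =
    (if x = a then reduce (z a @ z b) else if x = linv a then finv (reduce (z a @ z b)) else z x)"
proof -
  have E: "elem_aut (a, b) \<in> carrier Aut_F_omega"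
    using assms by (simp add: Elem_def)
  have 1: "\<gamma> [a, b] = reduce (z a @ z b)"
    using hom_F_mult[OF hom, of "[a]" "[b]"] independent_neqs[OF assms] by (simp add: reduced_Cons)
  then have 2: "\<gamma> [linv b, linv a] = finv (reduce (z a @ z b))"
    using hom_F_finv[OF hom, of "[a, b]"] independent_neqs[OF assms] by (simp add: reduced_Cons)
  show ?thesis
    using 1 2 by (simp add: mult_Aut_apply E Aut elem_aut_letter assms)
qed

text \<open>The move changes only the images of \<open>a\<close> and of its inverse, which have
  equal length; hence the factor 2. All other letters are collected in \<open>n\<close> and
  \<open>M\<close>.\<close>

lemma potential_step:
  assumes "(a, b) \<in> elem_range m N"
  defines "r \<equiv> reduce (z a @ z b)"
  shows "\<exists>n M. potential m N \<gamma> = (2 * length (z a) + n, {#half (z a), half (finv (z a))#} + M) \<and>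
    potential m N (elem_aut (a, b) \<cdot> \<gamma>) = (2 * length r + n, {#half r, half (finv r)#} + M)"
proof -
  have a: "a \<in> letter_range m N" and i: "independent a b"
    using assms(1) by (auto simp: elem_range_def mem_letter_range independent_iff)
  note s = elem_step[OF i, folded r_def]
  let ?\<delta> = "elem_aut (a, b) \<cdot> \<gamma>"
  have eq: "sum (\<lambda>x. f (?\<delta> [x])) (letter_range m N - {a, linv a}) = sum (\<lambda>x. f (z x)) (letter_range m N - {a, linv a})"
    for f :: "letter list \<Rightarrow> 'b::comm_monoid_add"
    by (rule sum.cong) (auto simp: s)
  show ?thesis
    unfolding potential_def sum_letter_range[OF a] eq by (auto simp: s z_linv)
qed

lemma min_length:
  assumes "(a, b) \<in> elem_range m N"
  shows "length (z a) \<le> length (reduce (z a @ z b))"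
  using minimal[OF assms] potential_step[OF assms] by (auto simp: potential_ord_def)

text \<open>When a move keeps the length and the first half of the image of \<open>a\<close>, the
  potential can change only through the half read from the other end, that is, the initial half of
  the inverse.\<close>

lemma min_half:
  assumes "(a, b) \<in> elem_range m N"
  defines "r \<equiv> reduce (z a @ z b)"
  assumes "length r = length (z a)" "half r = half (z a)"
  shows "(half (finv r), half (finv (z a))) \<notin> lenlex letter_ord"
proof
  assume h: "(half (finv r), half (finv (z a))) \<in> lenlex letter_ord"
  obtain n M where *: "potential m N \<gamma> = (2 * length (z a) + n, {#half (z a), half (finv (z a))#} + M)"
    "potential m N (elem_aut (a, b) \<cdot> \<gamma>) = (2 * length r + n, {#half r, half (finv r)#} + M)"
    using potential_step[OF assms(1)] r_def by auto
  have "({#half r#} + M + {#half (finv r)#}, {#half r#} + M + {#half (finv (z a))#}) \<in> mult (lenlex letter_ord)"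
    by (rule one_step_implies_mult) (use h in auto)
  then have "(potential m N (elem_aut (a, b) \<cdot> \<gamma>), potential m N \<gamma>) \<in> potential_ord"
    unfolding * potential_ord_def using assms by (simp add: add_mset_commute)
  then show False using minimal[OF assms(1)] by simp
qed

text \<open>Three different reasons: the image of a fixed letter has length one, so injectivity is
  enough; a square does not shorten; in all other cases a move of the allowed range compares the two
  lengths.\<close>

lemma length_mult_ge:
  assumes "fst a < N" "fst b < N" "b \<noteq> linv a"
  shows "length (z a) \<le> length (reduce (z a @ z b))"
proof -
  consider "fst a < m" | "m \<le> fst a" "fst a \<noteq> fst b" | "a = b"
    using assms fst_eq_letter[of b a] by fastforce
  then show ?thesis
  proof cases
    case 1
    have "reduce (z a @ z b) \<noteq> []"
    proof
      assume "reduce (z a @ z b) = []"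
      then have "z b = z (linv a)"
        using reduce_prod_eq_Nil[of "z a" "z b"] by (simp add: z_linv)
      then show False using assms z_inj by blast
    qed
    then show ?thesis using fix_below[OF 1] by (simp add: Suc_le_eq)
  next
    case 2
    then show ?thesis using assms by (intro min_length) (auto simp: elem_range_def)
  next
    case 3
    then show ?thesis by (simp add: length_square)
  qed
qed

text \<open>Neither factor loses more than half of its length. One bound is
  \<open>length_mult_ge\<close> for the pair itself, the other is the same estimate for the inverted
  product.\<close>

lemma pair_cancellation:
  assumes "fst a < N" "fst b < N" "b \<noteq> linv a"
  obtains u p v where "z a = u @ finv p" "z b = p @ v" "reduced (u @ v)" "reduce (z a @ z b) = u @ v"
    "length p \<le> length u" "length p \<le> length v"
proof -
  obtain u p v where *: "z a = u @ finv p" "z b = p @ v" "reduced (u @ v)" "reduce (z a @ z b) = u @ v"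
    using cancellation[OF z_reduced[of a] z_reduced[of b]] by blast
  have "length p \<le> length v"
    using length_mult_ge[OF assms] * by simp
  moreover have "length (z (linv b)) \<le> length (reduce (z (linv b) @ z (linv a)))"
    using assms by (intro length_mult_ge) (auto simp: linv_swap)
  then have "length (z b) \<le> length (reduce (z a @ z b))"
    using reduce_finv[of "z a @ z b"] by (simp add: z_linv)
  then have "length p \<le> length u" using * by simp
  ultimately show ?thesis using * that by blast
qed

section \<open>Cancellation of an image against both neighbours\<close>

definition canc :: "letter \<Rightarrow> letter \<Rightarrow> nat" where
  "canc a b = (length (z a) + length (z b) - length (reduce (z a @ z b))) div 2"

lemma cancD:
  assumes "z a = u @ finv p" "z b = p @ v" "reduce (z a @ z b) = u @ v"
  shows "canc a b = length p"
  unfolding canc_def assms(3) using arg_cong[OF assms(1), of length] arg_cong[OF assms(2), of length]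
  by simp

text \<open>Exactly half of \<open>z b\<close> cancels against \<open>z d\<close>, so multiplication
  merely replaces the initial segment \<open>q\<close> of \<open>z d\<close> by \<open>p\<close>. If
  \<open>p\<close> is smaller, the move taking d to b d keeps the length and lowers an initial half,
  contrary to minimality. As elementary moves multiply on the right, it is expressed as the move of
  \<open>linv d\<close> by \<open>linv b\<close>.\<close>

lemma no_descent:
  assumes bd: "fst b < N" "fst d < N" "d \<noteq> linv b"
    and zb: "z b = p @ finv q" and zd: "z d = q @ d'" and len: "length p = length q"
    and le: "length q \<le> length d'" and red: "reduce (z b @ z d) = p @ d'"
    and pq: "(p, q) \<in> lenlex letter_ord"
  shows False
proof -
  have pne: "p \<noteq> []" using zb len z_nonempty[of b] by auto
  have "p \<noteq> q"
    using pq lenlex_irreflexive[of letter_ord q] irrefl_letter_ord by (auto simp: irrefl_def)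
  \<comment> \<open>The image of a fixed letter has length one and cannot contain the non-empty
    \<open>q\<close> followed by a word at least as long.\<close>
  have "\<not> fst d < m"
    using fix_below[of d] zd le len pne by (cases q) (auto simp: Cons_eq_append_conv)
  moreover have "fst d \<noteq> fst b"
  proof
    assume "fst d = fst b"
    then have "d = b" using bd fst_eq_letter by blast
    then have "p @ finv q = q @ d'" using zb zd by simp
    then show False using len \<open>p \<noteq> q\<close> by simp
  qed
  ultimately have D: "(linv d, linv b) \<in> elem_range m N"
    using bd by (auto simp: elem_range_def)
  have r: "reduce (z (linv d) @ z (linv b)) = finv d' @ finv p"
    using reduce_finv[of "z b @ z d"] red by (simp add: z_linv)
  have zd': "z (linv d) = finv d' @ finv q"
    by (simp add: z_linv zd)
  define k where "k = (length q + length d' + 1) div 2"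
  have k: "length q \<le> k" using le by (simp add: k_def)
  have hp: "half (p @ d') = p @ take (k - length q) d'"
    using k len by (simp add: half_def k_def)
  have hq: "half (q @ d') = q @ take (k - length q) d'"
    using k by (simp add: half_def k_def)
  have "(half (finv (finv d' @ finv p)), half (finv (z (linv d)))) \<in> lenlex letter_ord"
    using lenlex_append1[OF pq] by (simp add: z_linv zd hp hq)
  moreover have "half (finv d' @ finv p) = half (z (linv d))"
    unfolding zd' using le len by (simp add: half_append)
  ultimately show False
    using min_half[OF D] unfolding r by (simp add: zd' len)
qed

text \<open>Nielsen's third condition. If the two neighbours consumed the image of \<open>b\<close>,
  it would be \<open>p @ finv q\<close> with halves of equal length, distinct because the image is
  not trivial. The smaller half then gives a descent against the right neighbour or, after inverting
  everything, against the left one.\<close>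

lemma triple_cancellation:
  assumes abd: "fst a < N" "fst b < N" "fst d < N" and ne: "b \<noteq> linv a" "d \<noteq> linv b"
  shows "canc a b + canc b d < length (z b)"
proof (rule ccontr)
  assume n: "\<not> canc a b + canc b d < length (z b)"
  obtain u p v where 1: "z a = u @ finv p" "z b = p @ v" "reduce (z a @ z b) = u @ v"
    "length p \<le> length u" "length p \<le> length v"
    using pair_cancellation[OF abd(1,2) ne(1)] by metis
  obtain u' q v' where 2: "z b = u' @ finv q" "z d = q @ v'" "reduce (z b @ z d) = u' @ v'"
    "length q \<le> length u'" "length q \<le> length v'"
    using pair_cancellation[OF abd(2,3) ne(2)] by metis
  have l: "length (z b) = length p + length v" "length (z b) = length u' + length q"
    using arg_cong[OF 1(2), of length] arg_cong[OF 2(1), of length] by simp_all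
  have "length (z b) \<le> length p + length q"
    using n cancD[OF 1(1-3)] cancD[OF 2(1-3)] by simp
  then have len: "length p = length q" "length u' = length p" "length v = length q"
    using l 1(5) 2(4) by linarith+
  have "p @ v = u' @ finv q" using 1(2) 2(1) by metis
  moreover have "length p = length u'" using len by metis
  ultimately have uv: "u' = p" "v = finv q"
    using append_eq_append_conv[of p u' v "finv q"] by blast+
  have "p \<noteq> q"
  proof
    assume "p = q"
    then have "reduce (z b) = []" using 2(1) uv by simp
    then show False by simp
  qed
  then consider "(p, q) \<in> lenlex letter_ord" | "(q, p) \<in> lenlex letter_ord"
    using total_lenlex[OF total_letter_ord] by (auto simp: total_on_def)
  then show False
  proof cases
    case 1
    show False
      by (rule no_descent[of b d p q v']) (use 1 2 uv len abd ne in auto)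
  next
    case c: 2
    have r: "reduce (z (linv b) @ z (linv a)) = q @ finv u"
      using reduce_finv[of "z a @ z b"] 1(3) uv by (simp add: z_linv)
    show False
      by (rule no_descent[of "linv b" "linv a" q p "finv u"])
        (use c r 1 2(1) uv len abd ne in \<open>auto simp: z_linv linv_swap\<close>)
  qed
qed

fun canc_hd :: "letter \<Rightarrow> letter list \<Rightarrow> nat" where
  "canc_hd a [] = 0"
| "canc_hd a (b # w) = canc a b"

lemma canc_lt:
  assumes "fst a < N" "fst b < N" "b \<noteq> linv a"
  shows "canc a b < length (z a)" "canc a b < length (z b)"
proof -
  obtain u p v where *: "z a = u @ finv p" "z b = p @ v" "reduce (z a @ z b) = u @ v"
    "length p \<le> length u" "length p \<le> length v"
    using pair_cancellation[OF assms] by metis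
  have "canc a b = length p" by (rule cancD[OF *(1-3)])
  then show "canc a b < length (z a)" "canc a b < length (z b)"
    using * z_nonempty[of a] z_nonempty[of b] by (cases u; cases v; force)+
qed

text \<open>The image of the first letter loses only what cancels against the second one, and every
  inner image keeps a non-empty core. Hence each further letter contributes at least one to the
  length.\<close>

lemma product_form:
  assumes "reduced (a # w)" "\<forall>x\<in>set (a # w). fst x < N"
  shows "\<exists>v. subst_word z (a # w) = take (length (z a) - canc_hd a w) (z a) @ v \<and> length w \<le> length v"
  using assms
proof (induction w arbitrary: a)
  case Nil
  then show ?case by (simp add: subst_word_Cons)
next
  case (Cons b w)
  then have red: "reduced (b # w)" and N: "fst a < N" "fst b < N" "\<forall>x\<in>set (b # w). fst x < N"
    and ne: "b \<noteq> linv a"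
    by (auto simp: reduced_Cons)
  obtain v where v: "subst_word z (b # w) = take (length (z b) - canc_hd b w) (z b) @ v" "length w \<le> length v"
    using Cons.IH[OF red N(3)] by blast
  obtain u p t where *: "z a = u @ finv p" "z b = p @ t" "reduced (u @ t)" "reduce (z a @ z b) = u @ t"
    using pair_cancellation[OF N(1,2) ne] by metis
  have c: "canc a b = length p" by (rule cancD[OF *(1,2,4)])
  have "canc a b + canc_hd b w < length (z b)"
  proof (cases w)
    case Nil
    then show ?thesis using canc_lt[OF N(1,2) ne] by simp
  next
    case (Cons d w')
    then show ?thesis
      using triple_cancellation[of a b d] N red ne by (auto simp: reduced_Cons)
  qed
  then have lt: "length p + canc_hd b w < length (z b)" using c by simp
  \<comment> \<open>The core of the image of \<open>b\<close> that survives the cancellation on both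
    sides. Being non-empty, it separates the two seams, which can therefore be checked one at a
    time.\<close>
  define s where "s = take (length t - canc_hd b w) t"
  have ts: "take (length (z b) - canc_hd b w) (z b) = p @ s"
    using lt *(2) by (simp add: s_def)
  have sne: "s \<noteq> []"
    using lt *(2) by (auto simp: s_def)
  have "reduced (s @ v)"
    using reduced_subst_word[of z "b # w"] unfolding v(1) ts by (simp add: reduced_append)
  moreover have "reduced (u @ s)"
    using *(3) append_take_drop_id[of "length t - canc_hd b w" t] unfolding s_def
    by (metis append_assoc reduced_append)
  ultimately have "reduced (u @ s @ v)"
    using reduced_append_overlap sne by blast
  moreover have "subst_word z (a # b # w) = reduce (u @ s @ v)"
  proof -
    have "subst_word z (a # b # w) = reduce (z a @ subst_word z (b # w))"
      by (simp add: subst_word_Cons)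
    also have "\<dots> = reduce (u @ finv p @ p @ s @ v)"
      unfolding v(1) ts *(1) by simp
    finally show ?thesis by (simp add: reduce_cancel')
  qed
  moreover have "u = take (length (z a) - canc_hd a (b # w)) (z a)"
    using *(1) c by simp
  ultimately show ?case
    using v(2) sne by (intro exI[of _ "s @ v"]) (cases s; simp)
qed

lemma length_ge:
  assumes "reduced u" "\<forall>x\<in>set u. fst x < N"
  shows "length u \<le> length (\<gamma> u)"
proof (cases u)
  case (Cons a w)
  obtain v where v: "subst_word z u = take (length (z a) - canc_hd a w) (z a) @ v" "length w \<le> length v"
    using product_form[of a w] assms Cons by blast
  have "canc_hd a w < length (z a)"
    using assms Cons canc_lt[of a] by (cases w) (auto simp: reduced_Cons)
  then have "length u \<le> length (subst_word z u)"
    using v Cons by simp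
  then show ?thesis using hom_F_subst_word[OF hom assms(1)] by simp
qed simp

end

subsection \<open>Monomial automorphisms\<close>

text \<open>The word \<open>w_ab\<close> of the relations, with the inverse of the third factor
  written as a letter.\<close>

definition mono_word :: "letter \<Rightarrow> letter \<Rightarrow> (letter \<times> letter) list" where
  "mono_word a b = [(b, a), (linv a, b), (linv b, linv a)]"

lemma set_mono_word [simp]: "independent a b \<Longrightarrow> set (mono_word a b) \<subseteq> Elem"
  by (auto simp: mono_word_def Elem_def independent_iff)

lemma hom_F_word: "\<phi> \<in> hom F_omega F_omega \<Longrightarrow> x \<noteq> linv y \<Longrightarrow> \<phi> [x, y] = reduce (\<phi> [x] @ \<phi> [y])"
  using hom_F_mult[of \<phi> "[x]" "[y]"] reduce_id[of "[x, y]"] linv_swap[of y x] by (auto simp: reduced_Cons)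

lemma elem_prod_mono_word:
  assumes "independent a b"
  shows "elem_prod (mono_word a b) [z] = [sigma a b z]"
proof -
  note n = independent_neqs[OF assms]
  have i: "independent b a" "independent (linv a) b" "independent (linv b) (linv a)"
    using assms by (auto simp: independent_iff)
  then have E: "elem_aut (b, a) \<in> carrier Aut_F_omega" "elem_aut (linv a, b) \<in> carrier Aut_F_omega"
    "elem_aut (linv b, linv a) \<in> carrier Aut_F_omega"
    by (simp_all add: Elem_def)
  note h = E[THEN Aut_hom]
  interpret A: group Aut_F_omega by (rule group_Aut)
  have r1: "reduced (elem_aut (b, a) [z])"
    by (rule hom_F_reduced[OF h(1)]) simp
  have r2: "reduced (elem_aut (linv a, b) (elem_aut (b, a) [z]))"
    by (rule hom_F_reduced[OF h(2) r1])
  have "elem_prod (mono_word a b) [z] = elem_aut (linv b, linv a) (elem_aut (linv a, b) (elem_aut (b, a) [z]))"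
    using E r1 r2 by (simp add: mono_word_def mult_Aut_apply one_Aut_apply)
  also have "\<dots> = [sigma a b z]"
    using n by (auto simp: elem_aut_letter i hom_F_word h sigma_def reduce_Cons)
  finally show ?thesis .
qed

subsection \<open>Extending the set of fixed letters\<close>

lemma set_reduce: "set (reduce w) \<subseteq> set w"
proof (induction w)
  case (Cons x w)
  then show ?case by (cases "reduce w") (auto simp: reduce_Cons)
qed simp

lemma elem_prod_letters:
  assumes "set es \<subseteq> elem_range m N" "reduced w" "\<forall>x\<in>set w. fst x < N"
  shows "\<forall>x\<in>set (elem_prod es w). fst x < N"
  using assms
proof (induction es arbitrary: w)
  case Nil
  then show ?case by (simp add: one_Aut_apply)
next
  case (Cons e es)
  obtain a b where e: "e = (a, b)" and ab: "independent a b" "fst a < N" "fst b < N"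
    using Cons.prems(1) by (auto simp: elem_range_def independent_iff)
  have E: "e \<in> Elem" "set es \<subseteq> Elem"
    using Cons.prems(1) elem_range_Elem by auto
  have h: "elem_aut e \<in> hom F_omega F_omega" using E by (intro Aut_hom) simp
  have "fst x < N" if x: "x \<in> set (elem_aut e w)" for x
  proof -
    have "x \<in> set (reduce (concat (map (\<lambda>y. elem_aut e [y]) w)))"
      using x hom_F_subst_word[OF h Cons.prems(2)] by (simp add: subst_word_def)
    then have "x \<in> set (concat (map (\<lambda>y. elem_aut e [y]) w))"
      using set_reduce by blast
    then obtain y where y: "y \<in> set w" "x \<in> set (elem_aut e [y])" by auto
    then have "fst y < N" using Cons.prems(3) by blast
    then show ?thesis
      using y(2) ab unfolding e elem_aut_letter[OF ab(1)] by (simp split: if_splits) (metis fst_linv)+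
  qed
  then have "\<forall>x\<in>set (elem_aut e w). fst x < N" by blast
  moreover have "reduced (elem_aut e w)" by (rule hom_F_reduced[OF h Cons.prems(2)])
  ultimately show ?case
    using Cons.IH[of "elem_aut e w"] Cons.prems E by (simp add: mult_Aut_apply)
qed

lemma einv_elem_range: "set es \<subseteq> elem_range m N \<Longrightarrow> set (einv es) \<subseteq> elem_range m N"
proof -
  have "elem_inv e \<in> elem_range m N" if "e \<in> elem_range m N" for e
    using that by (auto simp: elem_range_def elem_inv_def linv_def)
  then show "set es \<subseteq> elem_range m N \<Longrightarrow> set (einv es) \<subseteq> elem_range m N"
    by (auto simp: einv_def)
qed

definition fixes_below :: "nat \<Rightarrow> (letter list \<Rightarrow> letter list) \<Rightarrow> bool" where
  "fixes_below m \<gamma> \<longleftrightarrow> (\<forall>a. fst a < m \<longrightarrow> \<gamma> [a] = [a])"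

lemma fixes_below_mult:
  assumes "\<alpha> \<in> carrier Aut_F_omega" "\<beta> \<in> carrier Aut_F_omega" "fixes_below m \<alpha>" "fixes_below m \<beta>"
  shows "fixes_below m (\<alpha> \<cdot> \<beta>)"
  using assms by (simp add: fixes_below_def mult_Aut_apply)

lemma fixes_below_elem_prod: "set es \<subseteq> elem_range m N \<Longrightarrow> fixes_below m (elem_prod es)"
proof -
  assume es: "set es \<subseteq> elem_range m N"
  have "elem_prod es [a] = [a]" if "fst a < m" for a
  proof (rule elem_prod_fix)
    show "set es \<subseteq> Elem" using es elem_range_Elem by blast
    show "fst (fst e) \<noteq> fst a" if "e \<in> set es" for e
    proof -
      have "e \<in> elem_range m N" using es that by blast
      then have "m \<le> fst (fst e)" by (auto simp: elem_range_def)
      then show ?thesis using \<open>fst a < m\<close> by simp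
    qed
  qed
  then show ?thesis by (simp add: fixes_below_def)
qed

text \<open>After a minimal correction, words below \<open>N\<close> are not shortened, so the
  preimage of the new letter is itself a letter. A monomial automorphism then takes the new letter
  to that preimage.\<close>

lemma nielsen_step:
  assumes \<gamma>: "\<gamma> \<in> carrier Aut_F_omega" and fixed: "fixes_below m \<gamma>"
  obtains N es where "set es \<subseteq> elem_range m N" "(elem_prod es \<cdot> \<gamma>) [(m, True)] = [(m, True)]"
proof -
  interpret A: group Aut_F_omega by (rule group_Aut)
  obtain u where u: "reduced u" "\<gamma> u = [(m, True)]"
    using Aut_surj[OF \<gamma>, of "[(m, True)]"] by auto
  \<comment> \<open>\<open>N\<close> bounds the letters of a preimage of the new letter, so that the
    length estimate applies to it. It is also at least m + 2, which leaves room for a second letter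
    when a sign has to be changed.\<close>
  define N where "N = Suc (Suc (max m (Max (insert 0 (fst ` set u)))))"
  have "fst x \<le> Max (insert 0 (fst ` set u))" if "x \<in> set u" for x
    using that by (intro Max_ge) auto
  then have N: "m + 2 \<le> N" "\<forall>x\<in>set u. fst x < N"
    unfolding N_def by (fastforce simp: less_Suc_eq_le le_max_iff_disj)+
  let ?Q = "{es. set es \<subseteq> elem_range m N}"
  let ?\<delta> = "\<lambda>es. elem_prod es \<cdot> \<gamma>"
  have "[] \<in> ?Q" by simp
  then obtain es where es: "es \<in> ?Q"
    and min: "\<And>es'. (potential m N (?\<delta> es'), potential m N (?\<delta> es)) \<in> potential_ord \<Longrightarrow> es' \<notin> ?Q"
    using wfE_min[OF wf_inv_image[OF wf_potential_ord, of "\<lambda>es. potential m N (?\<delta> es)"], of "[]" ?Q]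
    unfolding in_inv_image by blast
  have esE: "set es \<subseteq> Elem" using es elem_range_Elem by blast
  have epA: "elem_prod es \<in> carrier Aut_F_omega" using esE by simp
  have \<delta>A: "?\<delta> es \<in> carrier Aut_F_omega"
    using epA \<gamma> by (rule A.m_closed)
  interpret nielsen_minimal m N "?\<delta> es"
  proof
    show "?\<delta> es \<in> carrier Aut_F_omega" by (rule \<delta>A)
    show "?\<delta> es [a] = [a]" if "fst a < m" for a
      using fixes_below_mult[OF epA \<gamma> fixes_below_elem_prod fixed] es that unfolding fixes_below_def by blast
    show "(potential m N (elem_aut e \<cdot> ?\<delta> es), potential m N (?\<delta> es)) \<notin> potential_ord"
      if e: "e \<in> elem_range m N" for e
    proof -
      have "elem_aut e \<in> carrier Aut_F_omega"
        by (rule elem_aut_in_Aut) (use e elem_range_Elem in blast)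
      then have "?\<delta> (e # es) = elem_aut e \<cdot> ?\<delta> es"
        using epA \<gamma> by (simp add: A.m_assoc)
      then show ?thesis using min[of "e # es"] e es by auto
    qed
  qed
  \<comment> \<open>The preimage of the new letter under the corrected automorphism. The moves
    involve only letters below \<open>N\<close>, hence so does \<open>u'\<close>.\<close>
  define u' where "u' = elem_prod (einv es) u"
  have ei: "set (einv es) \<subseteq> Elem" using esE by simp
  have u'r: "reduced u'"
    unfolding u'_def by (rule hom_F_reduced[OF Aut_hom[OF elem_prod_in_Aut[OF ei]] u(1)])
  have "\<forall>x\<in>set u'. fst x < N"
    unfolding u'_def using elem_prod_letters[OF einv_elem_range u(1) N(2)] es by blast
  moreover have \<delta>u': "?\<delta> es u' = [(m, True)]"
  proof -
    have "elem_prod es u' = (elem_prod (einv es) \<cdot> elem_prod es) u"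
      unfolding u'_def by (rule mult_Aut_apply[symmetric]) (use ei epA u in auto)
    also have "\<dots> = u"
      using epA u by (simp add: elem_prod_einv[OF esE] one_Aut_apply)
    finally show ?thesis using u u'r epA \<gamma> by (simp add: mult_Aut_apply)
  qed
  ultimately have "length u' \<le> 1"
    using length_ge[of u'] u'r by simp
  moreover have "u' \<noteq> []"
    using \<delta>u' hom_F_Nil[OF Aut_hom[OF \<delta>A]] by auto
  ultimately obtain a where a: "u' = [a]"
    by (cases u') auto
  then have aN: "fst a < N" using \<open>\<forall>x\<in>set u'. fst x < N\<close> by simp
  let ?x = "(m, True)"
  have am: "\<not> fst a < m"
    using fix_below[of a] \<delta>u' a by auto
  obtain ms where ms: "set ms \<subseteq> elem_range m N" "elem_prod ms [?x] = [a]"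
  proof (cases "fst a = m")
    case False
    then have i: "independent a ?x" by (simp add: independent_iff)
    have "sigma a ?x ?x = a" using independent_neqs[OF i] by (simp add: sigma_def)
    then show ?thesis
      using that[of "mono_word a ?x"] elem_prod_mono_word[OF i, of ?x] False am aN N
      by (auto simp: mono_word_def elem_range_def)
  next
    case True
    show ?thesis
    proof (cases "a = ?x")
      case True
      then show ?thesis using that[of "[]"] by (simp add: one_Aut_apply)
    next
      case False
      then have ax: "a = linv ?x" using fst_eq_letter[of a ?x] True by auto
      let ?y = "(Suc m, True)"
      have i: "independent ?x ?y" by (simp add: independent_iff)
      have s: "sigma ?x ?y ?x = linv ?y" "sigma ?x ?y (linv ?y) = linv ?x"
        using independent_neqs[OF i] by (auto simp: sigma_def linv_def)
      \<comment> \<open>The square of the monomial map inverts both letters involved; it repairs a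
        wrong sign.\<close>
      have "elem_prod (mono_word ?x ?y @ mono_word ?x ?y) [?x] = [a]"
        using i elem_prod_mono_word[OF i] by (simp add: elem_prod_append mult_Aut_apply s ax)
      then show ?thesis
        using that[of "mono_word ?x ?y @ mono_word ?x ?y"] N by (auto simp: mono_word_def elem_range_def)
    qed
  qed
  have msE: "set ms \<subseteq> Elem" using ms elem_range_Elem by blast
  have "elem_prod (ms @ es) \<cdot> \<gamma> = elem_prod ms \<cdot> ?\<delta> es"
    using msE esE \<gamma> by (simp add: elem_prod_append A.m_assoc)
  then have "(elem_prod (ms @ es) \<cdot> \<gamma>) [?x] = [?x]"
    using ms msE \<delta>A \<delta>u' a by (simp add: mult_Aut_apply)
  then show ?thesis
    using that[of "ms @ es" N] ms es by auto
qed

text \<open>The bound \<open>N\<close> on the letters used emerges only during the induction and may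
  exceed \<open>n\<close>. This delay is what the later alternation has to absorb.\<close>

lemma nielsen:
  assumes \<gamma>: "\<gamma> \<in> carrier Aut_F_omega" and fixed: "fixes_below m \<gamma>" and "m \<le> n"
  shows "\<exists>N es. n \<le> N \<and> set es \<subseteq> elem_range m N \<and> fixes_below n (elem_prod es \<cdot> \<gamma>)"
  using \<open>m \<le> n\<close>
proof (induction n rule: dec_induct)
  case base
  interpret A: group Aut_F_omega by (rule group_Aut)
  show ?case using \<gamma> fixed by (intro exI[of _ m] exI[of _ "[]"]) simp
next
  case (step n)
  interpret A: group Aut_F_omega by (rule group_Aut)
  obtain N es where 1: "n \<le> N" "set es \<subseteq> elem_range m N" "fixes_below n (elem_prod es \<cdot> \<gamma>)"
    using step.IH by blast
  have esE: "set es \<subseteq> Elem" using 1 elem_range_Elem by blast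
  have \<delta>: "elem_prod es \<cdot> \<gamma> \<in> carrier Aut_F_omega" using esE \<gamma> by simp
  obtain N' fs where 2: "set fs \<subseteq> elem_range n N'"
    "(elem_prod fs \<cdot> (elem_prod es \<cdot> \<gamma>)) [(n, True)] = [(n, True)]"
    by (rule nielsen_step[OF \<delta> 1(3)])
  have fsE: "set fs \<subseteq> Elem" using 2 elem_range_Elem by blast
  let ?\<epsilon> = "elem_prod fs \<cdot> (elem_prod es \<cdot> \<gamma>)"
  have \<epsilon>: "?\<epsilon> \<in> carrier Aut_F_omega" using fsE \<delta> by simp
  have eq: "elem_prod (fs @ es) \<cdot> \<gamma> = ?\<epsilon>"
    using fsE esE \<gamma> by (simp add: elem_prod_append A.m_assoc)
  have "fixes_below n ?\<epsilon>"
    using fixes_below_mult[OF _ \<delta> fixes_below_elem_prod[OF 2(1)] 1(3)] fsE by simp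
  moreover have "?\<epsilon> [a] = [a]" if "fst a = n" for a
  proof (cases "snd a")
    case True
    then have "a = (n, True)" using that by (simp add: prod_eq_iff)
    then show ?thesis using 2(2) by simp
  next
    case False
    then have "a = linv (n, True)" using that by (simp add: prod_eq_iff linv_def)
    then show ?thesis using 2(2) hom_F_linv[OF Aut_hom[OF \<epsilon>], of "(n, True)"] by simp
  qed
  ultimately have "fixes_below (Suc n) ?\<epsilon>"
    by (auto simp: fixes_below_def less_Suc_eq)
  moreover have "set (fs @ es) \<subseteq> elem_range m (Suc (max N N'))"
  proof -
    have "elem_range m N \<subseteq> elem_range m (Suc (max N N'))"
      by (rule elem_range_mono) simp_all
    moreover have "elem_range n N' \<subseteq> elem_range m (Suc (max N N'))"
      by (rule elem_range_mono) (use step.hyps in simp_all)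
    ultimately show ?thesis using 1(2) 2(1) unfolding set_append by blast
  qed
  ultimately show ?case
    using 1(1) eq by (intro exI[of _ "Suc (max N N')"] exI[of _ "fs @ es"]) auto
qed

section \<open>Big free groups\<close>

lemma wordsD:
  assumes "f \<in> words \<Lambda>"
  shows "le f \<subseteq> idx f \<times> idx f" "refl_on (idx f) (le f)" "trans (le f)" "antisym (le f)"
    "total_on (idx f) (le f)" "\<And>s. s \<in> idx f \<Longrightarrow> lab f s \<in> \<Lambda>"
    "\<And>l. finite {s \<in> idx f. lab f s = l}"
proof -
  show "finite {s \<in> idx f. lab f s = l}" for l
  proof (cases "l \<in> \<Lambda>")
    case False
    then have "{s \<in> idx f. lab f s = l} = {}" using assms unfolding words_def by blast
    then show ?thesis using finite.emptyI by (rule ssubst)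
  qed (use assms in \<open>auto simp: words_def\<close>)
qed (use assms in \<open>auto simp: words_def order_on_defs\<close>)

lemma le_refl: "f \<in> words \<Lambda> \<Longrightarrow> s \<in> idx f \<Longrightarrow> (s, s) \<in> le f"
  using wordsD(2) by (auto simp: refl_on_def)

lemma le_trans_word: "f \<in> words \<Lambda> \<Longrightarrow> (s, t) \<in> le f \<Longrightarrow> (t, u) \<in> le f \<Longrightarrow> (s, u) \<in> le f"
  using wordsD(3) by (meson transD)

lemma le_antisym_word: "f \<in> words \<Lambda> \<Longrightarrow> (s, t) \<in> le f \<Longrightarrow> (t, s) \<in> le f \<Longrightarrow> s = t"
  using wordsD(4) by (meson antisymD)

lemma le_total:
  "f \<in> words \<Lambda> \<Longrightarrow> s \<in> idx f \<Longrightarrow> t \<in> idx f \<Longrightarrow> (s, t) \<in> le f \<or> (t, s) \<in> le f"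
  using wordsD(5) le_refl unfolding total_on_def by metis

lemma le_idx: "f \<in> words \<Lambda> \<Longrightarrow> (s, t) \<in> le f \<Longrightarrow> s \<in> idx f \<and> t \<in> idx f"
  using wordsD(1) by blast

lemma words_iff:
  "f \<in> words \<Lambda> \<longleftrightarrow> le f \<subseteq> idx f \<times> idx f \<and> (\<forall>s\<in>idx f. (s, s) \<in> le f) \<and>
    (\<forall>s\<in>idx f. \<forall>t\<in>idx f. \<forall>u\<in>idx f. (s, t) \<in> le f \<longrightarrow> (t, u) \<in> le f \<longrightarrow> (s, u) \<in> le f) \<and>
    (\<forall>s\<in>idx f. \<forall>t\<in>idx f. (s, t) \<in> le f \<longrightarrow> (t, s) \<in> le f \<longrightarrow> s = t) \<and>
    (\<forall>s\<in>idx f. \<forall>t\<in>idx f. (s, t) \<in> le f \<or> (t, s) \<in> le f) \<and>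
    (\<forall>s\<in>idx f. lab f s \<in> \<Lambda>) \<and> (\<forall>l\<in>\<Lambda>. finite {s \<in> idx f. lab f s = l})"
    (is "_ \<longleftrightarrow> ?r")
proof
  assume f: "f \<in> words \<Lambda>"
  show ?r
    using wordsD(1,6,7)[OF f] le_refl[OF f] le_trans_word[OF f] le_antisym_word[OF f] le_total[OF f]
    by (intro conjI ballI impI) blast+
next
  assume r: ?r
  then have "trans (le f)" unfolding trans_def by blast
  moreover have "antisym (le f)" using r unfolding antisym_def by blast
  moreover have "total_on (idx f) (le f)" using r unfolding total_on_def by blast
  ultimately show "f \<in> words \<Lambda>"
    using r unfolding words_def order_on_defs refl_on_def by blast
qed

lemma finite_word_min:
  assumes "f \<in> words \<Lambda>" "finite P" "P \<noteq> {}" "P \<subseteq> idx f"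
  obtains s where "s \<in> P" "\<forall>t\<in>P. (s, t) \<in> le f"
proof -
  have "\<exists>s\<in>P. \<forall>t\<in>P. (s, t) \<in> le f"
    using assms(2-)
  proof (induction P rule: finite_ne_induct)
    case (singleton x)
    then show ?case using le_refl[OF assms(1)] by auto
  next
    case (insert x F)
    then obtain s where s: "s \<in> F" "\<forall>t\<in>F. (s, t) \<in> le f" by auto
    have x: "x \<in> idx f" "s \<in> idx f" using insert.prems s by auto
    from le_total[OF assms(1) this] show ?case
    proof
      assume "(x, s) \<in> le f"
      then show ?thesis using s le_refl[OF assms(1) x(1)] le_trans_word[OF assms(1)] by blast
    next
      assume "(s, x) \<in> le f"
      then show ?thesis using s by blast
    qed
  qed
  then show ?thesis using that by blast
qed

subsection \<open>Restriction, reversal and concatenation\<close>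

lemma word_restrict_simps [simp]:
  "idx (word_restrict f T) = idx f \<inter> T" "lab (word_restrict f T) = lab f"
  "(s, t) \<in> le (word_restrict f T) \<longleftrightarrow> (s, t) \<in> le f \<and> s \<in> T \<and> t \<in> T"
  by (auto simp: word_restrict_def)

lemma bar_word_simps [simp]:
  "idx (bar_word i f) = idx f" "lab (bar_word i f) s = i (lab f s)"
  "(s, t) \<in> le (bar_word i f) \<longleftrightarrow> (t, s) \<in> le f"
  by (auto simp: bar_word_def)

lemma empty_word_simps [simp]: "idx empty_word = {}" "le empty_word = {}"
  by (auto simp: empty_word_def)

lemma one_letter_simps [simp]:
  "idx (one_letter l) = {(l, 0)}" "le (one_letter l) = {((l, 0), (l, 0))}" "lab (one_letter l) s = l"
  by (auto simp: one_letter_def)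

text \<open>Follows the parity coding of \<open>concat_word\<close>: a map on the positions of a
  concatenation is given by one map for each factor.\<close>

definition on_parts :: "('l \<times> nat \<Rightarrow> 'a) \<Rightarrow> ('l \<times> nat \<Rightarrow> 'a) \<Rightarrow> 'l \<times> nat \<Rightarrow> 'a" where
  "on_parts h k = (\<lambda>(l, n). if even n then h (l, n div 2) else k (l, n div 2))"

lemma on_parts_simps [simp]: "on_parts h k (inL s) = h s" "on_parts h k (inR s) = k s"
  by (cases s; simp add: on_parts_def inL_def inR_def)+

lemma inL_inR_simps [simp]:
  "inL s = inL t \<longleftrightarrow> s = t" "inR s = inR t \<longleftrightarrow> s = t" "inL s \<noteq> inR t" "inR t \<noteq> inL s"
proof -
  show "inL s = inL t \<longleftrightarrow> s = t" "inR s = inR t \<longleftrightarrow> s = t"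
    by (cases s; cases t; simp add: inL_def inR_def)+
  have "snd (inL s) \<noteq> snd (inR t)" by (simp add: inL_def inR_def) presburger
  then show "inL s \<noteq> inR t" "inR t \<noteq> inL s" by metis+
qed

lemma parts_cases:
  obtains s where "x = inL s" | s where "x = inR s"
proof (cases "even (snd x)")
  case True
  then have "x = inL (fst x, snd x div 2)" by (simp add: inL_def prod_eq_iff)
  then show ?thesis by (rule that(1))
next
  case False
  then have "x = inR (fst x, snd x div 2)" by (simp add: inR_def prod_eq_iff)
  then show ?thesis by (rule that(2))
qed

lemma inL_inR_images [simp]:
  fixes A B C :: "('a \<times> nat) set"
  shows "inL s \<in> inL ` A \<longleftrightarrow> s \<in> A" "inR s \<in> inR ` A \<longleftrightarrow> s \<in> A" "inL s \<notin> inR ` A" "inR s \<notin> inL ` A"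
  "inL ` A = inL ` B \<longleftrightarrow> A = B" "inR ` A = inR ` B \<longleftrightarrow> A = B"
  "inL ` A \<subseteq> inL ` B \<union> inR ` C \<longleftrightarrow> A \<subseteq> B" "inR ` A \<subseteq> inL ` B \<union> inR ` C \<longleftrightarrow> A \<subseteq> C"
proof -
  show 1: "inL s \<in> inL ` A \<longleftrightarrow> s \<in> A" for s A
    by (simp add: image_iff)
  show 2: "inR s \<in> inR ` A \<longleftrightarrow> s \<in> A" for s A
    by (simp add: image_iff)
  show 3: "inL s \<notin> inR ` A" "inR s \<notin> inL ` A" for s A
    by (simp_all add: image_iff)
  have "inj (inL :: 'a \<times> nat \<Rightarrow> _)" "inj (inR :: 'a \<times> nat \<Rightarrow> _)" by (simp_all add: inj_def)
  then show "inL ` A = inL ` B \<longleftrightarrow> A = B" "inR ` A = inR ` B \<longleftrightarrow> A = B"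
    by (simp_all add: inj_image_eq_iff)
  show "inL ` A \<subseteq> inL ` B \<union> inR ` C \<longleftrightarrow> A \<subseteq> B" "inR ` A \<subseteq> inL ` B \<union> inR ` C \<longleftrightarrow> A \<subseteq> C"
    unfolding image_subset_iff Un_iff 1 2 by (simp_all only: 3 simp_thms subset_iff Ball_def)
qed

lemma map_prod_image_iff:
  "(x, y) \<in> map_prod h k ` r \<longleftrightarrow> (\<exists>s t. (s, t) \<in> r \<and> x = h s \<and> y = k t)"
proof
  assume "(x, y) \<in> map_prod h k ` r"
  then show "\<exists>s t. (s, t) \<in> r \<and> x = h s \<and> y = k t"
    by (rule prod_fun_imageE) (intro exI conjI; simp)
next
  assume "\<exists>s t. (s, t) \<in> r \<and> x = h s \<and> y = k t"
  then show "(x, y) \<in> map_prod h k ` r"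
    by (elim exE conjE) (simp only: map_prod_imageI)
qed

lemma le_concat_parts:
  "(x, y) \<in> le (concat_word f g) \<longleftrightarrow>
    (\<exists>s t. (s, t) \<in> le f \<and> x = inL s \<and> y = inL t) \<or> (\<exists>s t. (s, t) \<in> le g \<and> x = inR s \<and> y = inR t) \<or>
    (x \<in> inL ` idx f \<and> y \<in> inR ` idx g)"
  by (simp add: concat_word_def map_prod_image_iff)

lemma concat_word_simps [simp]:
  "idx (concat_word f g) = inL ` idx f \<union> inR ` idx g"
  "lab (concat_word f g) = on_parts (lab f) (lab g)"
  "(inL s, inL t) \<in> le (concat_word f g) \<longleftrightarrow> (s, t) \<in> le f"
  "(inR s', inR t') \<in> le (concat_word f g) \<longleftrightarrow> (s', t') \<in> le g"
  "(inL s, inR t') \<in> le (concat_word f g) \<longleftrightarrow> s \<in> idx f \<and> t' \<in> idx g"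
  "(inR s', inL t) \<notin> le (concat_word f g)"
  by (simp_all add: le_concat_parts image_iff) (simp_all add: concat_word_def on_parts_def)

lemma empty_in_words [simp]: "empty_word \<in> words \<Lambda>"
  by (simp add: words_iff)

lemma one_letter_in_words: "l \<in> \<Lambda> \<Longrightarrow> one_letter l \<in> words \<Lambda>"
  by (simp add: words_iff)

lemma word_restrict_in_words:
  assumes "f \<in> words \<Lambda>"
  shows "word_restrict f T \<in> words \<Lambda>"
proof -
  have "finite {s \<in> idx f \<inter> T. lab f s = l}" for l
    by (rule finite_subset[OF _ wordsD(7)[OF assms, of l]]) blast
  moreover have "le (word_restrict f T) \<subseteq> (idx f \<inter> T) \<times> (idx f \<inter> T)"
    using wordsD(1)[OF assms] unfolding word_restrict_def by auto
  ultimately show ?thesis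
    using assms unfolding words_iff word_restrict_simps by (intro conjI ballI impI) blast+
qed

lemma concat_in_words:
  assumes "f \<in> words \<Lambda>" "g \<in> words \<Lambda>"
  shows "concat_word f g \<in> words \<Lambda>"
proof -
  have fin: "finite {s \<in> idx (concat_word f g). lab (concat_word f g) s = l}" for l
  proof (rule finite_subset)
    show "{s \<in> idx (concat_word f g). lab (concat_word f g) s = l} \<subseteq>
      inL ` {s \<in> idx f. lab f s = l} \<union> inR ` {s \<in> idx g. lab g s = l}" by auto
  qed (use wordsD(7)[OF assms(1)] wordsD(7)[OF assms(2)] in auto)
  have sub: "le (concat_word f g) \<subseteq> idx (concat_word f g) \<times> idx (concat_word f g)"
  proof (rule subrelI)
    fix x y assume "(x, y) \<in> le (concat_word f g)"
    then show "(x, y) \<in> idx (concat_word f g) \<times> idx (concat_word f g)"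
      using le_idx[OF assms(1)] le_idx[OF assms(2)]
      by (cases x rule: parts_cases; cases y rule: parts_cases) simp_all
  qed
  note fT = le_trans_word[OF assms(1)] and gT = le_trans_word[OF assms(2)]
  note fA = le_antisym_word[OF assms(1)] and gA = le_antisym_word[OF assms(2)]
  show ?thesis
    unfolding words_iff
  proof (intro conjI sub)
    show "\<forall>s\<in>idx (concat_word f g). \<forall>t\<in>idx (concat_word f g). \<forall>u\<in>idx (concat_word f g).
      (s, t) \<in> le (concat_word f g) \<longrightarrow> (t, u) \<in> le (concat_word f g) \<longrightarrow> (s, u) \<in> le (concat_word f g)"
      by (simp add: ball_Un ball_conj_distrib) (use fT gT in blast)
    show "\<forall>s\<in>idx (concat_word f g). \<forall>t\<in>idx (concat_word f g).
      (s, t) \<in> le (concat_word f g) \<longrightarrow> (t, s) \<in> le (concat_word f g) \<longrightarrow> s = t"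
      by (simp add: ball_Un ball_conj_distrib) (use fA gA in blast)
    show "\<forall>s\<in>idx (concat_word f g). \<forall>t\<in>idx (concat_word f g).
      (s, t) \<in> le (concat_word f g) \<or> (t, s) \<in> le (concat_word f g)"
      by (simp add: ball_Un ball_conj_distrib) (use le_total[OF assms(1)] le_total[OF assms(2)] in blast)
    show "\<forall>s\<in>idx (concat_word f g). (s, s) \<in> le (concat_word f g)"
      by (simp add: ball_Un le_refl[OF assms(1)] le_refl[OF assms(2)])
    show "\<forall>s\<in>idx (concat_word f g). lab (concat_word f g) s \<in> \<Lambda>"
      by (simp add: ball_Un wordsD(6)[OF assms(1)] wordsD(6)[OF assms(2)])
    show "\<forall>l\<in>\<Lambda>. finite {s \<in> idx (concat_word f g). lab (concat_word f g) s = l}"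
      using fin by blast
  qed
qed

lemma bar_in_words:
  assumes "f \<in> words \<Lambda>" "\<And>l. l \<in> \<Lambda> \<Longrightarrow> i l \<in> \<Lambda> \<and> i (i l) = l"
  shows "bar_word i f \<in> words \<Lambda>"
proof -
  have "finite {s \<in> idx f. i (lab f s) = l}" for l
    by (rule finite_subset[OF _ wordsD(7)[OF assms(1), of "i l"]])
      (use assms(2) wordsD(6)[OF assms(1)] in auto)
  note fin = this
  have sub: "le (bar_word i f) \<subseteq> idx f \<times> idx f"
    using wordsD(1)[OF assms(1)] unfolding bar_word_def by auto
  show ?thesis
    unfolding words_iff bar_word_simps
  proof (intro conjI ballI impI sub fin)
    show "(s, s) \<in> le f" if "s \<in> idx f" for s
      by (rule le_refl[OF assms(1) that])
    show "(u, s) \<in> le f" if "(t, s) \<in> le f" "(u, t) \<in> le f" for s t u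
      by (rule le_trans_word[OF assms(1) that(2,1)])
    show "s = t" if "(t, s) \<in> le f" "(s, t) \<in> le f" for s t
      by (rule le_antisym_word[OF assms(1) that(2,1)])
    show "(t, s) \<in> le f \<or> (s, t) \<in> le f" if "s \<in> idx f" "t \<in> idx f" for s t
      by (rule le_total[OF assms(1) that(2,1)])
    show "i (lab f s) \<in> \<Lambda>" if "s \<in> idx f" for s
      using assms(2) wordsD(6)[OF assms(1) that] by blast
  qed
qed

subsection \<open>Cancellation\<close>

definition cancel_data :: "('l \<Rightarrow> 'l) \<Rightarrow> 'l word \<Rightarrow> ('l \<times> nat) set \<Rightarrow> ('l \<times> nat \<Rightarrow> 'l \<times> nat) \<Rightarrow> bool" where
  "cancel_data i f T star \<longleftrightarrow> T \<subseteq> idx f \<and>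
    (\<forall>t\<in>T. star t \<in> T \<and> star (star t) = t \<and> lab f (star t) = i (lab f t) \<and>
       word_interval f t (star t) \<subseteq> T \<and>
       star ` word_interval f t (star t) = word_interval f t (star t))"

text \<open>Isomorphism from the subword of \<open>f\<close> on the positions \<open>P\<close>.
  Keeping \<open>P\<close> as a parameter avoids forming the restricted word each time.\<close>

definition is_iso :: "('l \<times> nat \<Rightarrow> 'l \<times> nat) \<Rightarrow> 'l word \<Rightarrow> ('l \<times> nat) set \<Rightarrow> 'l word \<Rightarrow> bool" where
  "is_iso \<phi> f P g \<longleftrightarrow> bij_betw \<phi> P (idx g) \<and>
     (\<forall>s\<in>P. \<forall>t\<in>P. (s, t) \<in> le f \<longleftrightarrow> (\<phi> s, \<phi> t) \<in> le g) \<and> (\<forall>s\<in>P. lab f s = lab g (\<phi> s))"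

lemma cancels_iff: "cancels i f g \<longleftrightarrow> (\<exists>T star \<phi>. cancel_data i f T star \<and> is_iso \<phi> f (idx f - T) g)"
proof -
  have "word_iso (word_restrict f (idx f - T)) g \<longleftrightarrow> (\<exists>\<phi>. is_iso \<phi> f (idx f - T) g)" for T
    unfolding word_iso_def is_iso_def by (simp add: Int_absorb1)
  moreover have "cancels i f g \<longleftrightarrow>
    (\<exists>T star. cancel_data i f T star \<and> word_iso (word_restrict f (idx f - T)) g)"
    unfolding cancels_def cancel_data_def by (intro ex_cong1) (simp only: conj_ac)
  ultimately show ?thesis by simp
qed

lemma is_iso_cancels: "is_iso \<phi> f (idx f) g \<Longrightarrow> cancels i f g"
  unfolding cancels_iff
  by (intro exI[of _ "{}"] exI[of _ id] exI[of _ \<phi>]) (auto simp: cancel_data_def)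

lemma is_isoI:
  assumes "\<forall>s\<in>P. \<phi> s \<in> idx g \<and> \<psi> (\<phi> s) = s" "\<forall>t\<in>idx g. \<psi> t \<in> P \<and> \<phi> (\<psi> t) = t"
    "\<forall>s\<in>P. \<forall>t\<in>P. (s, t) \<in> le f \<longleftrightarrow> (\<phi> s, \<phi> t) \<in> le g"
    "\<forall>s\<in>P. lab f s = lab g (\<phi> s)"
  shows "is_iso \<phi> f P g"
proof -
  have "bij_betw \<phi> P (idx g)"
    by (rule bij_betw_byWitness[where f' = \<psi>]) (use assms in \<open>simp_all add: image_subset_iff\<close>)
  then show ?thesis unfolding is_iso_def by (intro conjI assms(3,4))
qed

text \<open>\<open>f'\<close> is typically a restriction of \<open>f\<close>, of which only the
  labels and the order on \<open>Q\<close> matter.\<close>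

lemma is_iso_mono_set:
  assumes "is_iso \<phi> f P g" "Q \<subseteq> P" "\<And>s. s \<in> P \<Longrightarrow> s \<in> Q \<longleftrightarrow> \<phi> s \<in> T" "\<And>s t. s \<in> Q \<Longrightarrow> t \<in> Q \<Longrightarrow> (s, t) \<in> le f' \<longleftrightarrow> (s, t) \<in> le f"
    "lab f' = lab f"
  shows "is_iso \<phi> f' Q (word_restrict g T)"
proof -
  have b: "bij_betw \<phi> P (idx g)" and o: "\<And>s t. s \<in> P \<Longrightarrow> t \<in> P \<Longrightarrow> (s, t) \<in> le f \<longleftrightarrow> (\<phi> s, \<phi> t) \<in> le g"
    and l: "\<And>s. s \<in> P \<Longrightarrow> lab f s = lab g (\<phi> s)"
    using assms(1) unfolding is_iso_def by simp_all
  have T: "\<phi> s \<in> T" if "s \<in> Q" for s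
    using that assms(2,3) by (meson subsetD)
  have "\<phi> ` Q = idx g \<inter> T"
  proof (intro equalityI subsetI)
    fix t assume "t \<in> \<phi> ` Q"
    then obtain s where "s \<in> Q" "t = \<phi> s" by (elim imageE)
    then show "t \<in> idx g \<inter> T" using T[of s] bij_betwE[OF b] assms(2) by (simp add: subsetD)
  next
    fix t assume t: "t \<in> idx g \<inter> T"
    then have "t \<in> \<phi> ` P" using b by (simp add: bij_betw_def)
    then obtain s where "s \<in> P" "t = \<phi> s" by (elim imageE)
    then show "t \<in> \<phi> ` Q" using t assms(3)[of s] by simp
  qed
  then have "bij_betw \<phi> Q (idx g \<inter> T)"
    using b inj_on_subset[OF _ assms(2)] unfolding bij_betw_def by blast
  then show ?thesis
    unfolding is_iso_def word_restrict_simps assms(5)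
    using T assms(4) o[OF subsetD[OF assms(2)] subsetD[OF assms(2)]] l[OF subsetD[OF assms(2)]]
    by (intro conjI ballI) simp_all
qed

lemma cancels_refl: "cancels i f f"
  by (rule is_iso_cancels[of id]) (simp add: is_iso_def)

lemma word_interval_concat [simp]:
  "word_interval (concat_word f g) (inL s) (inL t) = inL ` word_interval f s t"
  "word_interval (concat_word f g) (inR s) (inR t) = inR ` word_interval g s t"
  by (auto simp: word_interval_def)

lemma cancels_concat:
  assumes "cancels i f f'" "cancels i g g'"
  shows "cancels i (concat_word f g) (concat_word f' g')"
proof -
  obtain T1 star1 \<phi>1 where 1: "cancel_data i f T1 star1" "is_iso \<phi>1 f (idx f - T1) f'"
    using assms(1) by (auto simp: cancels_iff)
  obtain T2 star2 \<phi>2 where 2: "cancel_data i g T2 star2" "is_iso \<phi>2 g (idx g - T2) g'"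
    using assms(2) by (auto simp: cancels_iff)
  let ?T = "inL ` T1 \<union> inR ` T2" and ?star = "on_parts (inL \<circ> star1) (inR \<circ> star2)"
  have "cancel_data i (concat_word f g) ?T ?star"
  proof -
    have "?star ` inL ` I = inL ` star1 ` I" "?star ` inR ` I = inR ` star2 ` I" for I
      by (simp_all add: image_image)
    then show ?thesis
      using 1(1) 2(1) unfolding cancel_data_def
      by (simp add: ball_Un)
  qed
  moreover
  have eq: "idx (concat_word f g) - ?T = inL ` (idx f - T1) \<union> inR ` (idx g - T2)"
  proof (rule Set.set_eqI)
    show "x \<in> idx (concat_word f g) - ?T \<longleftrightarrow> x \<in> inL ` (idx f - T1) \<union> inR ` (idx g - T2)" for x
      by (cases x rule: parts_cases) simp_all
  qed
  have b: "bij_betw \<phi>1 (idx f - T1) (idx f')" "bij_betw \<phi>2 (idx g - T2) (idx g')"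
    using 1(2) 2(2) by (auto simp: is_iso_def)
  define \<psi>1 where "\<psi>1 = inv_into (idx f - T1) \<phi>1"
  define \<psi>2 where "\<psi>2 = inv_into (idx g - T2) \<phi>2"
  have \<psi>1: "\<And>s. s \<in> idx f - T1 \<Longrightarrow> \<psi>1 (\<phi>1 s) = s" "\<And>t. t \<in> idx f' \<Longrightarrow> \<psi>1 t \<in> idx f - T1 \<and> \<phi>1 (\<psi>1 t) = t"
    unfolding \<psi>1_def using b(1) bij_betw_inv_into_left bij_betw_inv_into_right bij_betwE[OF bij_betw_inv_into[OF b(1)]]
    by metis+
  have \<psi>2: "\<And>s. s \<in> idx g - T2 \<Longrightarrow> \<psi>2 (\<phi>2 s) = s" "\<And>t. t \<in> idx g' \<Longrightarrow> \<psi>2 t \<in> idx g - T2 \<and> \<phi>2 (\<psi>2 t) = t"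
    unfolding \<psi>2_def using b(2) bij_betw_inv_into_left bij_betw_inv_into_right bij_betwE[OF bij_betw_inv_into[OF b(2)]]
    by metis+
  have "is_iso (on_parts (inL \<circ> \<phi>1) (inR \<circ> \<phi>2)) (concat_word f g) (idx (concat_word f g) - ?T) (concat_word f' g')"
    unfolding eq
    by (rule is_isoI[where \<psi> = "on_parts (inL \<circ> \<psi>1) (inR \<circ> \<psi>2)"])
      (use 1(2) 2(2) \<psi>1 \<psi>2 bij_betwE[OF b(1)] bij_betwE[OF b(2)] in \<open>simp_all add: is_iso_def ball_Un\<close>)
  ultimately show ?thesis unfolding cancels_iff by blast
qed

lemma cancels_concat_assoc:
  "cancels i (concat_word (concat_word f g) h) (concat_word f (concat_word g h))"
  by (rule is_iso_cancels[of "on_parts (on_parts inL (inR \<circ> inL)) (inR \<circ> inR)"],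
      rule is_isoI[where \<psi> = "on_parts (inL \<circ> inL) (on_parts (inL \<circ> inR) inR)"])
    (simp_all add: ball_Un)

lemma cancels_concat_empty: "cancels i (concat_word empty_word f) f"
  by (rule is_iso_cancels[of "on_parts id id"], rule is_isoI[where \<psi> = inR]) simp_all

lemma cancels_bar_bar:
  "(\<And>s. s \<in> idx f \<Longrightarrow> i (i (lab f s)) = lab f s) \<Longrightarrow> cancels i (bar_word i (bar_word i f)) f"
  by (rule is_iso_cancels[of id], rule is_isoI[where \<psi> = id]) simp_all

text \<open>Each position is paired with its copy in the reversed word. The interval between the two
  copies is invariant under exchanging the factors; taken in the opposite direction it is empty, and
  the conditions there are void.\<close>

lemma cancels_concat_bar:
  assumes "f \<in> words \<Lambda>" "\<And>l. l \<in> \<Lambda> \<Longrightarrow> i l \<in> \<Lambda> \<and> i (i l) = l"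
  shows "cancels i (concat_word f (bar_word i f)) empty_word"
proof -
  let ?h = "concat_word f (bar_word i f)"
  let ?star = "on_parts inR inL"
  have 1: "word_interval ?h (inL s) (inR s) = inL ` {x \<in> idx f. (s, x) \<in> le f} \<union> inR ` {x \<in> idx f. (s, x) \<in> le f}"
    if "s \<in> idx f" for s
    using that unfolding word_interval_def by auto
  have 2: "word_interval ?h (inR s) (inL s) = {}" for s
    by (auto simp: word_interval_def)
  have "cancel_data i ?h (idx ?h) ?star"
    unfolding cancel_data_def using assms(2) wordsD(6)[OF assms(1)]
    by (simp add: ball_Un 1 2 image_Un image_image Un_commute)
  moreover have "is_iso id ?h (idx ?h - idx ?h) empty_word"
    by (simp add: is_iso_def bij_betw_def)
  ultimately show ?thesis unfolding cancels_iff by blast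
qed

definition restr :: "'l set \<Rightarrow> 'l word \<Rightarrow> 'l word" where
  "restr A f = word_restrict f {s. lab f s \<in> A}"

lemma restr_simps [simp]:
  "idx (restr A f) = {s \<in> idx f. lab f s \<in> A}" "lab (restr A f) = lab f"
  "(s, t) \<in> le (restr A f) \<longleftrightarrow> (s, t) \<in> le f \<and> lab f s \<in> A \<and> lab f t \<in> A"
  by (auto simp: restr_def)

lemma restr_in_words: "f \<in> words \<Lambda> \<Longrightarrow> restr A f \<in> words A"
proof -
  assume "f \<in> words \<Lambda>"
  then have w: "restr A f \<in> words \<Lambda>"
    unfolding restr_def by (rule word_restrict_in_words)
  then have "linear_order_on (idx (restr A f)) (le (restr A f))"
    by (simp add: words_def)
  moreover have "lab (restr A f) ` idx (restr A f) \<subseteq> A" by auto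
  moreover have "\<forall>l\<in>A. finite {s \<in> idx (restr A f). lab (restr A f) s = l}"
    using wordsD(7)[OF w] by blast
  ultimately show ?thesis unfolding words_def by blast
qed

lemma restr_concat: "restr A (concat_word f g) = concat_word (restr A f) (restr A g)"
proof -
  have "(x, y) \<in> le (restr A (concat_word f g)) \<longleftrightarrow> (x, y) \<in> le (concat_word (restr A f) (restr A g))" for x y
    by (cases x rule: parts_cases; cases y rule: parts_cases) auto
  then have "le (restr A (concat_word f g)) = le (concat_word (restr A f) (restr A g))"
    by (simp add: set_eq_iff split_paired_All)
  moreover have "idx (restr A (concat_word f g)) = idx (concat_word (restr A f) (restr A g))"
  proof (rule Set.set_eqI)
    show "x \<in> idx (restr A (concat_word f g)) \<longleftrightarrow> x \<in> idx (concat_word (restr A f) (restr A g))" for x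
      by (cases x rule: parts_cases) simp_all
  qed
  moreover have "lab (restr A (concat_word f g)) = lab (concat_word (restr A f) (restr A g))"
    by simp
  ultimately show ?thesis by (intro word.equality) simp_all
qed

lemma involution_image:
  assumes "\<And>x. x \<in> J \<Longrightarrow> h x \<in> J \<and> h (h x) = x"
  shows "h ` J = J"
proof (intro equalityI subsetI)
  fix x assume "x \<in> J"
  then show "x \<in> h ` J" using assms[of x] by (intro image_eqI[of _ _ "h x"]) simp_all
next
  fix y assume "y \<in> h ` J"
  then obtain x where "x \<in> J" "y = h x" by (rule imageE)
  then show "y \<in> J" using assms[of x] by simp
qed

text \<open>The pairing inverts labels, so it preserves the set of positions with label in
  \<open>A\<close> once \<open>A\<close> is closed under inversion; intervals are simply intersected
  with that set.\<close>

lemma cancels_restr: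
  assumes "cancels i f g" "\<And>l. l \<in> A \<Longrightarrow> i l \<in> A"
  shows "cancels i (restr A f) (restr A g)"
proof -
  obtain T star \<phi> where *: "cancel_data i f T star" "is_iso \<phi> f (idx f - T) g"
    using assms(1) by (auto simp: cancels_iff)
  let ?T = "{t \<in> T. lab f t \<in> A}"
  have int: "word_interval (restr A f) t (star t) = {x \<in> word_interval f t (star t). lab f x \<in> A}"
    if "t \<in> ?T" for t
    using that * assms(2) by (auto simp: word_interval_def cancel_data_def)
  have "star ` {x \<in> word_interval f t (star t). lab f x \<in> A} = {x \<in> word_interval f t (star t). lab f x \<in> A}"
    if t: "t \<in> T" for t
  proof -
    let ?I = "word_interval f t (star t)"
    have I: "?I \<subseteq> T" "star ` ?I = ?I" using * t by (auto simp: cancel_data_def)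
    have s: "star x \<in> {x \<in> ?I. lab f x \<in> A} \<and> star (star x) = x" if "x \<in> {x \<in> ?I. lab f x \<in> A}" for x
    proof -
      have "x \<in> T" using that I by blast
      then have "star (star x) = x" "lab f (star x) = i (lab f x)" using * by (auto simp: cancel_data_def)
      moreover have "star x \<in> ?I" using I that by blast
      ultimately show ?thesis using that assms(2) by auto
    qed
    show ?thesis by (rule involution_image[OF s])
  qed
  then have "cancel_data i (restr A f) ?T star"
    using * assms(2) unfolding cancel_data_def by (auto simp: int)
  moreover have "is_iso \<phi> (restr A f) (idx (restr A f) - ?T) (restr A g)"
    unfolding restr_def[of A g]
    by (rule is_iso_mono_set[OF *(2)]) (use *(2) in \<open>auto simp: is_iso_def\<close>)
  ultimately show ?thesis unfolding cancels_iff by blast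
qed

subsection \<open>The equivalence relation\<close>

lemma word_equiv_induct [consumes 1, case_names step refl sym trans]:
  assumes "word_equiv \<Lambda> i f g"
    and "\<And>f g. f \<in> words \<Lambda> \<Longrightarrow> g \<in> words \<Lambda> \<Longrightarrow> cancels i f g \<Longrightarrow> r f g"
    and "\<And>f. r f f" "\<And>f g. r f g \<Longrightarrow> r g f" "\<And>f g h. r f g \<Longrightarrow> r g h \<Longrightarrow> r f h"
  shows "r f g"
  using assms(1) unfolding word_equiv_def equivclp_def
proof (induction rule: rtranclp_induct)
  case (step y z)
  then have "r y z"
    using assms(2,4) by (auto elim: symclpE)
  then show ?case using step assms(5) by blast
qed (rule assms(3))

lemma word_equiv_refl: "word_equiv \<Lambda> i f f"
  by (simp add: word_equiv_def)

lemma word_equiv_sym: "word_equiv \<Lambda> i f g \<Longrightarrow> word_equiv \<Lambda> i g f"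
  unfolding word_equiv_def by (rule equivclp_sym)

lemma word_equiv_trans: "word_equiv \<Lambda> i f g \<Longrightarrow> word_equiv \<Lambda> i g h \<Longrightarrow> word_equiv \<Lambda> i f h"
  unfolding word_equiv_def by (rule equivclp_trans)

lemma word_equiv_cancels:
  "f \<in> words \<Lambda> \<Longrightarrow> g \<in> words \<Lambda> \<Longrightarrow> cancels i f g \<Longrightarrow> word_equiv \<Lambda> i f g"
  unfolding word_equiv_def by (intro r_into_equivclp) simp

lemma word_equiv_map:
  assumes "word_equiv \<Lambda> i f g"
    and "\<And>f g. f \<in> words \<Lambda> \<Longrightarrow> g \<in> words \<Lambda> \<Longrightarrow> cancels i f g \<Longrightarrow> word_equiv A j (F f) (F g)"
  shows "word_equiv A j (F f) (F g)"
  using assms(1)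
proof (induction rule: word_equiv_induct)
  case (step f g)
  then show ?case by (rule assms(2))
qed (auto intro: word_equiv_refl word_equiv_sym word_equiv_trans)

lemma word_equiv_restr:
  assumes "word_equiv \<Lambda> i f g" "\<And>l. l \<in> A \<Longrightarrow> i l \<in> A"
  shows "word_equiv A i (restr A f) (restr A g)"
  using assms(1)
  by (rule word_equiv_map) (intro word_equiv_cancels restr_in_words cancels_restr assms(2))

lemma word_equiv_concat:
  assumes "word_equiv \<Lambda> i f f'" "word_equiv \<Lambda> i g g'" "f' \<in> words \<Lambda>" "g \<in> words \<Lambda>"
  shows "word_equiv \<Lambda> i (concat_word f g) (concat_word f' g')"
proof (rule word_equiv_trans)
  show "word_equiv \<Lambda> i (concat_word f g) (concat_word f' g)"
    by (rule word_equiv_map[OF assms(1)])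
      (intro word_equiv_cancels concat_in_words cancels_concat cancels_refl assms)
  show "word_equiv \<Lambda> i (concat_word f' g) (concat_word f' g')"
    by (rule word_equiv_map[OF assms(2)])
      (intro word_equiv_cancels concat_in_words cancels_concat cancels_refl assms)
qed

lemma word_class_eq:
  assumes "f \<in> words \<Lambda>" "g \<in> words \<Lambda>"
  shows "word_class \<Lambda> i f = word_class \<Lambda> i g \<longleftrightarrow> word_equiv \<Lambda> i f g"
proof
  assume "word_class \<Lambda> i f = word_class \<Lambda> i g"
  then show "word_equiv \<Lambda> i f g"
    using assms word_equiv_refl[of \<Lambda> i g] by (auto simp: word_class_def)
next
  assume "word_equiv \<Lambda> i f g"
  then show "word_class \<Lambda> i f = word_class \<Lambda> i g"
    unfolding word_class_def using word_equiv_sym word_equiv_trans by blast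
qed

lemma word_class_self: "f \<in> words \<Lambda> \<Longrightarrow> f \<in> word_class \<Lambda> i f"
  by (simp add: word_class_def word_equiv_refl)

lemma in_word_class: "g \<in> word_class \<Lambda> i f \<longleftrightarrow> g \<in> words \<Lambda> \<and> word_equiv \<Lambda> i f g"
  by (simp add: word_class_def)

section \<open>The group of words modulo cancellation and its projections to smaller
  alphabets\<close>

locale big_free =
  fixes \<Lambda> :: "'l set" and i :: "'l \<Rightarrow> 'l"
  assumes invol: "\<And>l. l \<in> \<Lambda> \<Longrightarrow> i l \<in> \<Lambda> \<and> i (i l) = l"
begin

abbreviation "cls \<equiv> word_class \<Lambda> i"

lemma bar_words: "f \<in> words \<Lambda> \<Longrightarrow> bar_word i f \<in> words \<Lambda>"
  using bar_in_words invol by blast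

lemma cls_eq_cancels: "f \<in> words \<Lambda> \<Longrightarrow> g \<in> words \<Lambda> \<Longrightarrow> cancels i f g \<Longrightarrow> cls f = cls g"
  by (simp add: word_class_eq word_equiv_cancels)

lemma mult_cls:
  assumes f: "f \<in> words \<Lambda>" and g: "g \<in> words \<Lambda>"
  shows "cls f \<otimes>\<^bsub>BF \<Lambda> i\<^esub> cls g = cls (concat_word f g)"
proof -
  have "cls (concat_word f' g') = cls (concat_word f g)" if "f' \<in> cls f" "g' \<in> cls g" for f' g'
    using that word_equiv_concat[of \<Lambda> i f f' g g'] f g
    by (subst word_class_eq) (auto simp: in_word_class concat_in_words word_equiv_sym)
  then have "cls f \<otimes>\<^bsub>BF \<Lambda> i\<^esub> cls g = (\<Union>f'\<in>cls f. \<Union>g'\<in>cls g. cls (concat_word f g))"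
    by (simp add: BF_def)
  moreover have "cls f \<noteq> {}" "cls g \<noteq> {}"
    using word_class_self[OF f] word_class_self[OF g] by blast+
  ultimately show ?thesis by simp
qed

lemma carrier_BF: "carrier (BF \<Lambda> i) = cls ` words \<Lambda>"
  by (simp add: BF_def)

lemma one_BF: "\<one>\<^bsub>BF \<Lambda> i\<^esub> = cls empty_word"
  by (simp add: BF_def)

lemma cls_concat_bar: "f \<in> words \<Lambda> \<Longrightarrow> cls (concat_word f (bar_word i f)) = cls empty_word"
  using cancels_concat_bar[of f \<Lambda> i] invol
  by (intro cls_eq_cancels concat_in_words bar_words empty_in_words) auto

lemma cls_bar_concat:
  assumes "f \<in> words \<Lambda>"
  shows "cls (concat_word (bar_word i f) f) = cls empty_word"
proof -
  have "cls (concat_word (bar_word i f) (bar_word i (bar_word i f))) = cls (concat_word (bar_word i f) f)"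
    using assms invol wordsD(6)[OF assms]
    by (intro cls_eq_cancels concat_in_words bar_words cancels_concat cancels_refl cancels_bar_bar) auto
  then show ?thesis using cls_concat_bar[OF bar_words[OF assms]] by simp
qed

lemma group_BF: "group (BF \<Lambda> i)"
proof (rule groupI)
  show "\<one>\<^bsub>BF \<Lambda> i\<^esub> \<in> carrier (BF \<Lambda> i)" by (simp add: carrier_BF one_BF)
  fix x assume "x \<in> carrier (BF \<Lambda> i)"
  then obtain f where f: "f \<in> words \<Lambda>" "x = cls f" by (auto simp: carrier_BF)
  show "\<one>\<^bsub>BF \<Lambda> i\<^esub> \<otimes>\<^bsub>BF \<Lambda> i\<^esub> x = x"
    using f by (simp add: one_BF mult_cls) (intro cls_eq_cancels concat_in_words cancels_concat_empty; simp)
  show "\<exists>y\<in>carrier (BF \<Lambda> i). y \<otimes>\<^bsub>BF \<Lambda> i\<^esub> x = \<one>\<^bsub>BF \<Lambda> i\<^esub>"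
    using f by (intro bexI[of _ "cls (bar_word i f)"])
      (auto simp: mult_cls bar_words cls_bar_concat one_BF carrier_BF)
  fix y assume "y \<in> carrier (BF \<Lambda> i)"
  then obtain g where g: "g \<in> words \<Lambda>" "y = cls g" by (auto simp: carrier_BF)
  show "x \<otimes>\<^bsub>BF \<Lambda> i\<^esub> y \<in> carrier (BF \<Lambda> i)"
    using f g by (simp add: mult_cls carrier_BF concat_in_words)
  fix z assume "z \<in> carrier (BF \<Lambda> i)"
  then obtain h where h: "h \<in> words \<Lambda>" "z = cls h" by (auto simp: carrier_BF)
  show "x \<otimes>\<^bsub>BF \<Lambda> i\<^esub> y \<otimes>\<^bsub>BF \<Lambda> i\<^esub> z = x \<otimes>\<^bsub>BF \<Lambda> i\<^esub> (y \<otimes>\<^bsub>BF \<Lambda> i\<^esub> z)"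
    using f g h by (simp add: mult_cls concat_in_words)
      (intro cls_eq_cancels concat_in_words cancels_concat_assoc)
qed

lemma inv_cls: "f \<in> words \<Lambda> \<Longrightarrow> inv\<^bsub>BF \<Lambda> i\<^esub> (cls f) = cls (bar_word i f)"
  by (rule group.inv_equality[OF group_BF])
    (auto simp: mult_cls bar_words cls_bar_concat one_BF carrier_BF)

text \<open>A finite word is the product of its letters, split off from the least position on. This
  serves for the density of the finitary part as well as for the groups over finite
  alphabets.\<close>

lemma finite_word_in_subgroup:
  assumes H: "subgroup H (BF \<Lambda> i)"
    and "f \<in> words \<Lambda>" "finite (idx f)" "\<And>s. s \<in> idx f \<Longrightarrow> cls (one_letter (lab f s)) \<in> H"
  shows "cls f \<in> H"
  using assms(2-)
proof (induction "card (idx f)" arbitrary: f)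
  case 0
  then have "is_iso id f (idx f) empty_word" by (simp add: is_iso_def bij_betw_def)
  then have "cls f = cls empty_word"
    using 0 by (intro cls_eq_cancels is_iso_cancels) auto
  then show ?case using subgroup.one_closed[OF H] by (simp add: one_BF)
next
  case (Suc n)
  then have "idx f \<noteq> {}" by auto
  then obtain s where s: "s \<in> idx f" "\<forall>t\<in>idx f. (s, t) \<in> le f"
    using finite_word_min[OF Suc.prems(1,2)] by blast
  let ?l = "lab f s" and ?g = "word_restrict f (idx f - {s})"
  have l: "?l \<in> \<Lambda>" using wordsD(6)[OF Suc.prems(1) s(1)] .
  have g: "?g \<in> words \<Lambda>" by (rule word_restrict_in_words[OF Suc.prems(1)])
  have "card (idx ?g) = n" "finite (idx ?g)"
    using Suc.hyps(2) Suc.prems(2) s(1) by (auto simp: Int_absorb1)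
  then have "cls ?g \<in> H"
    using Suc.hyps(1)[of ?g] g Suc.prems(3) by auto
  moreover have "cls (one_letter ?l) \<in> H" using Suc.prems(3) s by blast
  ultimately have "cls (one_letter ?l) \<otimes>\<^bsub>BF \<Lambda> i\<^esub> cls ?g \<in> H"
    using subgroup.m_closed[OF H] by blast
  moreover have A: "(t, s) \<in> le f \<longleftrightarrow> t = s" if "t \<in> idx f" for t
    using s le_antisym_word[OF Suc.prems(1)] that by blast
  have "is_iso (\<lambda>t. if t = s then inL (?l, 0) else inR t) f (idx f) (concat_word (one_letter ?l) ?g)"
    by (rule is_isoI[where \<psi> = "on_parts (\<lambda>_. s) id"])
      (use s A in \<open>simp_all add: ball_Un\<close>)
  then have "cls f = cls (concat_word (one_letter ?l) ?g)"
    using Suc.prems(1) g one_letter_in_words[OF l] by (intro cls_eq_cancels is_iso_cancels concat_in_words)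
  ultimately show ?case using g one_letter_in_words[OF l] by (simp add: mult_cls)
qed

lemma big_free_subset: "A \<subseteq> \<Lambda> \<Longrightarrow> i ` A = A \<Longrightarrow> big_free A i"
  using invol by unfold_locales auto

lemma letter_proj_cls:
  assumes "A \<subseteq> \<Lambda>" "i ` A = A" "f \<in> words \<Lambda>"
  shows "letter_proj i A (cls f) = word_class A i (restr A f)"
proof -
  have A: "i l \<in> A" if "l \<in> A" for l using assms(2) that by blast
  have "word_class A i (restr A g) = word_class A i (restr A f)" if "g \<in> cls f" for g
  proof -
    have g: "g \<in> words \<Lambda>" "word_equiv \<Lambda> i f g" using that by (auto simp: in_word_class)
    have "word_equiv A i (restr A g) (restr A f)"
      by (rule word_equiv_restr[OF word_equiv_sym[OF g(2)] A])
    then show ?thesis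
      using word_class_eq restr_in_words[OF g(1)] restr_in_words[OF assms(3)] by blast
  qed
  then have "letter_proj i A (cls f) = (\<Union>g\<in>cls f. word_class A i (restr A f))"
    unfolding letter_proj_def restr_def[symmetric] by simp
  moreover have "cls f \<noteq> {}"
    using word_class_self[OF assms(3)] by blast
  ultimately show ?thesis by simp
qed

lemma letter_proj_hom:
  assumes "A \<subseteq> \<Lambda>" "i ` A = A"
  shows "group_hom (BF \<Lambda> i) (BF A i) (letter_proj i A)"
proof -
  interpret A: big_free A i by (rule big_free_subset[OF assms])
  show ?thesis
    unfolding group_hom_def group_hom_axioms_def
  proof (intro conjI group_BF A.group_BF homI)
    fix x assume "x \<in> carrier (BF \<Lambda> i)"
    then obtain f where f: "f \<in> words \<Lambda>" "x = cls f" by (auto simp: carrier_BF)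
    then show "letter_proj i A x \<in> carrier (BF A i)"
      using restr_in_words by (auto simp: letter_proj_cls[OF assms] A.carrier_BF)
    fix y assume "y \<in> carrier (BF \<Lambda> i)"
    then obtain g where g: "g \<in> words \<Lambda>" "y = cls g" by (auto simp: carrier_BF)
    show "letter_proj i A (x \<otimes>\<^bsub>BF \<Lambda> i\<^esub> y) = letter_proj i A x \<otimes>\<^bsub>BF A i\<^esub> letter_proj i A y"
      using f g restr_in_words[OF f(1)] restr_in_words[OF g(1)]
      by (simp add: mult_cls letter_proj_cls[OF assms] concat_in_words A.mult_cls restr_concat)
  qed
qed

lemma ker_proj_normal:
  assumes "A \<subseteq> \<Lambda>" "i ` A = A"
  shows "ker_proj \<Lambda> i A \<lhd> BF \<Lambda> i"
  unfolding ker_proj_def by (rule group_hom.normal_kernel[OF letter_proj_hom[OF assms]])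

lemma cls_in_ker_proj:
  assumes "A \<subseteq> \<Lambda>" "i ` A = A" "f \<in> words \<Lambda>"
  shows "cls f \<in> ker_proj \<Lambda> i A \<longleftrightarrow> word_equiv A i (restr A f) empty_word"
proof -
  interpret A: big_free A i by (rule big_free_subset[OF assms(1,2)])
  show ?thesis
    using assms restr_in_words[OF assms(3)]
    by (simp add: ker_proj_def kernel_def carrier_BF letter_proj_cls A.one_BF word_class_eq)
qed

lemma ker_proj_mono:
  assumes "B \<subseteq> A" "A \<subseteq> \<Lambda>" "i ` A = A" "i ` B = B"
  shows "ker_proj \<Lambda> i A \<subseteq> ker_proj \<Lambda> i B"
proof
  fix x assume x: "x \<in> ker_proj \<Lambda> i A"
  then obtain f where f: "f \<in> words \<Lambda>" "x = cls f" by (auto simp: carrier_BF ker_proj_def kernel_def)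
  then have "word_equiv A i (restr A f) empty_word"
    using x assms by (simp add: cls_in_ker_proj)
  then have "word_equiv B i (restr B (restr A f)) (restr B empty_word)"
    using assms(4) by (intro word_equiv_restr) auto
  moreover have "restr B (restr A f) = restr B f"
    using assms(1) by (auto simp: restr_def word_restrict_def)
  moreover have "restr B empty_word = empty_word"
    by (simp add: restr_def word_restrict_def empty_word_def)
  ultimately show "x \<in> ker_proj \<Lambda> i B"
    using f assms by (simp add: cls_in_ker_proj)
qed

text \<open>Deleting the letters outside \<open>A\<close> does not affect the projection to a
  smaller \<open>B\<close>: truncations of a word approximate it in the natural topology.\<close>

lemma inv_mult_restr_in_ker_proj:
  assumes "B \<subseteq> A" "A \<subseteq> \<Lambda>" "i ` B = B" "f \<in> words \<Lambda>"
  shows "inv\<^bsub>BF \<Lambda> i\<^esub> (cls f) \<otimes>\<^bsub>BF \<Lambda> i\<^esub> cls (restr A f) \<in> ker_proj \<Lambda> i B"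
proof -
  have B: "B \<subseteq> \<Lambda>" using assms by blast
  interpret h: group_hom "BF \<Lambda> i" "BF B i" "letter_proj i B"
    by (rule letter_proj_hom[OF B assms(3)])
  have w: "restr A f \<in> words \<Lambda>"
    using restr_in_words[OF assms(4), of A] word_restrict_in_words[OF assms(4)] by (simp add: restr_def)
  have c: "cls f \<in> carrier (BF \<Lambda> i)" "cls (restr A f) \<in> carrier (BF \<Lambda> i)"
    using w assms by (auto simp: carrier_BF)
  have "restr B (restr A f) = restr B f"
    using assms(1) by (auto simp: restr_def word_restrict_def)
  then have "letter_proj i B (cls (restr A f)) = letter_proj i B (cls f)"
    using w assms B by (simp add: letter_proj_cls)
  then show ?thesis
    using c by (simp add: ker_proj_def kernel_def)
qed

lemma admissible_empty:
  assumes "admissible \<Lambda> i S" "S \<noteq> {}"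
  shows "empty_word \<in> S"
proof -
  obtain f where f: "f \<in> S" "f \<in> words \<Lambda>" using assms by (auto simp: admissible_def)
  then have "concat_word f (bar_word i f) \<in> S" using assms by (auto simp: admissible_def)
  then show ?thesis
    using assms cancels_concat_bar[OF f(2)] invol empty_in_words unfolding admissible_def by blast
qed

lemma subgroup_BF_sub:
  assumes "admissible \<Lambda> i S" "S \<noteq> {}"
  shows "subgroup (cls ` S) (BF \<Lambda> i)"
proof
  have S: "S \<subseteq> words \<Lambda>" using assms by (simp add: admissible_def)
  show "cls ` S \<subseteq> carrier (BF \<Lambda> i)" using S by (auto simp: carrier_BF)
  show "\<one>\<^bsub>BF \<Lambda> i\<^esub> \<in> cls ` S" using admissible_empty[OF assms] by (simp add: one_BF)
  show "x \<otimes>\<^bsub>BF \<Lambda> i\<^esub> y \<in> cls ` S" if "x \<in> cls ` S" "y \<in> cls ` S" for x y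
  proof -
    from that obtain f g where fg: "f \<in> S" "g \<in> S" "x = cls f" "y = cls g" by blast
    then have "x \<otimes>\<^bsub>BF \<Lambda> i\<^esub> y = cls (concat_word f g)" using S mult_cls by blast
    moreover have "concat_word f g \<in> S" using assms fg unfolding admissible_def by blast
    ultimately show ?thesis by blast
  qed
  show "inv\<^bsub>BF \<Lambda> i\<^esub> x \<in> cls ` S" if "x \<in> cls ` S" for x
  proof -
    from that obtain f where f: "f \<in> S" "x = cls f" by blast
    then have "inv\<^bsub>BF \<Lambda> i\<^esub> x = cls (bar_word i f)" using S inv_cls by blast
    moreover have "bar_word i f \<in> S" using assms f unfolding admissible_def by blast
    ultimately show ?thesis by blast
  qed
qed

end

section \<open>Products over finite sets of positions\<close>

definition enum :: "'l word \<Rightarrow> ('l \<times> nat) set \<Rightarrow> ('l \<times> nat) list \<Rightarrow> bool" where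
  "enum f P l \<longleftrightarrow> distinct l \<and> set l = P \<and> sorted_wrt (\<lambda>s t. (s, t) \<in> le f) l"

definition sorted_positions :: "'l word \<Rightarrow> ('l \<times> nat) set \<Rightarrow> ('l \<times> nat) list" where
  "sorted_positions f P = (THE l. enum f P l)"

lemma enum_unique:
  assumes f: "f \<in> words \<Lambda>" and "enum f P l" "enum f P l'"
  shows "l = l'"
  using assms(2,3)
proof (induction l arbitrary: P l')
  case Nil
  then show ?case by (auto simp: enum_def)
next
  case (Cons s l)
  then obtain s' k where l': "l' = s' # k" by (cases l') (auto simp: enum_def)
  have s: "s \<in> P" "\<forall>t\<in>P. t = s \<or> (s, t) \<in> le f" "enum f (P - {s}) l"
    using Cons.prems(1) by (auto simp: enum_def)
  have s': "s' \<in> P" "\<forall>t\<in>P. t = s' \<or> (s', t) \<in> le f" "enum f (P - {s'}) k"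
    using Cons.prems(2) unfolding l' by (auto simp: enum_def)
  have "s = s'" using s s' le_antisym_word[OF f] by metis
  then show ?case using Cons.IH[of "P - {s}" k] s s' l' by simp
qed

lemma sorted_positions_eq:
  assumes "f \<in> words \<Lambda>" "enum f P l"
  shows "sorted_positions f P = l"
  unfolding sorted_positions_def
proof (rule the_equality)
  show "l' = l" if "enum f P l'" for l'
    by (rule enum_unique[OF assms(1) that assms(2)])
qed (rule assms(2))

lemma enum_sorted_positions:
  assumes f: "f \<in> words \<Lambda>" and "finite P" "P \<subseteq> idx f"
  shows "enum f P (sorted_positions f P)"
proof -
  have "\<exists>l. enum f P l"
    using assms(2,3)
  proof (induction "card P" arbitrary: P)
    case 0
    then show ?case by (intro exI[of _ "[]"]) (simp add: enum_def)
  next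
    case (Suc n)
    then have "P \<noteq> {}" by auto
    then obtain s where s: "s \<in> P" "\<forall>t\<in>P. (s, t) \<in> le f"
      using finite_word_min[OF f Suc.prems(1) _ Suc.prems(2)] by metis
    have "n = card (P - {s})" using Suc.hyps(2) Suc.prems(1) s(1) by simp
    then obtain l where "enum f (P - {s}) l"
      using Suc.hyps(1)[of "P - {s}"] Suc.prems by blast
    then have "enum f P (s # l)" using s by (auto simp: enum_def)
    then show ?case by blast
  qed
  then obtain l where "enum f P l" ..
  then show ?thesis using sorted_positions_eq[OF f, of P l] by simp
qed

lemma set_sorted_positions:
  assumes "f \<in> words \<Lambda>" "finite P" "P \<subseteq> idx f"
  shows "set (sorted_positions f P) = P"
  using enum_sorted_positions[OF assms] unfolding enum_def by blast

lemma sorted_positions_union: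
  assumes f: "f \<in> words \<Lambda>" and P: "finite P" "P \<subseteq> idx f" and Q: "finite Q" "Q \<subseteq> idx f"
    and less: "\<And>s t. s \<in> P \<Longrightarrow> t \<in> Q \<Longrightarrow> (s, t) \<in> le f \<and> s \<noteq> t"
  shows "sorted_positions f (P \<union> Q) = sorted_positions f P @ sorted_positions f Q"
proof (rule sorted_positions_eq[OF f])
  show "enum f (P \<union> Q) (sorted_positions f P @ sorted_positions f Q)"
    using enum_sorted_positions[OF f P] enum_sorted_positions[OF f Q] less
    by (auto simp: enum_def sorted_wrt_append)
qed

lemma sorted_positions_single: "f \<in> words \<Lambda> \<Longrightarrow> sorted_positions f {s} = [s]"
  by (rule sorted_positions_eq) (auto simp: enum_def)

lemma sorted_positions_empty: "f \<in> words \<Lambda> \<Longrightarrow> sorted_positions f {} = []"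
  by (rule sorted_positions_eq) (auto simp: enum_def)

lemma sorted_positions_map:
  assumes f: "f \<in> words \<Lambda>" and g: "g \<in> words \<Lambda>'" and P: "finite P" "P \<subseteq> idx f"
    and inj: "inj_on \<phi> P"
    and mono: "\<And>s t. s \<in> P \<Longrightarrow> t \<in> P \<Longrightarrow> (s, t) \<in> le f \<Longrightarrow> (\<phi> s, \<phi> t) \<in> le g"
  shows "sorted_positions g (\<phi> ` P) = map \<phi> (sorted_positions f P)"
proof (rule sorted_positions_eq[OF g])
  have e: "enum f P (sorted_positions f P)" by (rule enum_sorted_positions[OF f P])
  then have d: "distinct (sorted_positions f P)" and set: "set (sorted_positions f P) = P"
    and sorted: "sorted_wrt (\<lambda>s t. (s, t) \<in> le f) (sorted_positions f P)"
    by (simp_all add: enum_def)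
  have "sorted_wrt (\<lambda>s t. (\<phi> s, \<phi> t) \<in> le g) (sorted_positions f P)"
  proof (rule sorted_wrt_mono_rel[OF _ sorted])
    fix s t assume "s \<in> set (sorted_positions f P)" "t \<in> set (sorted_positions f P)" "(s, t) \<in> le f"
    then show "(\<phi> s, \<phi> t) \<in> le g" unfolding set by (rule mono)
  qed
  then show "enum g (\<phi> ` P) (map \<phi> (sorted_positions f P))"
    using d set inj by (simp add: enum_def distinct_map sorted_wrt_map)
qed

lemma sorted_positions_rev:
  assumes f: "f \<in> words \<Lambda>" and g: "bar_word i f \<in> words \<Lambda>" and P: "finite P" "P \<subseteq> idx f"
  shows "sorted_positions (bar_word i f) P = rev (sorted_positions f P)"
  by (rule sorted_positions_eq[OF g]) (use enum_sorted_positions[OF f P] in \<open>simp add: enum_def sorted_wrt_rev\<close>)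

text \<open>The action of a finite subword, indexed by a set of positions of a fixed word so that
  different finite approximations of that word can be compared.\<close>

definition part_prod :: "(letter \<times> letter) word \<Rightarrow> ((letter \<times> letter) \<times> nat) set \<Rightarrow> letter list \<Rightarrow> letter list" where
  "part_prod f P = elem_prod (map (lab f) (sorted_positions f P))"

lemma labels_sorted_positions:
  assumes f: "f \<in> words Elem" and P: "finite P" "P \<subseteq> idx f"
  shows "set (map (lab f) (sorted_positions f P)) \<subseteq> Elem"
proof -
  have "lab f s \<in> Elem" if "s \<in> P" for s
    using wordsD(6)[OF f] P(2) that by blast
  then show ?thesis using set_sorted_positions[OF f P] by (simp add: image_subset_iff)
qed

lemma part_prod_in_Aut:
  assumes "f \<in> words Elem" "finite P" "P \<subseteq> idx f"
  shows "part_prod f P \<in> carrier Aut_F_omega"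
  unfolding part_prod_def by (rule elem_prod_in_Aut[OF labels_sorted_positions[OF assms]])

lemma part_prod_union:
  assumes f: "f \<in> words Elem" and P: "finite P" "P \<subseteq> idx f" and Q: "finite Q" "Q \<subseteq> idx f"
    and less: "\<And>s t. s \<in> P \<Longrightarrow> t \<in> Q \<Longrightarrow> (s, t) \<in> le f \<and> s \<noteq> t"
  shows "part_prod f (P \<union> Q) = part_prod f P \<cdot> part_prod f Q"
  unfolding part_prod_def using elem_prod_append[OF labels_sorted_positions[OF f P] labels_sorted_positions[OF f Q]]
  by (simp add: sorted_positions_union[OF f P Q less])

lemma part_prod_single: "f \<in> words Elem \<Longrightarrow> s \<in> idx f \<Longrightarrow> part_prod f {s} = elem_aut (lab f s)"
  using wordsD(6)[of f Elem s] by (simp add: part_prod_def sorted_positions_single group_Aut group.is_monoid monoid.r_one)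

lemma part_prod_empty: "f \<in> words Elem \<Longrightarrow> part_prod f {} = \<one>\<^sub>A"
  by (simp add: part_prod_def sorted_positions_empty)

lemma part_prod_map:
  assumes f: "f \<in> words Elem" and g: "g \<in> words Elem" and P: "finite P" "P \<subseteq> idx f"
    and inj: "inj_on \<phi> P"
    and mono: "\<And>s t. s \<in> P \<Longrightarrow> t \<in> P \<Longrightarrow> (s, t) \<in> le f \<Longrightarrow> (\<phi> s, \<phi> t) \<in> le g"
    and lab: "\<And>s. s \<in> P \<Longrightarrow> lab g (\<phi> s) = lab f s"
  shows "part_prod g (\<phi> ` P) = part_prod f P"
proof -
  have "map (lab g) (map \<phi> (sorted_positions f P)) = map (lab f) (sorted_positions f P)"
    using lab set_sorted_positions[OF f P] by simp
  moreover have "sorted_positions g (\<phi> ` P) = map \<phi> (sorted_positions f P)"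
    by (rule sorted_positions_map[OF f g P inj]) (rule mono)
  ultimately show ?thesis
    unfolding part_prod_def by metis
qed

lemma part_prod_restrict:
  assumes f: "f \<in> words Elem" and P: "finite P" "P \<subseteq> idx f" "P \<subseteq> T"
  shows "part_prod (word_restrict f T) P = part_prod f P"
  using part_prod_map[OF f word_restrict_in_words[OF f, of T] P(1,2), of id] P(3) by auto

lemma bar_Elem: "f \<in> words Elem \<Longrightarrow> bar_word elem_inv f \<in> words Elem"
  by (rule bar_in_words) auto

lemma part_prod_bar:
  assumes f: "f \<in> words Elem" and P: "finite P" "P \<subseteq> idx f"
  shows "part_prod (bar_word elem_inv f) P = inv\<^sub>A (part_prod f P)"
proof -
  have "map (lab (bar_word elem_inv f)) (sorted_positions (bar_word elem_inv f) P) = einv (map (lab f) (sorted_positions f P))"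
    by (simp add: sorted_positions_rev[OF f bar_Elem[OF f] P] einv_def rev_map)
  then show ?thesis
    unfolding part_prod_def using elem_prod_einv[OF labels_sorted_positions[OF f P]] by simp
qed

lemma part_prod_concat:
  assumes f: "f \<in> words Elem" and P: "finite P" "P \<subseteq> idx f"
    and g: "g \<in> words Elem" and Q: "finite Q" "Q \<subseteq> idx g"
  shows "part_prod (concat_word f g) (inL ` P \<union> inR ` Q) = part_prod f P \<cdot> part_prod g Q"
proof -
  have h: "concat_word f g \<in> words Elem" by (rule concat_in_words[OF f g])
  have "part_prod (concat_word f g) (inL ` P) = part_prod f P"
    by (rule part_prod_map[OF f h P]) (simp_all add: inj_on_def)
  moreover have "part_prod (concat_word f g) (inR ` Q) = part_prod g Q"
    by (rule part_prod_map[OF g h Q]) (simp_all add: inj_on_def)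
  moreover have "part_prod (concat_word f g) (inL ` P \<union> inR ` Q) =
      part_prod (concat_word f g) (inL ` P) \<cdot> part_prod (concat_word f g) (inR ` Q)"
  proof (rule part_prod_union[OF h])
    fix s t assume "s \<in> inL ` P" "t \<in> inR ` Q"
    then obtain s' t' where "s' \<in> P" "s = inL s'" "t' \<in> Q" "t = inR t'" by (elim imageE)
    then show "(s, t) \<in> le (concat_word f g) \<and> s \<noteq> t" using P(2) Q(2) by (simp add: subsetD)
  qed (use P Q in \<open>simp_all add: image_mono le_supI1 le_supI2\<close>)
  ultimately show ?thesis by simp
qed

subsection \<open>Invariance under cancellation\<close>

lemma elem_inv_neq: "elem_inv e \<noteq> e"
  by (cases e) (simp add: elem_inv_def)

text \<open>The interval condition makes \<open>t\<close> and \<open>t'\<close> neighbours, so the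
  product splits as left part, \<open>t\<close>, \<open>t'\<close>, right part, and the two middle
  factors cancel.\<close>

lemma part_prod_remove_pair:
  assumes f: "f \<in> words Elem" "finite (idx f)" and t: "t \<in> idx f" "t' \<in> idx f" "t \<noteq> t'"
    and int: "word_interval f t t' = {t, t'}" and lab: "lab f t' = elem_inv (lab f t)"
  shows "part_prod f (idx f) = part_prod f (idx f - {t, t'})"
proof -
  interpret A: group Aut_F_omega by (rule group_Aut)
  let ?L = "{x \<in> idx f. (x, t) \<in> le f \<and> x \<noteq> t}" and ?R = "{x \<in> idx f. (t', x) \<in> le f \<and> x \<noteq> t'}"
  have tt': "(t, t') \<in> le f" using int by (auto simp: word_interval_def)
  have LR: "(x, y) \<in> le f \<and> x \<noteq> y" if "x \<in> ?L" "y \<in> ?R" for x y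
    using that le_trans_word[OF f(1)] le_antisym_word[OF f(1)] tt' t(3) by (smt (verit) mem_Collect_eq)
  have between: "x = t \<or> x = t'" if "x \<in> idx f" "(t, x) \<in> le f" "(x, t') \<in> le f" for x
    using that int by (auto simp: word_interval_def)
  have split: "x \<in> ?L \<or> x = t \<or> x = t' \<or> x \<in> ?R" if "x \<in> idx f" for x
    using that between[of x] le_total[OF f(1) that t(1)] le_total[OF f(1) that t(2)] by blast
  have notLR: "t \<notin> ?L \<union> ?R" "t' \<notin> ?L \<union> ?R"
    using tt' t(3) le_antisym_word[OF f(1)] by blast+
  have fin: "finite ?L" "finite ?R" using f(2) by auto
  have idx1: "idx f = ?L \<union> ({t} \<union> ({t'} \<union> ?R))"
    using split t by blast
  have idx2: "idx f - {t, t'} = ?L \<union> ?R"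
    using split notLR by blast
  have 1: "part_prod f ({t'} \<union> ?R) = part_prod f {t'} \<cdot> part_prod f ?R"
    by (rule part_prod_union[OF f(1)]) (use fin t in auto)
  have 2: "part_prod f ({t} \<union> ({t'} \<union> ?R)) = part_prod f {t} \<cdot> part_prod f ({t'} \<union> ?R)"
  proof (rule part_prod_union[OF f(1)])
    fix s u assume "s \<in> {t}" "u \<in> {t'} \<union> ?R"
    then show "(s, u) \<in> le f \<and> s \<noteq> u"
      using tt' t(3) le_trans_word[OF f(1) tt'] notLR(1) by blast
  qed (use fin t in auto)
  have 3: "part_prod f (?L \<union> ({t} \<union> ({t'} \<union> ?R))) = part_prod f ?L \<cdot> part_prod f ({t} \<union> ({t'} \<union> ?R))"
  proof (rule part_prod_union[OF f(1)])
    fix s u assume su: "s \<in> ?L" "u \<in> {t} \<union> ({t'} \<union> ?R)"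
    then consider "u = t" | "u = t'" | "u \<in> ?R" by blast
    then show "(s, u) \<in> le f \<and> s \<noteq> u"
    proof cases
      case 2
      then show ?thesis using su(1) le_trans_word[OF f(1) _ tt'] notLR(2) by blast
    qed (use su LR in blast)+
  qed (use fin t in auto)
  have 4: "part_prod f (?L \<union> ?R) = part_prod f ?L \<cdot> part_prod f ?R"
  proof (rule part_prod_union[OF f(1)])
    show "(x, y) \<in> le f \<and> x \<noteq> y" if "x \<in> ?L" "y \<in> ?R" for x y
      by (rule LR[OF that])
  qed (use fin in auto)
  have c: "part_prod f ?L \<in> carrier Aut_F_omega" "part_prod f ?R \<in> carrier Aut_F_omega"
    by (rule part_prod_in_Aut[OF f(1)]; use fin in auto)+
  have e: "lab f t \<in> Elem" using wordsD(6)[OF f(1) t(1)] .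
  have 5: "part_prod f ({t} \<union> ({t'} \<union> ?R)) = part_prod f ?R"
    unfolding 2 1 part_prod_single[OF f(1) t(1)] part_prod_single[OF f(1) t(2)] lab
    using e c elem_aut_inv_mult[OF e] by (simp add: A.m_assoc[symmetric])
  have "part_prod f (idx f) = part_prod f (?L \<union> ({t} \<union> ({t'} \<union> ?R)))"
    by (rule arg_cong[OF idx1])
  also have "\<dots> = part_prod f ?L \<cdot> part_prod f ?R"
    by (simp only: 3 5)
  also have "\<dots> = part_prod f (idx f - {t, t'})"
    by (simp only: 4 idx2)
  finally show ?thesis .
qed

text \<open>A pair whose interval has the fewest elements consists of neighbours, since any further
  position in the interval would belong to a pair with a smaller one. Removing it leaves a
  cancellation pattern on a shorter word.\<close>

lemma part_prod_cancel_data: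
  assumes "f \<in> words Elem" "finite (idx f)" "cancel_data elem_inv f T star"
  shows "part_prod f (idx f) = part_prod f (idx f - T)"
  using assms
proof (induction "card T" arbitrary: f T rule: less_induct)
  case less
  note f = less.prems(1,2) and D = less.prems(3)[unfolded cancel_data_def]
  have T: "T \<subseteq> idx f" "finite T" using D f(2) finite_subset by blast+
  have D': "star t \<in> T" "star (star t) = t" "lab f (star t) = elem_inv (lab f t)"
    "word_interval f t (star t) \<subseteq> T" "star ` word_interval f t (star t) = word_interval f t (star t)"
    if "t \<in> T" for t using D that by blast+
  have ne: "star t \<noteq> t" if "t \<in> T" for t
    using D'(3)[OF that] elem_inv_neq by metis
  show ?case
  proof (cases "T = {}")
    case False
    then obtain t0 where t0: "t0 \<in> T" by blast
    \<comment> \<open>Only one of the two intervals between paired positions is non-empty; the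
      minimum below is taken over pairs read in that direction.\<close>
    have fwd: "\<exists>u\<in>{t, star t}. (u, star u) \<in> le f" if "t \<in> T" for t
      using le_total[OF f(1), of t "star t"] T(1) that D'(1,2)[OF that] by auto
    let ?c = "\<lambda>t. card (word_interval f t (star t))"
    let ?Q = "\<lambda>t. t \<in> T \<and> (t, star t) \<in> le f"
    have "\<exists>t. ?Q t" using fwd[OF t0] t0 D'(1)[OF t0] by blast
    then obtain t where t: "?Q t" and min: "\<And>u. ?Q u \<Longrightarrow> ?c t \<le> ?c u"
      using ex_has_least_nat[of ?Q _ ?c] by blast
    let ?I = "word_interval f t (star t)"
    have tI: "t \<in> idx f" "star t \<in> idx f" using t T(1) D'(1) by blast+
    have inI: "t \<in> ?I" "star t \<in> ?I"
      using t tI le_refl[OF f(1)] by (simp_all add: word_interval_def)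
    have finI: "finite ?I" using f(2) by (simp add: word_interval_def)
    have int: "?I = {t, star t}"
    proof (rule ccontr)
      assume "?I \<noteq> {t, star t}"
      then obtain x where x: "x \<in> ?I" "x \<noteq> t" "x \<noteq> star t" using inI by blast
      have xT: "x \<in> T" using D'(4) t x by blast
      have "star x \<in> ?I" using D'(5) t x(1) by blast
      moreover have "star x \<noteq> t" "star x \<noteq> star t" using D'(2)[OF xT] D'(2)[of t] t x by metis+
      moreover obtain u where u: "u \<in> {x, star x}" "(u, star u) \<in> le f" using fwd[OF xT] by blast
      ultimately have u': "u \<in> ?I" "star u \<in> ?I" "u \<noteq> t" "u \<in> T"
        using x D'(1,2)[OF xT] xT by auto
      \<comment> \<open>The inner pair lies within the interval and starts after its left end, so
        its own interval misses \<open>t\<close>.\<close>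
      have "word_interval f u (star u) \<subseteq> ?I - {t}"
        using u' le_trans_word[OF f(1)] le_antisym_word[OF f(1)] unfolding word_interval_def by blast
      then have "?c u < ?c t"
        using finI inI(1) by (meson card_mono card_Diff1_less finite_Diff le_less_trans)
      then show False using min[of u] u' u by simp
    qed
    let ?U = "{t, star t}"
    let ?g = "word_restrict f (idx f - ?U)"
    have idxg: "idx ?g = idx f - ?U" by auto
    have g: "?g \<in> words Elem" "finite (idx ?g)"
      using word_restrict_in_words[OF f(1)] f(2) by auto
    have starU: "star u \<notin> ?U" if "u \<in> T" "u \<notin> ?U" for u
      using that D'(2)[OF that(1)] D'(2)[of t] t by auto
    have "cancel_data elem_inv ?g (T - ?U) star"
      unfolding cancel_data_def
    proof (intro conjI ballI)
      show "T - ?U \<subseteq> idx ?g" unfolding idxg using T(1) by blast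
      fix u assume u: "u \<in> T - ?U"
      then have uT: "u \<in> T" by blast
      have uidx: "u \<in> idx f" "star u \<in> idx f" using T(1) uT D'(1)[OF uT] by blast+
      have Iu: "word_interval ?g u (star u) = word_interval f u (star u) - ?U"
        using u starU[of u] uidx unfolding word_interval_def word_restrict_simps by blast
      show "star u \<in> T - ?U" using u starU[of u] D'(1)[OF uT] by blast
      show "star (star u) = u" by (rule D'(2)[OF uT])
      show "lab ?g (star u) = elem_inv (lab ?g u)" using D'(3)[OF uT] by simp
      show "word_interval ?g u (star u) \<subseteq> T - ?U" unfolding Iu using D'(4)[OF uT] by blast
      show "star ` word_interval ?g u (star u) = word_interval ?g u (star u)"
      proof (rule involution_image)
        fix x assume "x \<in> word_interval ?g u (star u)"
        then have x: "x \<in> word_interval f u (star u)" "x \<notin> ?U" unfolding Iu by blast+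
        then have xT: "x \<in> T" using D'(4)[OF uT] by blast
        have "star x \<in> word_interval f u (star u)" using D'(5)[OF uT] x(1) by blast
        then show "star x \<in> word_interval ?g u (star u) \<and> star (star x) = x"
          unfolding Iu using starU[OF xT x(2)] D'(2)[OF xT] by blast
      qed
    qed
    moreover have "card (T - ?U) < card T"
      using T(2) t by (intro psubset_card_mono) auto
    ultimately have "part_prod ?g (idx ?g) = part_prod ?g (idx ?g - (T - ?U))"
      using less.hyps[of "T - ?U" ?g] g by blast
    moreover have "part_prod ?g (idx ?g) = part_prod f (idx f - ?U)"
      unfolding idxg by (rule part_prod_restrict[OF f(1)]) (use f(2) in auto)
    moreover have "idx ?g - (T - ?U) = idx f - T"
      unfolding idxg using t D'(1) by blast
    moreover have "part_prod ?g (idx f - T) = part_prod f (idx f - T)"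
    proof (rule part_prod_restrict[OF f(1)])
      show "idx f - T \<subseteq> idx f - ?U" using t D'(1)[of t] by blast
    qed (use f(2) in auto)
    moreover have "part_prod f (idx f) = part_prod f (idx f - ?U)"
      using part_prod_remove_pair[OF f tI _ int] ne[of t] D'(3)[of t] t by metis
    ultimately show ?thesis by simp
  qed simp
qed

lemma finite_restr: "f \<in> words \<Lambda> \<Longrightarrow> finite A \<Longrightarrow> finite (idx (restr A f))"
proof -
  assume f: "f \<in> words \<Lambda>" and A: "finite A"
  have "idx (restr A f) = (\<Union>l\<in>A. {s \<in> idx f. lab f s = l})" by auto
  then show ?thesis using A wordsD(7)[OF f] by simp
qed

lemma restr_words: "f \<in> words \<Lambda> \<Longrightarrow> restr A f \<in> words \<Lambda>"
  unfolding restr_def by (rule word_restrict_in_words)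

lemma part_prod_restr:
  assumes "f \<in> words Elem" "finite A"
  shows "part_prod (restr A f) (idx (restr A f)) = part_prod f (idx (restr A f))"
  unfolding restr_def[of A f]
  by (rule part_prod_restrict[OF assms(1)]) (use finite_restr[OF assms] in \<open>auto simp: restr_def\<close>)

text \<open>Over a finite set of labels closed under inversion an arbitrary cancellation becomes a
  finite one, which does not change the product of automorphisms.\<close>

lemma part_prod_word_equiv:
  assumes "word_equiv Elem elem_inv f g" "finite A" "\<And>l. l \<in> A \<Longrightarrow> elem_inv l \<in> A"
  shows "part_prod f (idx (restr A f)) = part_prod g (idx (restr A g))"
  using assms(1)
proof (induction rule: word_equiv_induct)
  case (step f g)
  have "cancels elem_inv (restr A f) (restr A g)"
    by (rule cancels_restr[OF step(3) assms(3)])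
  then obtain T star \<phi> where D: "cancel_data elem_inv (restr A f) T star"
    and iso: "is_iso \<phi> (restr A f) (idx (restr A f) - T) (restr A g)"
    unfolding cancels_iff by (elim exE conjE)
  note rf = restr_words[OF step(1), of A] finite_restr[OF step(1) assms(2)]
  let ?P = "idx (restr A f) - T"
  have b: "bij_betw \<phi> ?P (idx (restr A g))"
    using iso unfolding is_iso_def by (elim conjE)
  have o: "(\<phi> s, \<phi> t) \<in> le (restr A g)" if "s \<in> ?P" "t \<in> ?P" "(s, t) \<in> le (restr A f)" for s t
    using iso unfolding is_iso_def using that by metis
  have l: "lab (restr A g) (\<phi> s) = lab (restr A f) s" if "s \<in> ?P" for s
    using iso unfolding is_iso_def using that by metis
  have "part_prod (restr A g) (\<phi> ` (idx (restr A f) - T)) = part_prod (restr A f) (idx (restr A f) - T)"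
    by (rule part_prod_map[OF rf(1) restr_words[OF step(2)] _ _ bij_betw_imp_inj_on[OF b] o l]) (use rf in auto)
  then have "part_prod (restr A f) (idx (restr A f)) = part_prod (restr A g) (idx (restr A g))"
    using part_prod_cancel_data[OF rf D] bij_betw_imp_surj_on[OF b] by simp
  then show ?case
    by (simp only: part_prod_restr[OF step(1) assms(2)] part_prod_restr[OF step(2) assms(2)])
qed auto

section \<open>The automorphism defined by a word\<close>

text \<open>The chains forbidden by \<open>S1\<close> are the infinite descending chains of this relation.\<close>

definition dep :: "(letter \<times> letter) word \<Rightarrow> ((letter \<times> letter) \<times> nat) rel" where
  "dep f = {(t, s). s \<in> idx f \<and> t \<in> idx f \<and> s \<noteq> t \<and> (s, t) \<in> le f \<and> fst (lab1 f t) = fst (lab2 f s)}"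

lemma in_dep:
  "(t, s) \<in> dep f \<longleftrightarrow> s \<in> idx f \<and> t \<in> idx f \<and> s \<noteq> t \<and> (s, t) \<in> le f \<and> fst (lab1 f t) = fst (lab2 f s)"
  by (simp add: dep_def)

text \<open>A monotone chain whose consecutive terms differ is injective by antisymmetry, so the
  irreflexivity built into \<open>dep\<close> accounts for the injectivity in \<open>S1\<close>.
  Equality of letters up to inversion is equality of their indices.\<close>

lemma S1_iff_wf:
  assumes f: "f \<in> words Elem"
  shows "f \<in> S1 \<longleftrightarrow> wf (dep f)"
proof
  assume S1: "f \<in> S1"
  show "wf (dep f)"
    unfolding wf_iff_no_infinite_down_chain
  proof (rule notI, elim exE)
    fix \<phi> assume c: "\<forall>n. (\<phi> (Suc n), \<phi> n) \<in> dep f"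
    have step: "\<phi> n \<in> idx f" "(\<phi> n, \<phi> (Suc n)) \<in> le f" "\<phi> n \<noteq> \<phi> (Suc n)"
      "fst (lab1 f (\<phi> (Suc n))) = fst (lab2 f (\<phi> n))" for n
      using c[rule_format, of n] unfolding in_dep by blast+
    have mono: "(\<phi> m, \<phi> n) \<in> le f" if "m \<le> n" for m n
      using that
    proof (induction n rule: dec_induct)
      case base
      then show ?case by (rule le_refl[OF f step(1)])
    next
      case (step n)
      then show ?case using le_trans_word[OF f] \<open>\<And>n. (\<phi> n, \<phi> (Suc n)) \<in> le f\<close> by blast
    qed
    have "inj \<phi>"
    proof (rule linorder_injI)
      fix m n :: nat assume "m < n"
      then have "(\<phi> (Suc m), \<phi> n) \<in> le f" by (intro mono) simp
      then show "\<phi> m \<noteq> \<phi> n" using step(2,3)[of m] le_antisym_word[OF f] by metis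
    qed
    moreover have "range \<phi> \<subseteq> idx f" using step(1) by blast
    moreover have "\<forall>n. lab1 f (\<phi> (Suc n)) \<in> {lab2 f (\<phi> n), linv (lab2 f (\<phi> n))}"
      using step(4) fst_eq_letter by blast
    ultimately show False using S1 mono unfolding S1_def by blast
  qed
next
  assume wf: "wf (dep f)"
  show "f \<in> S1"
  proof (rule ccontr)
    assume "f \<notin> S1"
    then obtain \<phi> :: "nat \<Rightarrow> (letter \<times> letter) \<times> nat" where \<phi>: "range \<phi> \<subseteq> idx f" "inj \<phi>"
      "\<forall>m n. m \<le> n \<longrightarrow> (\<phi> m, \<phi> n) \<in> le f"
      "\<forall>n. lab1 f (\<phi> (Suc n)) \<in> {lab2 f (\<phi> n), linv (lab2 f (\<phi> n))}"
      using f unfolding S1_def by blast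
    have "(\<phi> (Suc n), \<phi> n) \<in> dep f" for n
    proof -
      have "\<phi> n \<in> idx f" "\<phi> (Suc n) \<in> idx f" using \<phi>(1) by blast+
      moreover have "\<phi> n \<noteq> \<phi> (Suc n)" using \<phi>(2) by (simp add: inj_eq)
      moreover have "(\<phi> n, \<phi> (Suc n)) \<in> le f" using \<phi>(3) by simp
      moreover have "fst (lab1 f (\<phi> (Suc n))) = fst (lab2 f (\<phi> n))"
        unfolding fst_eq_letter using \<phi>(4) by blast
      ultimately show ?thesis unfolding in_dep by blast
    qed
    then show False using wf unfolding wf_iff_no_infinite_down_chain by blast
  qed
qed

lemma first_in_None: "first_in f M = None \<longleftrightarrow> M = {}"
  by (simp add: first_in_def)

lemma first_in_Some:
  assumes f: "f \<in> words \<Lambda>" and M: "finite M" "M \<subseteq> idx f" and s: "first_in f M = Some s"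
  shows "s \<in> M" "\<forall>t\<in>M. (s, t) \<in> le f"
proof -
  have "M \<noteq> {}" using s first_in_None[of f M] by auto
  then obtain s' where s': "s' \<in> M" "\<forall>t\<in>M. (s', t) \<in> le f"
    using finite_word_min[OF f M(1) _ M(2)] by metis
  have "(THE s. s \<in> M \<and> (\<forall>t\<in>M. (s, t) \<in> le f)) = s'"
    using s' le_antisym_word[OF f] by (intro the_equality) blast+
  then have "s = s'" using s \<open>M \<noteq> {}\<close> by (simp add: first_in_def)
  then show "s \<in> M" "\<forall>t\<in>M. (s, t) \<in> le f" using s' by blast+
qed

subsection \<open>Letters that act trivially\<close>

text \<open>The process behind \<open>C_list\<close>, run along a finite list instead of by
  successive minima; in this form it can be compared with the product over the whole list.\<close>

fun relevant :: "(letter \<times> letter) word \<Rightarrow> letter set \<Rightarrow> ((letter \<times> letter) \<times> nat) list \<Rightarrow>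
    ((letter \<times> letter) \<times> nat) list" where
  "relevant f A [] = []"
| "relevant f A (s # l) = (if lab1 f s \<in> A then s # relevant f (A \<union> {lab2 f s, linv (lab2 f s)}) l else relevant f A l)"

lemma relevant_skip: "(\<And>s. s \<in> set l \<Longrightarrow> lab1 f s \<notin> A) \<Longrightarrow> relevant f A (l @ l') = relevant f A l'"
  by (induction l) auto

lemma set_elem_aut:
  assumes e: "e \<in> Elem" and w: "reduced w" "set w \<subseteq> A"
    and A: "\<forall>y\<in>A. linv y \<in> A" and B: "A \<subseteq> B" "\<forall>y\<in>B. linv y \<in> B" "fst e \<in> A \<longrightarrow> snd e \<in> B"
  shows "set (elem_aut e w) \<subseteq> B"
proof
  fix x assume x: "x \<in> set (elem_aut e w)"
  have h: "elem_aut e \<in> hom F_omega F_omega" by (rule Aut_hom[OF elem_aut_in_Aut[OF e]])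
  have "x \<in> set (reduce (concat (map (\<lambda>y. elem_aut e [y]) w)))"
    using x hom_F_subst_word[OF h w(1)] by (simp add: subst_word_def)
  then have "x \<in> set (concat (map (\<lambda>y. elem_aut e [y]) w))"
    using set_reduce by blast
  then obtain y where y: "y \<in> set w" "x \<in> set (elem_aut e [y])" by auto
  have yA: "y \<in> A" using y(1) w(2) by blast
  have i: "independent (fst e) (snd e)" using e by (auto simp: Elem_def)
  have "elem_aut e [y] = (if y = fst e then [fst e, snd e]
      else if y = linv (fst e) then [linv (snd e), linv (fst e)] else [y])"
    using elem_aut_letter[OF i, of y] by simp
  then consider "x = y" | "fst e \<in> A" "x \<in> {fst e, snd e, linv (fst e), linv (snd e)}"
    using y(2) yA A by (auto split: if_splits)
  then show "x \<in> B"
    using yA B A by cases blast+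
qed

lemma elem_aut_skip:
  assumes e: "e \<in> Elem" and w: "reduced w" "set w \<subseteq> A" and A: "\<forall>y\<in>A. linv y \<in> A" "fst e \<notin> A"
  shows "elem_aut e w = w"
proof -
  have h: "elem_aut e \<in> hom F_omega F_omega" by (rule Aut_hom[OF elem_aut_in_Aut[OF e]])
  have "elem_aut e [y] = [y]" if "y \<in> set w" for y
  proof (rule elem_aut_fix[OF e])
    have "y \<in> A" using that w(2) by blast
    then have "linv y \<in> A" using A(1) by blast
    then have "fst e \<noteq> y" "fst e \<noteq> linv y" using \<open>y \<in> A\<close> A(2) by metis+
    then show "fst y \<noteq> fst (fst e)" by (metis fst_eq_letter)
  qed
  then have "subst_word (\<lambda>y. elem_aut e [y]) w = subst_word (\<lambda>y. [y]) w" by (rule subst_word_cong)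
  then show ?thesis using hom_F_subst_word[OF h w(1)] w(1) by (simp add: subst_word_single)
qed

text \<open>\<open>A\<close> contains every letter of the current word. A position whose first
  letter is outside \<open>A\<close> acts trivially on that word, and any other position adds at
  most its second letter and the inverse of it.\<close>

lemma elem_prod_relevant:
  assumes "\<forall>s\<in>set l. lab f s \<in> Elem" "\<forall>y\<in>A. linv y \<in> A" "reduced w" "set w \<subseteq> A"
  shows "elem_prod (map (lab f) (relevant f A l)) w = elem_prod (map (lab f) l) w"
  using assms
proof (induction l arbitrary: A w)
  case (Cons s l)
  have e: "lab f s \<in> Elem" and l: "\<forall>s\<in>set l. lab f s \<in> Elem" using Cons.prems by simp_all
  have lE: "set (map (lab f) l) \<subseteq> Elem" using l by auto
  have h: "elem_aut (lab f s) \<in> hom F_omega F_omega" by (rule Aut_hom[OF elem_aut_in_Aut[OF e]])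
  have r: "reduced (elem_aut (lab f s) w)" by (rule hom_F_reduced[OF h Cons.prems(3)])
  have whole: "elem_prod (map (lab f) (s # l)) w = elem_prod (map (lab f) l) (elem_aut (lab f s) w)"
    using mult_Aut_apply[OF elem_aut_in_Aut[OF e] elem_prod_in_Aut[OF lE] Cons.prems(3)] by simp
  show ?case
  proof (cases "lab1 f s \<in> A")
    case True
    let ?A = "A \<union> {lab2 f s, linv (lab2 f s)}"
    have A': "\<forall>y\<in>?A. linv y \<in> ?A" using Cons.prems(2) by auto
    have "set (relevant f A l) \<subseteq> set l" for A
      by (induction l arbitrary: A) auto
    then have sE: "set (map (lab f) (relevant f ?A l)) \<subseteq> Elem" using lE by fastforce
    have "set (elem_aut (lab f s) w) \<subseteq> ?A"
      by (rule set_elem_aut[OF e Cons.prems(3,4,2) _ A']) auto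
    then have "elem_prod (map (lab f) (relevant f ?A l)) (elem_aut (lab f s) w) = elem_prod (map (lab f) l) (elem_aut (lab f s) w)"
      by (rule Cons.IH[OF l A' r])
    moreover have "elem_prod (map (lab f) (relevant f A (s # l))) w = elem_prod (map (lab f) (relevant f ?A l)) (elem_aut (lab f s) w)"
      using mult_Aut_apply[OF elem_aut_in_Aut[OF e] elem_prod_in_Aut[OF sE] Cons.prems(3)] True by simp
    ultimately show ?thesis using whole by simp
  next
    case False
    then show ?thesis
      using whole elem_aut_skip[OF e Cons.prems(3,4,2) False] Cons.IH[OF l Cons.prems(2,3,4)] by simp
  qed
qed simp

subsection \<open>The process defining \<open>C_list\<close>\<close>

locale good_word =
  fixes f :: "(letter \<times> letter) word"
  assumes f: "f \<in> words Elem"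
    and finite_lab1: "\<And>x. finite {s \<in> idx f. lab1 f s = x}"
    and wf_dep: "wf (dep f)"
begin

lemma finite_lab1_in: "finite A \<Longrightarrow> finite {s \<in> idx f. lab1 f s \<in> A}"
proof -
  assume "finite A"
  moreover have "{s \<in> idx f. lab1 f s \<in> A} = (\<Union>x\<in>A. {s \<in> idx f. lab1 f s = x})" by auto
  ultimately show ?thesis using finite_lab1 by simp
qed

text \<open>Koenig's lemma in the form of well-founded induction: the relation branches finitely,
  since a dependent position starts with one of two given letters.\<close>

lemma finite_descendants: "finite {t. (t, s) \<in> (dep f)\<^sup>*}"
proof (induction s rule: wf_induct_rule[OF wf_dep])
  case (1 s)
  have "{t. (t, s) \<in> (dep f)\<^sup>*} \<subseteq> {s} \<union> (\<Union>u\<in>{u. (u, s) \<in> dep f}. {t. (t, u) \<in> (dep f)\<^sup>*})"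
  proof
    fix t assume "t \<in> {t. (t, s) \<in> (dep f)\<^sup>*}"
    then have "(t, s) \<in> (dep f)\<^sup>*" by simp
    then show "t \<in> {s} \<union> (\<Union>u\<in>{u. (u, s) \<in> dep f}. {t. (t, u) \<in> (dep f)\<^sup>*})"
      by (cases rule: rtranclE) auto
  qed
  moreover have "finite {u. (u, s) \<in> dep f}"
  proof (rule finite_subset[OF _ finite_lab1_in])
    show "{u. (u, s) \<in> dep f} \<subseteq> {u \<in> idx f. lab1 f u \<in> {lab2 f s, linv (lab2 f s)}}"
      using fst_eq_letter unfolding in_dep by blast
  qed simp
  moreover have "finite {t. (t, u) \<in> (dep f)\<^sup>*}" if "u \<in> {u. (u, s) \<in> dep f}" for u
    using 1 that by blast
  ultimately show ?case
    by (meson finite_UN_I finite_Un finite.emptyI finite.insertI finite_subset)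
qed

text \<open>All positions that the process started at \<open>x\<close> could ever pick. Its
  finiteness bounds the number of steps.\<close>

definition reach :: "letter \<Rightarrow> ((letter \<times> letter) \<times> nat) set" where
  "reach x = (\<Union>r\<in>{r \<in> idx f. lab1 f r \<in> {x, linv x}}. {t. (t, r) \<in> (dep f)\<^sup>*})"

lemma finite_reach: "finite (reach x)"
  unfolding reach_def using finite_lab1_in[of "{x, linv x}"] finite_descendants by auto

lemma reach_root: "s \<in> idx f \<Longrightarrow> lab1 f s \<in> {x, linv x} \<Longrightarrow> s \<in> reach x"
  unfolding reach_def by blast

lemma reach_step: "s \<in> reach x \<Longrightarrow> (t, s) \<in> dep f \<Longrightarrow> t \<in> reach x"
  unfolding reach_def using converse_rtrancl_into_rtrancl[of t s "dep f"] by blast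

abbreviation pick :: "letter \<Rightarrow> nat \<Rightarrow> (letter \<times> letter) \<times> nat" where
  "pick x k \<equiv> the (snd (stage f x k))"

text \<open>Invariant of the process. \<open>I\<close> holds the positions still ahead,
  \<open>A\<close> the letters collected. Every letter of \<open>A\<close> is traced back to
  \<open>x\<close> or to an earlier position in \<open>reach x\<close>; the cardinalities force the
  process to stop; the last clause compares the picks with \<open>relevant\<close> on every finite
  set that contains them.\<close>

definition stage_ok :: "letter \<Rightarrow> nat \<Rightarrow> letter set \<Rightarrow> ((letter \<times> letter) \<times> nat) set \<Rightarrow> bool" where
  "stage_ok x k A I \<longleftrightarrow>
    stage f x k = (A, first_in f {t \<in> I. lab1 f t \<in> A}) \<and> I \<subseteq> idx f \<and> finite A \<and> (\<forall>y\<in>A. linv y \<in> A) \<and>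
    (\<forall>t\<in>I. \<forall>u\<in>idx f. (t, u) \<in> le f \<longrightarrow> u \<in> I) \<and>
    (\<forall>y\<in>A. y \<in> {x, linv x} \<or> (\<exists>s\<in>reach x. s \<in> idx f \<and> fst y = fst (lab2 f s) \<and> (\<forall>t\<in>I. (s, t) \<in> le f \<and> s \<noteq> t))) \<and>
    card (reach x \<inter> I) + k \<le> card (reach x) \<and> (\<forall>j<k. pick x j \<in> idx f) \<and>
    (\<forall>P. finite P \<longrightarrow> P \<subseteq> idx f \<longrightarrow> (\<forall>j<k. pick x j \<in> P) \<longrightarrow>
      relevant f {x, linv x} (sorted_positions f P) = map (pick x) [0..<k] @ relevant f A (sorted_positions f (P \<inter> I)))"

lemma stage_okD:
  assumes "stage_ok x k A I"
  shows "stage f x k = (A, first_in f {t \<in> I. lab1 f t \<in> A})" "I \<subseteq> idx f" "finite A" "\<forall>y\<in>A. linv y \<in> A"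
    "\<forall>t\<in>I. \<forall>u\<in>idx f. (t, u) \<in> le f \<longrightarrow> u \<in> I"
    "\<forall>y\<in>A. y \<in> {x, linv x} \<or> (\<exists>s\<in>reach x. s \<in> idx f \<and> fst y = fst (lab2 f s) \<and> (\<forall>t\<in>I. (s, t) \<in> le f \<and> s \<noteq> t))"
    "card (reach x \<inter> I) + k \<le> card (reach x)" "\<forall>j<k. pick x j \<in> idx f"
    "\<And>P. finite P \<Longrightarrow> P \<subseteq> idx f \<Longrightarrow> \<forall>j<k. pick x j \<in> P \<Longrightarrow>
      relevant f {x, linv x} (sorted_positions f P) = map (pick x) [0..<k] @ relevant f A (sorted_positions f (P \<inter> I))"
proof -
  note d1 = assms[unfolded stage_ok_def]
  note d2 = conjunct2[OF d1] note d3 = conjunct2[OF d2] note d4 = conjunct2[OF d3]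
  note d5 = conjunct2[OF d4] note d6 = conjunct2[OF d5] note d7 = conjunct2[OF d6]
  note d8 = conjunct2[OF d7]
  show "stage f x k = (A, first_in f {t \<in> I. lab1 f t \<in> A})" by (rule conjunct1[OF d1])
  show "I \<subseteq> idx f" by (rule conjunct1[OF d2])
  show "finite A" by (rule conjunct1[OF d3])
  show "\<forall>y\<in>A. linv y \<in> A" by (rule conjunct1[OF d4])
  show "\<forall>t\<in>I. \<forall>u\<in>idx f. (t, u) \<in> le f \<longrightarrow> u \<in> I" by (rule conjunct1[OF d5])
  show "\<forall>y\<in>A. y \<in> {x, linv x} \<or> (\<exists>s\<in>reach x. s \<in> idx f \<and> fst y = fst (lab2 f s) \<and> (\<forall>t\<in>I. (s, t) \<in> le f \<and> s \<noteq> t))"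
    by (rule conjunct1[OF d6])
  show "card (reach x \<inter> I) + k \<le> card (reach x)" by (rule conjunct1[OF d7])
  show "\<forall>j<k. pick x j \<in> idx f" by (rule conjunct1[OF d8])
  show "relevant f {x, linv x} (sorted_positions f P) = map (pick x) [0..<k] @ relevant f A (sorted_positions f (P \<inter> I))"
    if "finite P" "P \<subseteq> idx f" "\<forall>j<k. pick x j \<in> P" for P
    using conjunct2[OF d8] that by blast
qed

lemma stage_ok_0: "stage_ok x 0 {x, linv x} (idx f)"
proof -
  have "P \<inter> idx f = P" if "P \<subseteq> idx f" for P using that by blast
  moreover have "card (reach x \<inter> idx f) \<le> card (reach x)"
    by (rule card_mono[OF finite_reach]) blast
  ultimately show ?thesis unfolding stage_ok_def by simp
qed

lemma stage_ok_Suc: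
  assumes ok: "stage_ok x k A I" and some: "snd (stage f x k) \<noteq> None"
  shows "\<exists>A' I'. stage_ok x (Suc k) A' I'"
proof -
  note ok = stage_okD[OF ok]
  obtain s where s: "first_in f {t \<in> I. lab1 f t \<in> A} = Some s" using some ok(1) by auto
  have fin: "finite {t \<in> I. lab1 f t \<in> A}" "{t \<in> I. lab1 f t \<in> A} \<subseteq> idx f"
    using finite_subset[OF _ finite_lab1_in[OF ok(3)], of "{t \<in> I. lab1 f t \<in> A}"] ok(2) by blast+
  have sI: "s \<in> I" "lab1 f s \<in> A" and smin: "\<And>t. t \<in> I \<Longrightarrow> lab1 f t \<in> A \<Longrightarrow> (s, t) \<in> le f"
    using first_in_Some[OF f fin s] by blast+
  have sidx: "s \<in> idx f" using sI ok(2) by blast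
  have pick: "pick x k = s" using ok(1) s by simp
  let ?A = "A \<union> {lab2 f s, linv (lab2 f s)}" and ?I = "{t \<in> idx f. (s, t) \<in> le f \<and> t \<noteq> s}"
  have II: "?I \<subseteq> I" using ok(5) sI(1) by blast
  \<comment> \<open>The pick is due to \<open>x\<close> itself or to an earlier position of
    \<open>reach x\<close> whose second letter put the first letter of \<open>s\<close> into
    \<open>A\<close>.\<close>
  have sreach: "s \<in> reach x"
  proof (cases "lab1 f s \<in> {x, linv x}")
    case True
    then show ?thesis by (rule reach_root[OF sidx])
  next
    case False
    then obtain u where u: "u \<in> reach x" "u \<in> idx f" "fst (lab1 f s) = fst (lab2 f u)" "\<forall>t\<in>I. (u, t) \<in> le f \<and> u \<noteq> t"
      using ok(6) sI(2) by blast
    then have "(s, u) \<in> dep f" using sI(1) sidx unfolding in_dep by blast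
    then show ?thesis by (rule reach_step[OF u(1)])
  qed
  have 1: "stage f x (Suc k) = (?A, first_in f {t \<in> ?I. lab1 f t \<in> ?A})"
    using ok(1) s by (simp add: conj_assoc)
  have 5: "\<forall>t\<in>?I. \<forall>u\<in>idx f. (t, u) \<in> le f \<longrightarrow> u \<in> ?I"
    using le_trans_word[OF f] le_antisym_word[OF f] by blast
  have 6: "\<forall>y\<in>?A. y \<in> {x, linv x} \<or> (\<exists>s\<in>reach x. s \<in> idx f \<and> fst y = fst (lab2 f s) \<and> (\<forall>t\<in>?I. (s, t) \<in> le f \<and> s \<noteq> t))"
  proof
    fix y assume "y \<in> ?A"
    then consider "y \<in> A" | "fst y = fst (lab2 f s)" by auto
    then show "y \<in> {x, linv x} \<or> (\<exists>s\<in>reach x. s \<in> idx f \<and> fst y = fst (lab2 f s) \<and> (\<forall>t\<in>?I. (s, t) \<in> le f \<and> s \<noteq> t))"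
    proof cases
      case 1
      then show ?thesis using ok(6) II by blast
    next
      case 2
      then show ?thesis using sreach sidx by blast
    qed
  qed
  have 7: "card (reach x \<inter> ?I) + Suc k \<le> card (reach x)"
  proof -
    have "card (reach x \<inter> ?I) < card (reach x \<inter> I)"
      using II sI(1) sreach finite_reach[of x] by (intro psubset_card_mono) auto
    then show ?thesis using ok(7) by simp
  qed
  have 8: "\<forall>j<Suc k. pick x j \<in> idx f"
    using ok(8) pick sidx by (simp add: less_Suc_eq)
  have 9: "relevant f {x, linv x} (sorted_positions f P) = map (pick x) [0..<Suc k] @ relevant f ?A (sorted_positions f (P \<inter> ?I))"
    if P: "finite P" "P \<subseteq> idx f" "\<forall>j<Suc k. pick x j \<in> P" for P
  proof -
    have sP: "s \<in> P" using P(3) pick by blast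
    \<comment> \<open>Positions ahead that precede the pick: by the minimality of \<open>s\<close>
      none of them begins with a letter of \<open>A\<close>, so \<open>relevant\<close> passes over
      them.\<close>
    let ?L = "{t \<in> P \<inter> I. (t, s) \<in> le f \<and> t \<noteq> s}"
    have tot: "(t, s) \<in> le f \<or> (s, t) \<in> le f" if "t \<in> P" for t
      using le_total[OF f _ sidx] that P(2) by blast
    have PI: "P \<inter> I = ?L \<union> ({s} \<union> (P \<inter> ?I))"
      using tot sP sI(1) II P(2) by blast
    have 1: "sorted_positions f ({s} \<union> (P \<inter> ?I)) = [s] @ sorted_positions f (P \<inter> ?I)"
    proof -
      have "sorted_positions f ({s} \<union> (P \<inter> ?I)) = sorted_positions f {s} @ sorted_positions f (P \<inter> ?I)"
        by (rule sorted_positions_union[OF f]) (use P sidx in auto)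
      then show ?thesis by (simp add: sorted_positions_single[OF f])
    qed
    have 2: "sorted_positions f (?L \<union> ({s} \<union> (P \<inter> ?I))) = sorted_positions f ?L @ sorted_positions f ({s} \<union> (P \<inter> ?I))"
    proof (rule sorted_positions_union[OF f])
      fix t u assume "t \<in> ?L" "u \<in> {s} \<union> (P \<inter> ?I)"
      then show "(t, u) \<in> le f \<and> t \<noteq> u"
        using le_trans_word[OF f, of t s u] le_antisym_word[OF f, of t s] by blast
    qed (use P sidx in auto)
    have L: "lab1 f t \<notin> A" if "t \<in> set (sorted_positions f ?L)" for t
    proof -
      have "set (sorted_positions f ?L) = ?L" by (rule set_sorted_positions[OF f]) (use P in auto)
      then have t: "t \<in> I" "(t, s) \<in> le f" "t \<noteq> s" using that by blast+
      then show ?thesis using smin[of t] le_antisym_word[OF f] by blast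
    qed
    have "sorted_positions f (P \<inter> I) = sorted_positions f ?L @ s # sorted_positions f (P \<inter> ?I)"
      by (rule trans[OF arg_cong[OF PI]]) (simp only: 2 1 append_Cons append_Nil)
    then have "relevant f A (sorted_positions f (P \<inter> I)) = relevant f A (sorted_positions f ?L @ s # sorted_positions f (P \<inter> ?I))"
      by (simp only:)
    also have "\<dots> = relevant f A (s # sorted_positions f (P \<inter> ?I))" by (rule relevant_skip[OF L])
    also have "\<dots> = s # relevant f ?A (sorted_positions f (P \<inter> ?I))" using sI(2) by simp
    finally show ?thesis using ok(9)[OF P(1,2)] P(3) pick by simp
  qed
  have "stage_ok x (Suc k) ?A ?I"
    unfolding stage_ok_def
  proof (intro conjI 1 5 6 7 8 allI impI)
    show "\<forall>y\<in>?A. linv y \<in> ?A" using ok(4) by auto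
  qed (use ok(3) 9 in auto)
  then show ?thesis by blast
qed

lemma stage_invariant:
  "(\<And>j. j < k \<Longrightarrow> snd (stage f x j) \<noteq> None) \<Longrightarrow> \<exists>A I. stage_ok x k A I"
proof (induction k)
  case 0
  then show ?case using stage_ok_0 by blast
next
  case (Suc k)
  then obtain A I where "stage_ok x k A I" by auto
  then show ?case using Suc.prems[of k] by (intro stage_ok_Suc) auto
qed

lemma stage_stops: "\<exists>k. snd (stage f x k) = None"
proof (rule ccontr)
  assume "\<nexists>k. snd (stage f x k) = None"
  then have "snd (stage f x j) \<noteq> None" for j by metis
  then obtain A I where "stage_ok x (Suc (card (reach x))) A I"
    using stage_invariant[of "Suc (card (reach x))" x] by metis
  then show False using stage_okD(7)[of x "Suc (card (reach x))" A I] by simp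
qed

text \<open>The relevant positions of a finite set could depend on that set, whereas the picks
  depend on \<open>f\<close> alone. They agree as soon as the set contains all picks, because after
  the last one no relevant position is left in all of \<open>f\<close>.\<close>

lemma C_list_props:
  shows "set (C_list f x) \<subseteq> idx f"
    and "finite P \<Longrightarrow> P \<subseteq> idx f \<Longrightarrow> set (C_list f x) \<subseteq> P \<Longrightarrow> relevant f {x, linv x} (sorted_positions f P) = C_list f x"
proof -
  define K where "K = (LEAST k. snd (stage f x k) = None)"
  have K: "snd (stage f x K) = None" unfolding K_def by (rule LeastI_ex[OF stage_stops])
  have "snd (stage f x j) \<noteq> None" if "j < K" for j
    using not_less_Least that unfolding K_def by blast
  then obtain A I where ok: "stage_ok x K A I" using stage_invariant[of K x] by blast
  note okD = stage_okD[OF ok]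
  have C: "C_list f x = map (pick x) [0..<K]" by (simp add: C_list_def K_def)
  show "set (C_list f x) \<subseteq> idx f" unfolding C using okD(8) by auto
  assume P: "finite P" "P \<subseteq> idx f" "set (C_list f x) \<subseteq> P"
  have "\<forall>j<K. pick x j \<in> P" using P(3) unfolding C by auto
  note s = okD(9)[OF P(1,2) this]
  have "{t \<in> I. lab1 f t \<in> A} = {}" using K okD(1) first_in_None[of f] by simp
  moreover have "set (sorted_positions f (P \<inter> I)) = P \<inter> I" by (rule set_sorted_positions[OF f]) (use P in auto)
  ultimately have "relevant f A (sorted_positions f (P \<inter> I) @ []) = relevant f A []" by (intro relevant_skip) blast
  then show "relevant f {x, linv x} (sorted_positions f P) = C_list f x" using s C by simp
qed

lemma alpha_letter_part_prod:
  assumes "finite P" "P \<subseteq> idx f" "set (C_list f x) \<subseteq> P"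
  shows "fold (\<lambda>s. elem_aut (lab f s)) (C_list f x) [x] = part_prod f P [x]"
proof -
  have lab: "\<forall>s\<in>idx f. lab f s \<in> Elem" using wordsD(6)[OF f] by blast
  have C: "set (map (lab f) (C_list f x)) \<subseteq> Elem"
  proof -
    have "lab f s \<in> Elem" if "s \<in> set (C_list f x)" for s
      using C_list_props(1)[of x] lab that by blast
    then show ?thesis by (simp add: image_subset_iff)
  qed
  have "fold (\<lambda>s. elem_aut (lab f s)) (C_list f x) [x] = fold elem_aut (map (lab f) (C_list f x)) [x]"
    by (simp add: fold_map comp_def)
  also have "\<dots> = elem_prod (map (lab f) (relevant f {x, linv x} (sorted_positions f P))) [x]"
    using fold_elem_aut[OF C, of "[x]"] C_list_props(2)[OF assms] by simp
  also have "\<dots> = elem_prod (map (lab f) (sorted_positions f P)) [x]"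
    using set_sorted_positions[OF f assms(1,2)] assms(2) lab by (intro elem_prod_relevant) auto
  finally show ?thesis by (simp add: part_prod_def)
qed

text \<open>One finite subword computes the values at \<open>x\<close> and at its inverse, and the
  automorphism it defines respects inverses.\<close>

lemma inv_compat_alpha: "inv_compat (\<lambda>x. fold (\<lambda>s. elem_aut (lab f s)) (C_list f x) [x])"
  unfolding inv_compat_def
proof
  fix x
  let ?P = "set (C_list f x) \<union> set (C_list f (linv x))"
  have P: "finite ?P" "?P \<subseteq> idx f" using C_list_props(1) by auto
  have h: "part_prod f ?P \<in> hom F_omega F_omega" by (rule Aut_hom[OF part_prod_in_Aut[OF f P]])
  have "fold (\<lambda>s. elem_aut (lab f s)) (C_list f x) [x] = part_prod f ?P [x]"
    "fold (\<lambda>s. elem_aut (lab f s)) (C_list f (linv x)) [linv x] = part_prod f ?P [linv x]"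
    by (rule alpha_letter_part_prod[OF P]; simp)+
  then show "reduce (fold (\<lambda>s. elem_aut (lab f s)) (C_list f x) [x] @
      fold (\<lambda>s. elem_aut (lab f s)) (C_list f (linv x)) [linv x]) = []"
    by (simp add: hom_F_linv[OF h])
qed

lemma alpha_hom: "alpha f \<in> hom F_omega F_omega"
  unfolding alpha_def by (rule extend_in_hom[OF inv_compat_alpha])

definition support :: "letter list \<Rightarrow> ((letter \<times> letter) \<times> nat) set" where
  "support w = (\<Union>x\<in>set w. set (C_list f x))"

lemma support: "finite (support w)" "support w \<subseteq> idx f"
  unfolding support_def using C_list_props(1) by auto

text \<open>\<open>P\<close> may be enlarged at will, so several words or several arguments can
  share one finite approximation.\<close>

lemma alpha_part_prod:
  assumes w: "reduced w" and P: "finite P" "P \<subseteq> idx f" "support w \<subseteq> P"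
  shows "alpha f w = part_prod f P w"
proof -
  have h: "part_prod f P \<in> hom F_omega F_omega" by (rule Aut_hom[OF part_prod_in_Aut[OF f P(1,2)]])
  have "alpha f w = subst_word (\<lambda>x. fold (\<lambda>s. elem_aut (lab f s)) (C_list f x) [x]) w"
    unfolding alpha_def by (rule extend_eq[OF w])
  also have "\<dots> = subst_word (\<lambda>x. part_prod f P [x]) w"
  proof (rule subst_word_cong)
    fix x assume "x \<in> set w"
    then have "set (C_list f x) \<subseteq> P" using P(3) unfolding support_def by blast
    then show "fold (\<lambda>s. elem_aut (lab f s)) (C_list f x) [x] = part_prod f P [x]"
      by (rule alpha_letter_part_prod[OF P(1,2)])
  qed
  also have "\<dots> = part_prod f P w" by (rule hom_F_subst_word[OF h w, symmetric])
  finally show ?thesis .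
qed

end

section \<open>The admissible set and the epimorphism\<close>

abbreviation bar :: "(letter \<times> letter) word \<Rightarrow> (letter \<times> letter) word" where
  "bar \<equiv> bar_word elem_inv"

lemma bar_bar [simp]: "bar (bar f) = f"
  by (simp add: bar_word_def)

lemma S_Elem_iff: "f \<in> S_Elem \<longleftrightarrow> good_word f \<and> good_word (bar f)"
proof (cases "f \<in> words Elem")
  case True
  then show ?thesis
    using S1_iff_wf[OF True] S1_iff_wf[OF bar_Elem[OF True]] bar_Elem[OF True]
    by (auto simp: S_Elem_def S0_def good_word_def)
next
  case False
  then show ?thesis by (simp add: S_Elem_def good_word_def)
qed

lemma S_Elem_words: "f \<in> S_Elem \<Longrightarrow> f \<in> words Elem"
  by (simp add: S_Elem_def)

lemma bar_S_Elem: "f \<in> S_Elem \<Longrightarrow> bar f \<in> S_Elem"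
  by (simp add: S_Elem_iff)

lemma is_iso_bar: "is_iso \<phi> f P g \<Longrightarrow> is_iso \<phi> (bar_word i f) P (bar_word i g)"
  unfolding is_iso_def bar_word_simps by metis

text \<open>Whether two positions are dependent involves no third one. Hence deleting positions can
  only make the dependence relation smaller.\<close>

lemma good_word_iso:
  assumes f: "good_word f" and iso: "is_iso \<phi> f P g" and P: "P \<subseteq> idx f" and g: "g \<in> words Elem"
  shows "good_word g"
proof -
  interpret good_word f by (rule f)
  have b: "bij_betw \<phi> P (idx g)" using iso unfolding is_iso_def by (elim conjE)
  have o: "(s, t) \<in> le f" if "s \<in> P" "t \<in> P" "(\<phi> s, \<phi> t) \<in> le g" for s t
    using iso unfolding is_iso_def using that by metis
  have l: "lab g (\<phi> s) = lab f s" if "s \<in> P" for s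
    using iso unfolding is_iso_def using that by metis
  define \<psi> where "\<psi> = inv_into P \<phi>"
  have \<psi>: "\<psi> t \<in> P" "\<phi> (\<psi> t) = t" if "t \<in> idx g" for t
    using that b unfolding \<psi>_def bij_betw_def by (auto simp: inv_into_into f_inv_into_f)
  have lg: "lab g t = lab f (\<psi> t)" if "t \<in> idx g" for t
    using l[OF \<psi>(1)[OF that]] \<psi>(2)[OF that] by simp
  show ?thesis
  proof
    show "g \<in> words Elem" by (rule g)
    show "finite {s \<in> idx g. lab1 g s = x}" for x
    proof (rule finite_subset)
      show "{s \<in> idx g. lab1 g s = x} \<subseteq> \<phi> ` {s \<in> idx f. lab1 f s = x}"
      proof
        fix t assume "t \<in> {s \<in> idx g. lab1 g s = x}"
        then have t: "t \<in> idx g" "lab1 g t = x" by simp_all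
        then have mem: "\<psi> t \<in> {s \<in> idx f. lab1 f s = x}" using \<psi>(1)[OF t(1)] P lg[OF t(1)] by auto
        show "t \<in> \<phi> ` {s \<in> idx f. lab1 f s = x}"
          by (rule image_eqI[where x = "\<psi> t"]) (rule \<psi>(2)[OF t(1), symmetric], rule mem)
      qed
      show "finite (\<phi> ` {s \<in> idx f. lab1 f s = x})" using finite_lab1 by blast
    qed
    have "dep g \<subseteq> inv_image (dep f) \<psi>"
    proof (rule subrelI)
      fix t s assume "(t, s) \<in> dep g"
      then have ts: "s \<in> idx g" "t \<in> idx g" "s \<noteq> t" "(s, t) \<in> le g" "fst (lab1 g t) = fst (lab2 g s)"
        unfolding in_dep by blast+
      have "(\<psi> s, \<psi> t) \<in> le f"
        using o[OF \<psi>(1)[OF ts(1)] \<psi>(1)[OF ts(2)]] \<psi>(2)[OF ts(1)] \<psi>(2)[OF ts(2)] ts(4) by simp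
      moreover have "\<psi> s \<noteq> \<psi> t" using \<psi>(2)[OF ts(1)] \<psi>(2)[OF ts(2)] ts(3) by metis
      ultimately show "(t, s) \<in> inv_image (dep f) \<psi>"
        using \<psi>(1)[OF ts(1)] \<psi>(1)[OF ts(2)] P ts(5) lg[OF ts(1)] lg[OF ts(2)]
        unfolding in_inv_image in_dep by (metis subsetD)
    qed
    then show "wf (dep g)" using wf_inv_image[OF wf_dep] wf_subset by blast
  qed
qed

text \<open>Predecessors of the \<open>d1\<close> part stay in it, so the induction treats that part
  first. Dependence points to later positions: for a concatenation the second factor takes the role
  of \<open>d1\<close>, for the reversed concatenation the first one does.\<close>

lemma wf_parts:
  assumes "wf r1" "wf r2" "\<And>x. (\<exists>s. x = d1 s) \<or> (\<exists>s. x = d2 s)"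
    and "\<And>t s. (d1 t, d1 s) \<in> r \<Longrightarrow> (t, s) \<in> r1" "\<And>t s. (d2 t, d2 s) \<in> r \<Longrightarrow> (t, s) \<in> r2"
    and "\<And>t s. (d2 t, d1 s) \<notin> r"
  shows "wf r"
proof (rule wfUNIVI)
  fix P x assume step: "\<forall>x. (\<forall>y. (y, x) \<in> r \<longrightarrow> P y) \<longrightarrow> P x"
  have 1: "P (d1 s)" for s
  proof (induction s rule: wf_induct_rule[OF assms(1)])
    case (1 s)
    have "P y" if "(y, d1 s) \<in> r" for y
      using assms(3)[of y] assms(4,6) that 1 by metis
    then show ?case using step by blast
  qed
  have 2: "P (d2 s)" for s
  proof (induction s rule: wf_induct_rule[OF assms(2)])
    case (1 s)
    have "P y" if "(y, d2 s) \<in> r" for y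
      using assms(3)[of y] assms(5) that 1 \<open>\<And>s. P (d1 s)\<close> by metis
    then show ?case using step by blast
  qed
  show "P x" using assms(3)[of x] 1 2 by metis
qed

lemma finite_lab1_concat:
  assumes "\<And>x. finite {s \<in> idx f. lab1 f s = x}" "\<And>x. finite {s \<in> idx g. lab1 g s = x}"
  shows "finite {s \<in> idx (concat_word f g). lab1 (concat_word f g) s = x}"
proof (rule finite_subset)
  show "{s \<in> idx (concat_word f g). lab1 (concat_word f g) s = x} \<subseteq>
    inL ` {s \<in> idx f. lab1 f s = x} \<union> inR ` {s \<in> idx g. lab1 g s = x}"
  proof
    fix s assume "s \<in> {s \<in> idx (concat_word f g). lab1 (concat_word f g) s = x}"
    then show "s \<in> inL ` {s \<in> idx f. lab1 f s = x} \<union> inR ` {s \<in> idx g. lab1 g s = x}"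
      by (cases s rule: parts_cases) simp_all
  qed
  show "finite (inL ` {s \<in> idx f. lab1 f s = x} \<union> inR ` {s \<in> idx g. lab1 g s = x})"
    using assms by blast
qed

lemma parts_ex: "(\<exists>s. x = inL s) \<or> (\<exists>s. x = inR s)"
  by (cases x rule: parts_cases) blast+

lemma concat_S_Elem:
  assumes "f \<in> S_Elem" "g \<in> S_Elem"
  shows "concat_word f g \<in> S_Elem"
proof -
  have f: "good_word f" "good_word (bar f)" and g: "good_word g" "good_word (bar g)"
    using assms by (simp_all add: S_Elem_iff)
  have h: "concat_word f g \<in> words Elem"
    by (rule concat_in_words[OF S_Elem_words[OF assms(1)] S_Elem_words[OF assms(2)]])
  have fin: "finite {s \<in> idx (concat_word f g). lab1 (concat_word f g) s = x}" for x
    by (rule finite_lab1_concat[OF good_word.finite_lab1[OF f(1)] good_word.finite_lab1[OF g(1)]])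
  have "wf (dep (concat_word f g))"
    by (rule wf_parts[where ?d1.0 = inR and ?d2.0 = inL,
          OF good_word.wf_dep[OF g(1)] good_word.wf_dep[OF f(1)]])
      (use parts_ex in \<open>simp_all add: in_dep disj_commute\<close>)
  then have "good_word (concat_word f g)" using h fin by (simp add: good_word_def)
  moreover have "wf (dep (bar (concat_word f g)))"
    by (rule wf_parts[where ?d1.0 = inL and ?d2.0 = inR,
          OF good_word.wf_dep[OF f(2)] good_word.wf_dep[OF g(2)]])
      (use parts_ex in \<open>simp_all add: in_dep\<close>)
  then have "good_word (bar (concat_word f g))" using bar_Elem[OF h] fin by (simp add: good_word_def)
  ultimately show ?thesis by (simp add: S_Elem_iff)
qed

text \<open>With respect to a grading of the letters for which a word is block triangular, chains of dependent
  positions descend in the grading and move forward inside the finitely many positions of a block.\<close>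

lemma block_triangular_in_S_Elem:
  fixes b :: "nat \<Rightarrow> nat"
  assumes f: "f \<in> words Elem" and tri: "\<forall>s\<in>idx f. b (fst (lab2 f s)) \<le> b (fst (lab1 f s))"
    and fin: "\<And>k. finite {s \<in> idx f. b (fst (lab1 f s)) = k}"
  shows "f \<in> S_Elem"
proof -
  have "good_word g" if g: "g \<in> words Elem" and tri: "\<forall>s\<in>idx g. b (fst (lab2 g s)) \<le> b (fst (lab1 g s))"
    and fin: "\<And>k. finite {s \<in> idx g. b (fst (lab1 g s)) = k}" for g
  proof
    show "g \<in> words Elem" by (rule g)
    show "finite {s \<in> idx g. lab1 g s = x}" for x
      by (rule finite_subset[OF _ fin[of "b (fst x)"]]) auto
    let ?b = "\<lambda>s. b (fst (lab1 g s))"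
    let ?U = "\<lambda>s. {t \<in> idx g. ?b t = ?b s \<and> (s, t) \<in> le g}"
    have "dep g \<subseteq> inv_image (less_than <*lex*> less_than) (\<lambda>s. (?b s, card (?U s)))"
    proof (rule subrelI)
      fix t s assume "(t, s) \<in> dep g"
      then have ts: "s \<in> idx g" "t \<in> idx g" "s \<noteq> t" "(s, t) \<in> le g" "fst (lab1 g t) = fst (lab2 g s)"
        unfolding in_dep by blast+
      have le: "?b t \<le> ?b s" using tri ts(1,5) by simp
      have "card (?U t) < card (?U s)" if eq: "?b t = ?b s"
      proof (rule psubset_card_mono)
        show "finite (?U s)" by (rule finite_subset[OF _ fin[of "?b s"]]) auto
        have "s \<in> ?U s" using ts(1) le_refl[OF g] by simp
        moreover have "s \<notin> ?U t" using ts(3,4) le_antisym_word[OF g] by blast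
        moreover have "?U t \<subseteq> ?U s" using eq le_trans_word[OF g ts(4)] by auto
        ultimately show "?U t \<subset> ?U s" by blast
      qed
      then show "(t, s) \<in> inv_image (less_than <*lex*> less_than) (\<lambda>s. (?b s, card (?U s)))"
        unfolding in_inv_image in_lex_prod less_than_iff using le le_neq_implies_less by blast
    qed
    then show "wf (dep g)"
      by (rule wf_subset[rotated]) (intro wf_inv_image wf_lex_prod wf_less_than)
  qed
  then show ?thesis using assms bar_Elem[OF f] by (simp add: S_Elem_iff)
qed

text \<open>Under the constant grading everything forms a single finite block.\<close>

lemma finite_word_in_S_Elem: "f \<in> words Elem \<Longrightarrow> finite (idx f) \<Longrightarrow> f \<in> S_Elem"
  by (rule block_triangular_in_S_Elem[where b = "\<lambda>_. 0"]) simp_all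

lemma big_free_Elem: "big_free Elem elem_inv"
  by unfold_locales simp

interpretation E: big_free Elem elem_inv
  by (rule big_free_Elem)

lemma admissible_S_Elem: "admissible Elem elem_inv S_Elem"
  unfolding admissible_def
proof (intro conjI ballI impI)
  show "S_Elem \<subseteq> words Elem" using S_Elem_words by blast
  show "concat_word f g \<in> S_Elem" if "f \<in> S_Elem" "g \<in> S_Elem" for f g
    by (rule concat_S_Elem[OF that])
  show "bar f \<in> S_Elem" if "f \<in> S_Elem" for f by (rule bar_S_Elem[OF that])
  show "g \<in> S_Elem" if "f \<in> S_Elem" "g \<in> words Elem" "cancels elem_inv f g" for f g
  proof -
    from that(3) obtain T star \<phi> where "is_iso \<phi> f (idx f - T) g"
      unfolding cancels_iff by (elim exE conjE)
    then have "is_iso \<phi> f (idx f - T) g" "is_iso \<phi> (bar f) (idx f - T) (bar g)"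
      using is_iso_bar by blast+
    then show ?thesis
      using that(1) good_word_iso[OF _ _ _ that(2)] good_word_iso[OF _ _ _ bar_Elem[OF that(2)]]
      unfolding S_Elem_iff by (metis Diff_subset bar_word_simps(1))
  qed
qed

lemma one_letter_S_Elem: "l \<in> Elem \<Longrightarrow> one_letter l \<in> S_Elem"
  by (rule finite_word_in_S_Elem[OF one_letter_in_words]) simp_all

lemma empty_S_Elem: "empty_word \<in> S_Elem"
  by (rule finite_word_in_S_Elem) simp_all

lemma S_Elem_nonempty: "S_Elem \<noteq> {}"
  using empty_S_Elem by blast

lemma alpha_word_equiv:
  assumes f: "f \<in> S_Elem" and g: "g \<in> S_Elem" and eq: "word_equiv Elem elem_inv f g"
  shows "alpha f = alpha g"
proof
  fix w
  interpret f: good_word f using f by (simp add: S_Elem_iff)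
  interpret g: good_word g using g by (simp add: S_Elem_iff)
  show "alpha f w = alpha g w"
  proof (cases "reduced w")
    case True
    \<comment> \<open>The labels in both supports, closed under inversion so that the equivalence
      restricts to words over \<open>A\<close>.\<close>
    define A where "A = (lab f ` f.support w \<union> lab g ` g.support w) \<union> elem_inv ` (lab f ` f.support w \<union> lab g ` g.support w)"
    have A: "finite A" "\<And>l. l \<in> A \<Longrightarrow> elem_inv l \<in> A"
      using f.support(1) g.support(1) unfolding A_def by auto
    have "f.support w \<subseteq> idx (restr A f)" using f.support(2) unfolding A_def by auto
    moreover have "idx (restr A f) \<subseteq> idx f" by auto
    ultimately have 1: "alpha f w = part_prod f (idx (restr A f)) w"
      using f.alpha_part_prod[OF True finite_restr[OF f.f A(1)]] by blast
    have "g.support w \<subseteq> idx (restr A g)" using g.support(2) unfolding A_def by auto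
    moreover have "idx (restr A g) \<subseteq> idx g" by auto
    ultimately have 2: "alpha g w = part_prod g (idx (restr A g)) w"
      using g.alpha_part_prod[OF True finite_restr[OF g.f A(1)]] by blast
    show ?thesis using part_prod_word_equiv[OF eq A] 1 2 by simp
  next
    case False
    then show ?thesis by (simp add: alpha_def extend_def)
  qed
qed

lemma alpha_reduced: "f \<in> S_Elem \<Longrightarrow> reduced w \<Longrightarrow> reduced (alpha f w)"
  using hom_F_reduced good_word.alpha_hom by (simp add: S_Elem_iff)

lemma alpha_concat:
  assumes f: "f \<in> S_Elem" and g: "g \<in> S_Elem" and w: "reduced w"
  shows "alpha (concat_word f g) w = alpha g (alpha f w)"
proof -
  interpret f: good_word f using f by (simp add: S_Elem_iff)
  interpret g: good_word g using g by (simp add: S_Elem_iff)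
  interpret h: good_word "concat_word f g" using concat_S_Elem[OF f g] by (simp add: S_Elem_iff)
  have v: "reduced (alpha f w)" by (rule alpha_reduced[OF f w])
  \<comment> \<open>\<open>P\<close> and \<open>Q\<close> have to carry three supports: that of
    \<open>f\<close> at \<open>w\<close>, that of \<open>g\<close> at the image of \<open>w\<close>,
    and the traces in both factors of the support of the concatenation.\<close>
  define P where "P = f.support w \<union> inL -` h.support w"
  define Q where "Q = g.support (alpha f w) \<union> inR -` h.support w"
  have hs: "h.support w \<subseteq> inL ` idx f \<union> inR ` idx g" "finite (h.support w)"
    using h.support by simp_all
  have "inj (inL :: (letter \<times> letter) \<times> nat \<Rightarrow> _)" "inj (inR :: (letter \<times> letter) \<times> nat \<Rightarrow> _)"
    by (simp_all add: inj_def)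
  then have fin: "finite P" "finite Q"
    unfolding P_def Q_def using f.support(1) g.support(1) hs(2) by (simp_all add: finite_vimageI)
  have sub: "P \<subseteq> idx f" "Q \<subseteq> idx g"
    unfolding P_def Q_def using f.support(2) g.support(2) hs(1) by fastforce+
  have hPQ: "h.support w \<subseteq> inL ` P \<union> inR ` Q"
  proof
    fix s assume "s \<in> h.support w"
    then show "s \<in> inL ` P \<union> inR ` Q"
      by (cases s rule: parts_cases) (simp_all add: P_def Q_def)
  qed
  have "alpha (concat_word f g) w = part_prod (concat_word f g) (inL ` P \<union> inR ` Q) w"
    by (rule h.alpha_part_prod[OF w]) (use fin sub hPQ in auto)
  also have "\<dots> = part_prod g Q (part_prod f P w)"
    unfolding part_prod_concat[OF f.f fin(1) sub(1) g.f fin(2) sub(2)]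
    by (rule mult_Aut_apply[OF part_prod_in_Aut[OF f.f fin(1) sub(1)] part_prod_in_Aut[OF g.f fin(2) sub(2)] w])
  also have "part_prod f P w = alpha f w"
    by (rule f.alpha_part_prod[OF w fin(1) sub(1), symmetric]) (simp add: P_def)
  also have "part_prod g Q (alpha f w) = alpha g (alpha f w)"
    by (rule g.alpha_part_prod[OF v fin(2) sub(2), symmetric]) (simp add: Q_def)
  finally show ?thesis .
qed

lemma alpha_empty: "reduced w \<Longrightarrow> alpha empty_word w = w"
proof -
  assume w: "reduced w"
  interpret good_word empty_word using empty_S_Elem by (simp add: S_Elem_iff)
  have "alpha empty_word w = part_prod empty_word {} w"
    by (rule alpha_part_prod[OF w]) (use support(2)[of w] in auto)
  then show ?thesis using w by (simp add: part_prod_empty one_Aut_apply)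
qed

lemma alpha_bar:
  assumes f: "f \<in> S_Elem" and w: "reduced w"
  shows "alpha (bar f) (alpha f w) = w"
proof -
  have "word_equiv Elem elem_inv (concat_word f (bar f)) empty_word"
    using E.cls_concat_bar[OF S_Elem_words[OF f]] S_Elem_words[OF concat_S_Elem[OF f bar_S_Elem[OF f]]]
    by (simp add: word_class_eq)
  then have "alpha (concat_word f (bar f)) = alpha empty_word"
    by (rule alpha_word_equiv[OF concat_S_Elem[OF f bar_S_Elem[OF f]] empty_S_Elem])
  then show ?thesis
    using alpha_concat[OF f bar_S_Elem[OF f] w] alpha_empty[OF w] by simp
qed

text \<open>Bijectivity comes from the reversed word, which stays in \<open>S_Elem\<close> because
  the chain condition is imposed on a word and on its reversal.\<close>

lemma alpha_in_Aut:
  assumes f: "f \<in> S_Elem"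
  shows "alpha f \<in> carrier Aut_F_omega"
proof -
  have "bij_betw (alpha f) (carrier F_omega) (carrier F_omega)"
    by (rule bij_betw_byWitness[where f' = "alpha (bar f)"])
      (use alpha_bar[OF f] alpha_bar[OF bar_S_Elem[OF f]] alpha_reduced[OF f] alpha_reduced[OF bar_S_Elem[OF f]]
        in auto)
  moreover have "alpha f \<in> hom F_omega F_omega" using f good_word.alpha_hom by (simp add: S_Elem_iff)
  moreover have "alpha f \<in> extensional (carrier F_omega)" by (simp add: alpha_def extend_def)
  ultimately show ?thesis by (simp add: carrier_Aut)
qed

section \<open>The group G and the homomorphism to the automorphism group\<close>

abbreviation cls :: "(letter \<times> letter) word \<Rightarrow> (letter \<times> letter) word set" where
  "cls \<equiv> word_class Elem elem_inv"

lemma subgroup_G: "subgroup (cls ` S_Elem) (BF Elem elem_inv)"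
  by (rule E.subgroup_BF_sub[OF admissible_S_Elem S_Elem_nonempty])

lemma carrier_G: "carrier G_Elem = cls ` S_Elem"
  by (simp add: G_Elem_def BF_sub_def)

lemma mult_G_BF: "x \<otimes>\<^bsub>G_Elem\<^esub> y = x \<otimes>\<^bsub>BF Elem elem_inv\<^esub> y"
  by (simp add: G_Elem_def BF_sub_def)

lemma one_G_BF: "\<one>\<^bsub>G_Elem\<^esub> = \<one>\<^bsub>BF Elem elem_inv\<^esub>"
  by (simp add: G_Elem_def BF_sub_def)

lemma group_G: "group G_Elem"
  unfolding G_Elem_def BF_sub_def by (rule subgroup.subgroup_is_group[OF subgroup_G E.group_BF])

lemma cls_in_G: "f \<in> S_Elem \<Longrightarrow> cls f \<in> carrier G_Elem"
  by (simp add: carrier_G)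

lemma mult_G: "f \<in> S_Elem \<Longrightarrow> g \<in> S_Elem \<Longrightarrow> cls f \<otimes>\<^bsub>G_Elem\<^esub> cls g = cls (concat_word f g)"
  by (simp add: mult_G_BF E.mult_cls S_Elem_words)

lemma inv_G: "f \<in> S_Elem \<Longrightarrow> inv\<^bsub>G_Elem\<^esub> (cls f) = cls (bar f)"
  by (rule group.inv_equality[OF group_G])
    (simp_all add: mult_G bar_S_Elem cls_in_G one_G_BF E.one_BF E.cls_bar_concat S_Elem_words)

lemma inv_G_BF: "x \<in> carrier G_Elem \<Longrightarrow> inv\<^bsub>G_Elem\<^esub> x = inv\<^bsub>BF Elem elem_inv\<^esub> x"
  using inv_G E.inv_cls S_Elem_words by (auto simp: carrier_G)

lemma Psi_cls:
  assumes f: "f \<in> S_Elem"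
  shows "Psi (cls f) = alpha f"
proof -
  have "alpha g = alpha f" if "g \<in> cls f \<inter> S_Elem" for g
    using alpha_word_equiv[of f g] f that by (auto simp: in_word_class)
  moreover have "f \<in> cls f \<inter> S_Elem" using f word_class_self[OF S_Elem_words[OF f]] by blast
  ultimately have "alpha ` (cls f \<inter> S_Elem) = {alpha f}" by blast
  then show ?thesis by (simp add: Psi_def)
qed

lemma Psi_hom: "Psi \<in> hom G_Elem Aut_F_omega"
proof (rule homI)
  fix x assume "x \<in> carrier G_Elem"
  then obtain f where f: "f \<in> S_Elem" "x = cls f" by (auto simp: carrier_G)
  then show "Psi x \<in> carrier Aut_F_omega" using Psi_cls alpha_in_Aut by simp
  fix y assume "y \<in> carrier G_Elem"
  then obtain g where g: "g \<in> S_Elem" "y = cls g" by (auto simp: carrier_G)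
  have h: "concat_word f g \<in> S_Elem" by (rule concat_S_Elem[OF f(1) g(1)])
  have "alpha (concat_word f g) = alpha f \<cdot> alpha g"
  proof (rule Aut_eqI[OF alpha_in_Aut[OF h]])
    show "alpha f \<cdot> alpha g \<in> carrier Aut_F_omega"
      using group_Aut alpha_in_Aut f g by (simp add: group.is_monoid monoid.m_closed)
    show "alpha (concat_word f g) [x] = (alpha f \<cdot> alpha g) [x]" for x
      using alpha_concat[OF f(1) g(1), of "[x]"] mult_Aut_apply[OF alpha_in_Aut[OF f(1)] alpha_in_Aut[OF g(1)], of "[x]"]
      by simp
  qed
  then show "Psi (x \<otimes>\<^bsub>G_Elem\<^esub> y) = Psi x \<cdot> Psi y"
    using f g h by (simp add: mult_G Psi_cls)
qed

interpretation G: group G_Elem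
  by (rule group_G)

interpretation Aut: group Aut_F_omega
  by (rule group_Aut)

interpretation Psi: group_hom G_Elem Aut_F_omega Psi
  by (simp add: group_hom_def group_hom_axioms_def group_G group_Aut Psi_hom)

lemma alpha_finite:
  assumes f: "f \<in> words Elem" and fin: "finite (idx f)"
  shows "alpha f = part_prod f (idx f)"
proof (rule Aut_eqI)
  have S: "f \<in> S_Elem" by (rule finite_word_in_S_Elem[OF f fin])
  then interpret good_word f by (simp add: S_Elem_iff)
  show "alpha f \<in> carrier Aut_F_omega" by (rule alpha_in_Aut[OF S])
  show "part_prod f (idx f) \<in> carrier Aut_F_omega" by (rule part_prod_in_Aut[OF f fin]) simp
  show "alpha f [x] = part_prod f (idx f) [x]" for x
    by (rule alpha_part_prod[OF _ fin]) (use support(2) in auto)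
qed

lemma Psi_Egen: "independent a b \<Longrightarrow> Psi (Egen a b) = elem_aut (a, b)"
proof -
  assume "independent a b"
  then have e: "(a, b) \<in> Elem" by (simp add: Elem_def)
  then have w: "one_letter (a, b) \<in> words Elem" by (rule one_letter_in_words)
  have "Psi (Egen a b) = part_prod (one_letter (a, b)) {((a, b), 0)}"
    unfolding Egen_def using Psi_cls[OF one_letter_S_Elem[OF e]] alpha_finite[OF w] by simp
  then show ?thesis using part_prod_single[OF w, of "((a, b), 0)"] by simp
qed

lemma Egen_in_G: "independent a b \<Longrightarrow> Egen a b \<in> carrier G_Elem"
  unfolding Egen_def by (intro cls_in_G one_letter_S_Elem) (simp add: Elem_def)

section \<open>Topologies defined by subgroups\<close>

lemma openin_subgroup_topology:
  assumes "\<And>N1 N2. N1 \<in> B \<Longrightarrow> N2 \<in> B \<Longrightarrow> \<exists>N\<in>B. N \<subseteq> N1 \<inter> N2"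
  shows "openin (subgroup_topology G B) U \<longleftrightarrow> U \<subseteq> carrier G \<and> (\<forall>g\<in>U. \<exists>N\<in>B. g <#\<^bsub>G\<^esub> N \<subseteq> U)"
proof -
  have mono: "g <#\<^bsub>G\<^esub> N \<subseteq> g <#\<^bsub>G\<^esub> N'" if "N \<subseteq> N'" for g N N'
    using that unfolding l_coset_def by blast
  have "istopology (\<lambda>U. U \<subseteq> carrier G \<and> (\<forall>g\<in>U. \<exists>N\<in>B. g <#\<^bsub>G\<^esub> N \<subseteq> U))"
    unfolding istopology_def
  proof (intro conjI allI impI ballI)
    fix S T g
    assume S: "S \<subseteq> carrier G \<and> (\<forall>g\<in>S. \<exists>N\<in>B. g <#\<^bsub>G\<^esub> N \<subseteq> S)"
      and T: "T \<subseteq> carrier G \<and> (\<forall>g\<in>T. \<exists>N\<in>B. g <#\<^bsub>G\<^esub> N \<subseteq> T)"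
    show "S \<inter> T \<subseteq> carrier G" using S by blast
    assume "g \<in> S \<inter> T"
    then obtain N1 N2 where N: "N1 \<in> B" "N2 \<in> B" "g <#\<^bsub>G\<^esub> N1 \<subseteq> S" "g <#\<^bsub>G\<^esub> N2 \<subseteq> T" using S T by blast
    obtain N where "N \<in> B" "N \<subseteq> N1 \<inter> N2" using assms[OF N(1,2)] by blast
    then show "\<exists>N\<in>B. g <#\<^bsub>G\<^esub> N \<subseteq> S \<inter> T" using N mono[of N N1 g] mono[of N N2 g] by blast
  next
    fix \<K> assume K: "\<forall>K\<in>\<K>. K \<subseteq> carrier G \<and> (\<forall>g\<in>K. \<exists>N\<in>B. g <#\<^bsub>G\<^esub> N \<subseteq> K)"
    show "\<Union>\<K> \<subseteq> carrier G" using K by blast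
    fix g assume "g \<in> \<Union>\<K>"
    then obtain K' where K': "K' \<in> \<K>" "g \<in> K'" by blast
    then obtain N where "N \<in> B" "g <#\<^bsub>G\<^esub> N \<subseteq> K'" using K by blast
    then show "\<exists>N\<in>B. g <#\<^bsub>G\<^esub> N \<subseteq> \<Union>\<K>" using K' by blast
  qed
  then show ?thesis
    unfolding subgroup_topology_def by (simp add: topology_inverse')
qed

text \<open>The basic subgroups are not assumed to be normal; \<open>base_conj\<close> is the
  substitute that makes multiplication and inversion continuous.\<close>

locale subgroup_base = group G for G (structure) +
  fixes B :: "'a set set"
  assumes base_nonempty: "B \<noteq> {}"
    and base_subgroup: "\<And>N. N \<in> B \<Longrightarrow> subgroup N G"
    and base_directed: "\<And>N1 N2. N1 \<in> B \<Longrightarrow> N2 \<in> B \<Longrightarrow> \<exists>N\<in>B. N \<subseteq> N1 \<inter> N2"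
    and base_conj: "\<And>g N. g \<in> carrier G \<Longrightarrow> N \<in> B \<Longrightarrow> \<exists>M\<in>B. \<forall>m\<in>M. inv g \<otimes> m \<otimes> g \<in> N"
begin

abbreviation "\<T> \<equiv> subgroup_topology G B"

lemma openin_iff: "openin \<T> U \<longleftrightarrow> U \<subseteq> carrier G \<and> (\<forall>g\<in>U. \<exists>N\<in>B. g <# N \<subseteq> U)"
  by (rule openin_subgroup_topology) (rule base_directed)

lemma open_subset: "openin \<T> U \<Longrightarrow> U \<subseteq> carrier G"
  by (simp add: openin_iff)

lemma open_coset:
  assumes g: "g \<in> carrier G" and N: "N \<in> B"
  shows "openin \<T> (g <# N)" "g \<in> g <# N"
proof -
  note sN = base_subgroup[OF N]
  show "g \<in> g <# N"
    using subgroup.one_closed[OF sN] g unfolding l_coset_def by force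
  have sub: "N \<subseteq> carrier G" by (rule subgroup.subset[OF sN])
  have "h <# N \<subseteq> g <# N" if "h \<in> g <# N" for h
  proof
    from that obtain n where n: "n \<in> N" "h = g \<otimes> n" unfolding l_coset_def by blast
    fix k assume "k \<in> h <# N"
    then obtain n' where n': "n' \<in> N" "k = h \<otimes> n'" unfolding l_coset_def by blast
    have "k = g \<otimes> (n \<otimes> n')" using n n' g sub by (simp add: m_assoc subsetD)
    moreover have "n \<otimes> n' \<in> N" by (rule subgroup.m_closed[OF sN n(1) n'(1)])
    ultimately show "k \<in> g <# N" unfolding l_coset_def by blast
  qed
  moreover have "g <# N \<subseteq> carrier G"
    using g sub unfolding l_coset_def by blast
  ultimately show "openin \<T> (g <# N)" using N openin_iff by blast
qed

lemma topspace: "topspace \<T> = carrier G"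
proof -
  obtain N where N: "N \<in> B" using base_nonempty by blast
  have "g <# N \<subseteq> carrier G" if "g \<in> carrier G" for g
    using open_subset[OF open_coset(1)[OF that N]] .
  then have "openin \<T> (carrier G)" using N openin_iff by blast
  then show ?thesis using open_subset[OF openin_topspace] openin_subset by blast
qed

lemma in_closure:
  "x \<in> \<T> closure_of S \<longleftrightarrow> x \<in> carrier G \<and> (\<forall>N\<in>B. \<exists>n\<in>N. x \<otimes> n \<in> S)"
proof
  assume x: "x \<in> \<T> closure_of S"
  then have xG: "x \<in> carrier G" using topspace by (simp add: in_closure_of)
  have "\<exists>n\<in>N. x \<otimes> n \<in> S" if N: "N \<in> B" for N
  proof -
    have "\<exists>y. y \<in> S \<and> y \<in> x <# N"
      using x open_coset[OF xG N] unfolding in_closure_of by blast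
    then show ?thesis unfolding l_coset_def by blast
  qed
  then show "x \<in> carrier G \<and> (\<forall>N\<in>B. \<exists>n\<in>N. x \<otimes> n \<in> S)" using xG by blast
next
  assume x: "x \<in> carrier G \<and> (\<forall>N\<in>B. \<exists>n\<in>N. x \<otimes> n \<in> S)"
  have "\<exists>y. y \<in> S \<and> y \<in> U" if "x \<in> U \<and> openin \<T> U" for U
  proof -
    from that obtain N where "N \<in> B" "x <# N \<subseteq> U" using openin_iff by blast
    moreover from this obtain n where "n \<in> N" "x \<otimes> n \<in> S" using x by blast
    ultimately show ?thesis unfolding l_coset_def by blast
  qed
  then show "x \<in> \<T> closure_of S" using x topspace by (simp add: in_closure_of)
qed

lemma topological: "topological_group G \<T>"
proof -
  have mult: "continuous_map (prod_topology \<T> \<T>) \<T> (\<lambda>(x, y). x \<otimes> y)"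
    unfolding continuous_map_def
  proof (intro conjI allI impI)
    show "(\<lambda>(x, y). x \<otimes> y) \<in> topspace (prod_topology \<T> \<T>) \<rightarrow> topspace \<T>"
      by (auto simp: topspace)
    fix U assume U: "openin \<T> U"
    show "openin (prod_topology \<T> \<T>) {z \<in> topspace (prod_topology \<T> \<T>). (case z of (x, y) \<Rightarrow> x \<otimes> y) \<in> U}"
      unfolding openin_prod_topology_alt
    proof (intro allI impI)
      fix x y assume "(x, y) \<in> {z \<in> topspace (prod_topology \<T> \<T>). (case z of (x, y) \<Rightarrow> x \<otimes> y) \<in> U}"
      then have xy: "x \<in> carrier G" "y \<in> carrier G" "x \<otimes> y \<in> U" by (simp_all add: topspace)
      obtain N where N: "N \<in> B" "(x \<otimes> y) <# N \<subseteq> U" using U xy(3) openin_iff by blast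
      \<comment> \<open>Passing \<open>m\<close> across \<open>y\<close> conjugates it: x m y n is x
        y times (inv y) m y times n.\<close>
      obtain M where M: "M \<in> B" "\<forall>m\<in>M. inv y \<otimes> m \<otimes> y \<in> N" using base_conj[OF xy(2) N(1)] by blast
      have sub: "N \<subseteq> carrier G" "M \<subseteq> carrier G"
        using subgroup.subset[OF base_subgroup] N(1) M(1) by blast+
      have "x' \<otimes> y' \<in> U" if "x' \<in> x <# M" "y' \<in> y <# N" for x' y'
      proof -
        from that obtain m n where mn: "m \<in> M" "x' = x \<otimes> m" "n \<in> N" "y' = y \<otimes> n"
          unfolding l_coset_def by blast
        have c: "m \<in> carrier G" "n \<in> carrier G" using mn sub by blast+
        have "y \<otimes> (inv y \<otimes> k) = k" if "k \<in> carrier G" for k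
          using that xy by (simp add: m_assoc[symmetric])
        then have "x' \<otimes> y' = (x \<otimes> y) \<otimes> ((inv y \<otimes> m \<otimes> y) \<otimes> n)"
          using mn c xy by (simp add: m_assoc)
        moreover have "(inv y \<otimes> m \<otimes> y) \<otimes> n \<in> N"
          using subgroup.m_closed[OF base_subgroup[OF N(1)]] M(2) mn by blast
        ultimately show ?thesis using N(2) unfolding l_coset_def by blast
      qed
      moreover have "x <# M \<subseteq> carrier G" "y <# N \<subseteq> carrier G"
        using open_subset open_coset(1) xy N(1) M(1) by blast+
      ultimately have "(x <# M) \<times> (y <# N) \<subseteq> {z \<in> topspace (prod_topology \<T> \<T>). (case z of (x, y) \<Rightarrow> x \<otimes> y) \<in> U}"
        by (auto simp: topspace)
      then show "\<exists>V W. openin \<T> V \<and> openin \<T> W \<and> x \<in> V \<and> y \<in> W \<and>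
          V \<times> W \<subseteq> {z \<in> topspace (prod_topology \<T> \<T>). (case z of (x, y) \<Rightarrow> x \<otimes> y) \<in> U}"
        using open_coset[OF xy(1) M(1)] open_coset[OF xy(2) N(1)] by blast
    qed
  qed
  have "continuous_map \<T> \<T> (\<lambda>x. inv x)"
    unfolding continuous_map_def
  proof (intro conjI allI impI)
    show "(\<lambda>x. inv x) \<in> topspace \<T> \<rightarrow> topspace \<T>" by (auto simp: topspace)
    fix U assume U: "openin \<T> U"
    have nbhd: "\<exists>N\<in>B. x <# N \<subseteq> {x \<in> carrier G. inv x \<in> U}" if x: "x \<in> carrier G" and ix: "inv x \<in> U" for x
    proof -
      obtain N where N: "N \<in> B" "inv x <# N \<subseteq> U" using U ix openin_iff by blast
      obtain M where M: "M \<in> B" "\<forall>m\<in>M. inv (inv x) \<otimes> m \<otimes> inv x \<in> N"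
        using base_conj[OF inv_closed[OF x] N(1)] by blast
      have sub: "M \<subseteq> carrier G" using subgroup.subset[OF base_subgroup[OF M(1)]] .
      have "x \<otimes> m \<in> carrier G \<and> inv (x \<otimes> m) \<in> U" if m: "m \<in> M" for m
      proof -
        have c: "m \<in> carrier G" using m sub by blast
        have im: "inv m \<in> M" by (rule subgroup.m_inv_closed[OF base_subgroup[OF M(1)] m])
        \<comment> \<open>The inverse of x m is inv x times the conjugate x (inv m) (inv x), to
          which the choice of \<open>M\<close> applies.\<close>
        have "inv (x \<otimes> m) = inv x \<otimes> (inv (inv x) \<otimes> inv m \<otimes> inv x)"
          using c x by (simp add: inv_mult_group m_assoc[symmetric])
        then have "inv (x \<otimes> m) \<in> inv x <# N" using M(2) im unfolding l_coset_def by blast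
        then show ?thesis using N(2) c x by blast
      qed
      then have "x <# M \<subseteq> {x \<in> carrier G. inv x \<in> U}" unfolding l_coset_def by blast
      then show ?thesis using M(1) by blast
    qed
    show "openin \<T> {x \<in> topspace \<T>. inv x \<in> U}"
      unfolding topspace openin_iff
    proof (intro conjI ballI)
      show "\<exists>N\<in>B. x <# N \<subseteq> {x \<in> carrier G. inv x \<in> U}" if "x \<in> {x \<in> carrier G. inv x \<in> U}" for x
        using nbhd[of x] that by simp
    qed simp
  qed
  then show ?thesis
    using mult topspace is_group by (simp add: topological_group_def)
qed

end

section \<open>The topology on the group\<close>

lemma subgroup_stabilizer: "subgroup (stabilizer_of Y) Aut_F_omega"
proof
  show "stabilizer_of Y \<subseteq> carrier Aut_F_omega" by (auto simp: stabilizer_of_def)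
  show "\<one>\<^sub>A \<in> stabilizer_of Y" by (simp add: stabilizer_of_def one_Aut_apply)
  show "x \<cdot> y \<in> stabilizer_of Y" if "x \<in> stabilizer_of Y" "y \<in> stabilizer_of Y" for x y
    using that by (simp add: stabilizer_of_def mult_Aut_apply)
  show "inv\<^sub>A x \<in> stabilizer_of Y" if "x \<in> stabilizer_of Y" for x
    using that by (simp add: stabilizer_of_def Aut_inv_apply)
qed

lemma finite_symmetricD:
  assumes "finite_symmetric \<Lambda> i A"
  shows "A \<subseteq> \<Lambda>" "finite A" "i ` A = A"
  using assms by (simp_all add: finite_symmetric_def)

lemma ker_normal: "finite_symmetric Elem elem_inv A \<Longrightarrow> ker_proj Elem elem_inv A \<lhd> BF Elem elem_inv"
  by (intro E.ker_proj_normal finite_symmetricD)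

lemma in_U_nbhd:
  "g \<in> U_nbhd Y A \<longleftrightarrow> g \<in> carrier G_Elem \<and> Psi g \<in> stabilizer_of Y \<and> g \<in> ker_proj Elem elem_inv A"
  by (auto simp: U_nbhd_def)

lemma subgroup_U_nbhd:
  assumes A: "finite_symmetric Elem elem_inv A"
  shows "subgroup (U_nbhd Y A) G_Elem"
proof
  note sK = normal_imp_subgroup[OF ker_normal[OF A]]
  show "U_nbhd Y A \<subseteq> carrier G_Elem" by (auto simp: in_U_nbhd)
  show "\<one>\<^bsub>G_Elem\<^esub> \<in> U_nbhd Y A"
    using subgroup.one_closed[OF sK] subgroup.one_closed[OF subgroup_stabilizer]
    by (simp add: in_U_nbhd Psi.hom_one) (simp add: one_G_BF)
  show "x \<otimes>\<^bsub>G_Elem\<^esub> y \<in> U_nbhd Y A" if "x \<in> U_nbhd Y A" "y \<in> U_nbhd Y A" for x y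
    using that subgroup.m_closed[OF sK] subgroup.m_closed[OF subgroup_stabilizer]
    by (simp add: in_U_nbhd) (simp add: mult_G_BF)
  show "inv\<^bsub>G_Elem\<^esub> x \<in> U_nbhd Y A" if "x \<in> U_nbhd Y A" for x
    using that subgroup.m_inv_closed[OF sK] subgroup.m_inv_closed[OF subgroup_stabilizer]
    by (simp add: in_U_nbhd) (simp add: inv_G_BF)
qed

text \<open>Fixing a basis element entails fixing its inverse, so it is enough that \<open>Y\<close>
  contains the positive form of each letter of \<open>w\<close>.\<close>

lemma Aut_fix_word:
  assumes \<alpha>: "\<alpha> \<in> stabilizer_of Y" and w: "reduced w" and Y: "\<And>z. z \<in> set w \<Longrightarrow> (fst z, True) \<in> Y"
  shows "\<alpha> w = w"
proof -
  have A: "\<alpha> \<in> carrier Aut_F_omega" using \<alpha> by (simp add: stabilizer_of_def)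
  note h = Aut_hom[OF A]
  have "\<alpha> [z] = [z]" if "z \<in> set w" for z
  proof -
    have b: "\<alpha> [(fst z, True)] = [(fst z, True)]"
      using \<alpha> Y[OF that] by (simp add: stabilizer_of_def)
    show ?thesis
    proof (cases "snd z")
      case True
      then have "(fst z, True) = z" by (simp add: prod_eq_iff)
      then show ?thesis using b by (simp only:)
    next
      case False
      then have e: "linv (fst z, True) = z" by (simp add: prod_eq_iff linv_def)
      have "\<alpha> [linv (fst z, True)] = [linv (fst z, True)]"
        using hom_F_linv[OF h, of "(fst z, True)"] b by simp
      then show ?thesis unfolding e .
    qed
  qed
  then have "subst_word (\<lambda>z. \<alpha> [z]) w = subst_word (\<lambda>z. [z]) w" by (rule subst_word_cong)
  then show ?thesis using hom_F_subst_word[OF h w] w by (simp add: subst_word_single)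
qed

definition base :: "(letter \<times> letter) word set set set" where
  "base = {U_nbhd Y A | Y A. finite Y \<and> Y \<subseteq> basis \<and> finite_symmetric Elem elem_inv A}"

lemma baseI: "finite Y \<Longrightarrow> Y \<subseteq> basis \<Longrightarrow> finite_symmetric Elem elem_inv A \<Longrightarrow> U_nbhd Y A \<in> base"
  unfolding base_def by blast

lemma finite_symmetric_Un:
  "finite_symmetric \<Lambda> i A \<Longrightarrow> finite_symmetric \<Lambda> i A' \<Longrightarrow> finite_symmetric \<Lambda> i (A \<union> A')"
  by (simp add: finite_symmetric_def image_Un)

lemma finite_symmetric_empty: "finite_symmetric \<Lambda> i {}"
  by (simp add: finite_symmetric_def)

lemma ker_proj_Un:
  assumes "finite_symmetric Elem elem_inv A" "finite_symmetric Elem elem_inv A'"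
  shows "ker_proj Elem elem_inv (A \<union> A') \<subseteq> ker_proj Elem elem_inv A \<inter> ker_proj Elem elem_inv A'"
  using E.ker_proj_mono[of A "A \<union> A'"] E.ker_proj_mono[of A' "A \<union> A'"]
    finite_symmetricD[OF assms(1)] finite_symmetricD[OF assms(2)] finite_symmetricD[OF finite_symmetric_Un[OF assms]]
  by simp

interpretation T: subgroup_base G_Elem base
proof (intro subgroup_base.intro subgroup_base_axioms.intro group_G)
  show "base \<noteq> {}" using baseI[of "{}", OF _ _ finite_symmetric_empty] by auto
  show "subgroup N G_Elem" if "N \<in> base" for N
    using that subgroup_U_nbhd unfolding base_def by blast
  show "\<exists>N\<in>base. N \<subseteq> N1 \<inter> N2" if N: "N1 \<in> base" "N2 \<in> base" for N1 N2
  proof -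
    obtain Y1 A1 where 1: "N1 = U_nbhd Y1 A1" "finite Y1" "Y1 \<subseteq> basis" "finite_symmetric Elem elem_inv A1"
      using N(1) unfolding base_def by blast
    obtain Y2 A2 where 2: "N2 = U_nbhd Y2 A2" "finite Y2" "Y2 \<subseteq> basis" "finite_symmetric Elem elem_inv A2"
      using N(2) unfolding base_def by blast
    have "U_nbhd (Y1 \<union> Y2) (A1 \<union> A2) \<subseteq> N1 \<inter> N2"
    proof
      fix g assume "g \<in> U_nbhd (Y1 \<union> Y2) (A1 \<union> A2)"
      then show "g \<in> N1 \<inter> N2"
        using ker_proj_Un[OF 1(4) 2(4)] unfolding 1(1) 2(1) in_U_nbhd Int_iff stabilizer_of_def by blast
    qed
    moreover have "U_nbhd (Y1 \<union> Y2) (A1 \<union> A2) \<in> base"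
      using 1 2 by (intro baseI finite_symmetric_Un) auto
    ultimately show ?thesis by blast
  qed
  show "\<exists>M\<in>base. \<forall>m\<in>M. inv\<^bsub>G_Elem\<^esub> g \<otimes>\<^bsub>G_Elem\<^esub> m \<otimes>\<^bsub>G_Elem\<^esub> g \<in> N"
    if g: "g \<in> carrier G_Elem" and N: "N \<in> base" for g N
  proof -
    obtain Y A where YA: "N = U_nbhd Y A" "finite Y" "Y \<subseteq> basis" "finite_symmetric Elem elem_inv A"
      using N unfolding base_def by blast
    let ?v = "\<lambda>y. (inv\<^sub>A (Psi g)) [y]"
    \<comment> \<open>The conjugate fixes \<open>y\<close> as soon as \<open>m\<close> fixes the
      word that the inverse of \<open>Psi g\<close> assigns to \<open>y\<close>. These are the basis
      elements occurring in such words.\<close>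
    define Y' where "Y' = (\<Union>y\<in>Y. (\<lambda>z. (fst z, True)) ` set (?v y))"
    have Y': "finite Y'" "Y' \<subseteq> basis" using YA(2) by (auto simp: Y'_def basis_def)
    have \<gamma>: "Psi g \<in> carrier Aut_F_omega" using g by (rule Psi.hom_closed)
    have "inv\<^bsub>G_Elem\<^esub> g \<otimes>\<^bsub>G_Elem\<^esub> m \<otimes>\<^bsub>G_Elem\<^esub> g \<in> N" if m: "m \<in> U_nbhd Y' A" for m
    proof -
      have mG: "m \<in> carrier G_Elem" "Psi m \<in> stabilizer_of Y'" "m \<in> ker_proj Elem elem_inv A"
        using m by (simp_all add: in_U_nbhd)
      have \<mu>: "Psi m \<in> carrier Aut_F_omega" using mG(1) by (rule Psi.hom_closed)
      have gBF: "g \<in> carrier (BF Elem elem_inv)"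
        using g subgroup.subset[OF subgroup_G] by (auto simp: carrier_G)
      have 1: "inv\<^bsub>G_Elem\<^esub> g \<otimes>\<^bsub>G_Elem\<^esub> m \<otimes>\<^bsub>G_Elem\<^esub> g \<in> ker_proj Elem elem_inv A"
        using normal.inv_op_closed1[OF ker_normal[OF YA(4)] gBF mG(3)]
        by (simp add: mult_G_BF inv_G_BF[OF g])
      have 2: "(inv\<^sub>A (Psi g) \<cdot> Psi m \<cdot> Psi g) [y] = [y]" if y: "y \<in> Y" for y
      proof -
        have r: "reduced (?v y)" by (rule hom_F_reduced[OF Aut_hom[OF Aut.inv_closed[OF \<gamma>]]]) simp
        have "(fst z, True) \<in> Y'" if "z \<in> set (?v y)" for z
          unfolding Y'_def using y that by blast
        then have f: "Psi m (?v y) = ?v y" by (rule Aut_fix_word[OF mG(2) r])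
        have "Psi g (?v y) = (inv\<^sub>A (Psi g) \<cdot> Psi g) [y]"
          by (rule mult_Aut_apply[symmetric]) (use \<gamma> in simp_all)
        also have "\<dots> = [y]" using \<gamma> by (simp add: one_Aut_apply)
        finally have "Psi g (?v y) = [y]" .
        then show ?thesis using f \<gamma> \<mu> by (simp add: mult_Aut_apply)
      qed
      show ?thesis
        unfolding YA(1) in_U_nbhd using 1 2 g mG(1) \<gamma> \<mu> by (simp add: stabilizer_of_def)
    qed
    then show ?thesis using baseI[OF Y' YA(4)] by blast
  qed
qed

lemma T_Elem_base: "T_Elem = subgroup_topology G_Elem base"
  by (simp add: T_Elem_def base_def)

section \<open>Comparison with the natural topology, density of the finitary part, closedness of the
  kernel\<close>

lemma natural_coarser:
  assumes "openin (natural_topology Elem elem_inv S_Elem) U"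
  shows "openin T_Elem U"
proof -
  let ?B = "{ker_proj Elem elem_inv A \<inter> carrier G_Elem | A. finite_symmetric Elem elem_inv A}"
  have "\<exists>N\<in>?B. N \<subseteq> N1 \<inter> N2" if N: "N1 \<in> ?B" "N2 \<in> ?B" for N1 N2
  proof -
    obtain A1 A2 where *: "N1 = ker_proj Elem elem_inv A1 \<inter> carrier G_Elem" "finite_symmetric Elem elem_inv A1"
      "N2 = ker_proj Elem elem_inv A2 \<inter> carrier G_Elem" "finite_symmetric Elem elem_inv A2" using N by blast
    show ?thesis
      by (rule bexI[of _ "ker_proj Elem elem_inv (A1 \<union> A2) \<inter> carrier G_Elem"])
        (use ker_proj_Un[OF *(2,4)] finite_symmetric_Un[OF *(2,4)] *(1,3) in blast)+
  qed
  then have op: "openin (subgroup_topology G_Elem ?B) V \<longleftrightarrow>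
      V \<subseteq> carrier G_Elem \<and> (\<forall>g\<in>V. \<exists>N\<in>?B. g <#\<^bsub>G_Elem\<^esub> N \<subseteq> V)" for V
    by (rule openin_subgroup_topology)
  have U: "U \<subseteq> carrier G_Elem" "\<forall>g\<in>U. \<exists>N\<in>?B. g <#\<^bsub>G_Elem\<^esub> N \<subseteq> U"
    using assms op unfolding natural_topology_def G_Elem_def[symmetric] by blast+
  have "\<exists>N\<in>base. g <#\<^bsub>G_Elem\<^esub> N \<subseteq> U" if "g \<in> U" for g
  proof -
    obtain A where A: "finite_symmetric Elem elem_inv A"
      "g <#\<^bsub>G_Elem\<^esub> (ker_proj Elem elem_inv A \<inter> carrier G_Elem) \<subseteq> U"
      using U(2) \<open>g \<in> U\<close> by blast
    have "U_nbhd {} A \<subseteq> ker_proj Elem elem_inv A \<inter> carrier G_Elem" by (auto simp: in_U_nbhd)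
    then have "g <#\<^bsub>G_Elem\<^esub> U_nbhd {} A \<subseteq> U" using A(2) unfolding l_coset_def by blast
    then show ?thesis using baseI[of "{}" A] A(1) by blast
  qed
  then show ?thesis using U(1) T.openin_iff unfolding T_Elem_base by blast
qed

lemma finitary_dense: "T_Elem closure_of (finitary_part Elem elem_inv) = carrier G_Elem"
proof (intro equalityI subsetI)
  show "x \<in> carrier G_Elem" if "x \<in> T_Elem closure_of (finitary_part Elem elem_inv)" for x
    using that T.in_closure unfolding T_Elem_base by blast
next
  fix x assume xG: "x \<in> carrier G_Elem"
  then obtain f where f: "f \<in> S_Elem" "x = cls f" by (auto simp: carrier_G)
  note fw = S_Elem_words[OF f(1)]
  interpret f: good_word f using f(1) by (simp add: S_Elem_iff)
  have "\<exists>n\<in>N. x \<otimes>\<^bsub>G_Elem\<^esub> n \<in> finitary_part Elem elem_inv" if N: "N \<in> base" for N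
  proof -
    obtain Y A where YA: "N = U_nbhd Y A" "finite Y" "Y \<subseteq> basis" "finite_symmetric Elem elem_inv A"
      using N unfolding base_def by blast
    note A = finite_symmetricD[OF YA(4)]
    \<comment> \<open>The error of the approximation is the inverse of \<open>x\<close> followed by
      a truncation of \<open>f\<close>. It sends \<open>y\<close> first to \<open>?v y\<close>; the
      truncation brings this word back to \<open>y\<close> if it keeps the support of
      \<open>f\<close> there.\<close>
    let ?v = "\<lambda>y. alpha (bar f) [y]"
    define L where "L = (\<Union>y\<in>Y. lab f ` f.support (?v y))"
    define A' where "A' = A \<union> L \<union> elem_inv ` L"
    have L: "finite L" "L \<subseteq> Elem"
      unfolding L_def using YA(2) f.support wordsD(6)[OF fw] by fastforce+
    have A'fin: "finite A'" unfolding A'_def using A(2) L(1) by blast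
    have A'E: "A' \<subseteq> Elem"
      unfolding A'_def using A(1) L(2) elem_inv_Elem by blast
    let ?g = "restr A' f"
    have g: "?g \<in> words Elem" "finite (idx ?g)"
      using restr_words[OF fw] finite_restr[OF fw A'fin] by blast+
    have gS: "?g \<in> S_Elem" by (rule finite_word_in_S_Elem[OF g])
    define n where "n = inv\<^bsub>G_Elem\<^esub> x \<otimes>\<^bsub>G_Elem\<^esub> cls ?g"
    have gG: "cls ?g \<in> carrier G_Elem" by (rule cls_in_G[OF gS])
    have xn: "x \<otimes>\<^bsub>G_Elem\<^esub> n = cls ?g" unfolding n_def using xG gG by (simp add: G.m_assoc[symmetric])
    have "cls ?g \<in> finitary_part Elem elem_inv"
      unfolding finitary_part_def
    proof (rule E.finite_word_in_subgroup[OF _ g])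
      show "subgroup (generate (BF Elem elem_inv) ((\<lambda>l. cls (one_letter l)) ` Elem)) (BF Elem elem_inv)"
        by (rule group.generate_is_subgroup[OF E.group_BF])
          (auto simp: E.carrier_BF one_letter_in_words)
      show "cls (one_letter (lab ?g s)) \<in> generate (BF Elem elem_inv) ((\<lambda>l. cls (one_letter l)) ` Elem)"
        if "s \<in> idx ?g" for s
        using wordsD(6)[OF g(1) that] by (intro generate.incl) blast
    qed
    moreover have "n \<in> N"
      unfolding YA(1) in_U_nbhd
    proof (intro conjI)
      show "n \<in> carrier G_Elem" unfolding n_def using xG gG by simp
      show "n \<in> ker_proj Elem elem_inv A"
      proof -
        have "A \<subseteq> A'" by (auto simp: A'_def)
        from E.inv_mult_restr_in_ker_proj[OF this A'E A(3) fw]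
        show ?thesis unfolding n_def f(2) mult_G_BF inv_G_BF[OF cls_in_G[OF f(1)]] .
      qed
      have Pn: "Psi n = alpha (bar f) \<cdot> alpha ?g"
        unfolding n_def f(2) inv_G[OF f(1)]
        using Psi.hom_mult[OF cls_in_G[OF bar_S_Elem[OF f(1)]] gG]
        by (simp add: Psi_cls bar_S_Elem f(1) gS)
      have "(alpha (bar f) \<cdot> alpha ?g) [y] = [y]" if y: "y \<in> Y" for y
      proof -
        have r: "reduced (?v y)" by (rule alpha_reduced[OF bar_S_Elem[OF f(1)]]) simp
        have sub: "f.support (?v y) \<subseteq> idx ?g"
        proof
          fix s assume "s \<in> f.support (?v y)"
          then have "s \<in> idx f" "lab f s \<in> L" using f.support(2) y unfolding L_def by blast+
          then show "s \<in> idx ?g" by (simp add: A'_def)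
        qed
        have "alpha ?g (?v y) = part_prod f (idx ?g) (?v y)"
          using alpha_finite[OF g] part_prod_restr[OF fw A'fin] by simp
        also have "\<dots> = alpha f (?v y)"
          by (rule f.alpha_part_prod[OF r g(2) _ sub, symmetric]) auto
        also have "\<dots> = [y]" using alpha_bar[OF bar_S_Elem[OF f(1)], of "[y]"] by simp
        finally show ?thesis
          using mult_Aut_apply[OF alpha_in_Aut[OF bar_S_Elem[OF f(1)]] alpha_in_Aut[OF gS], of "[y]"] by simp
      qed
      then show "Psi n \<in> stabilizer_of Y"
        unfolding Pn stabilizer_of_def
        using alpha_in_Aut[OF bar_S_Elem[OF f(1)]] alpha_in_Aut[OF gS] by simp
    qed
    ultimately show ?thesis using xn by metis
  qed
  then show "x \<in> T_Elem closure_of (finitary_part Elem elem_inv)"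
    unfolding T_Elem_base T.in_closure using xG by blast
qed

lemma admissible_T_Elem: "admissible_topology Elem elem_inv S_Elem T_Elem"
  unfolding admissible_topology_def G_Elem_def[symmetric]
  using T.topological natural_coarser finitary_dense by (simp add: T_Elem_base)

text \<open>A point of the closure differs from a kernel element by an automorphism fixing any
  prescribed finite set of basis elements. Its image under \<open>Psi\<close> therefore fixes every
  letter.\<close>

lemma kernel_closed: "closedin T_Elem (kernel G_Elem Aut_F_omega Psi)"
proof -
  let ?K = "kernel G_Elem Aut_F_omega Psi"
  have sub: "?K \<subseteq> topspace T_Elem" by (auto simp: T_Elem_base T.topspace kernel_def)
  have "T_Elem closure_of ?K \<subseteq> ?K"
  proof
    fix x assume "x \<in> T_Elem closure_of ?K"
    then have x: "x \<in> carrier G_Elem" "\<And>N. N \<in> base \<Longrightarrow> \<exists>n\<in>N. x \<otimes>\<^bsub>G_Elem\<^esub> n \<in> ?K"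
      unfolding T_Elem_base T.in_closure by blast+
    have P: "Psi x \<in> carrier Aut_F_omega" using x(1) by (rule Psi.hom_closed)
    have stab: "Psi x \<in> stabilizer_of Y" if Y: "finite Y" "Y \<subseteq> basis" for Y
    proof -
      obtain n where n: "n \<in> U_nbhd Y {}" "x \<otimes>\<^bsub>G_Elem\<^esub> n \<in> ?K"
        using x(2)[OF baseI[OF Y finite_symmetric_empty]] by blast
      have nG: "n \<in> carrier G_Elem" "Psi n \<in> stabilizer_of Y" using n(1) by (simp_all add: in_U_nbhd)
      have "Psi x \<cdot> Psi n = \<one>\<^sub>A"
        using n(2) x(1) nG(1) by (simp add: kernel_def)
      then have "Psi x = inv\<^sub>A (Psi n)"
        using P nG(1) by (metis Aut.inv_equality Aut.inv_inv Psi.hom_closed)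
      then show ?thesis using subgroup.m_inv_closed[OF subgroup_stabilizer nG(2)] by simp
    qed
    have "Psi x = \<one>\<^sub>A"
    proof (rule Aut_eqI[OF P Aut.one_closed])
      fix z
      have "Psi x [z] = [z]"
        by (rule Aut_fix_word[OF stab[of "{(fst z, True)}"]]) (auto simp: basis_def)
      then show "Psi x [z] = \<one>\<^sub>A [z]" by (simp add: one_Aut_apply)
    qed
    then show "x \<in> ?K" using x(1) by (simp add: kernel_def)
  qed
  then show ?thesis using sub closure_of_subset_eq[of ?K T_Elem] by blast
qed

section \<open>Surjectivity\<close>

text \<open>The second component of a position encodes, by the pairing function, the number of a
  list and a place in it; the first component is left to carry the label.\<close>

definition block_no :: "'l \<times> nat \<Rightarrow> nat" where
  "block_no s = fst (prod_decode (snd s))"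

definition place_no :: "'l \<times> nat \<Rightarrow> nat" where
  "place_no s = snd (prod_decode (snd s))"

text \<open>The infinite concatenation \<open>ds 0 @ ds 1 @ \<dots>\<close>.\<close>

definition seq_word :: "(nat \<Rightarrow> 'l list) \<Rightarrow> 'l word" where
  "seq_word ds = (let I = {s. place_no s < length (ds (block_no s)) \<and> fst s = ds (block_no s) ! place_no s}
     in \<lparr>idx = I,
       le = {(s, t). s \<in> I \<and> t \<in> I \<and>
         (block_no s < block_no t \<or> block_no s = block_no t \<and> place_no s \<le> place_no t)},
       lab = fst\<rparr>)"

lemma seq_word_simps:
  "s \<in> idx (seq_word ds) \<longleftrightarrow> place_no s < length (ds (block_no s)) \<and> fst s = ds (block_no s) ! place_no s"
  "(s, t) \<in> le (seq_word ds) \<longleftrightarrow> s \<in> idx (seq_word ds) \<and> t \<in> idx (seq_word ds) \<and>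
     (block_no s < block_no t \<or> block_no s = block_no t \<and> place_no s \<le> place_no t)"
  "lab (seq_word ds) s = fst s"
  by (simp_all add: seq_word_def Let_def)

definition position :: "(nat \<Rightarrow> 'l list) \<Rightarrow> nat \<Rightarrow> nat \<Rightarrow> 'l \<times> nat" where
  "position ds k j = (ds k ! j, prod_encode (k, j))"

lemma position_simps [simp]:
  "block_no (position ds k j) = k" "place_no (position ds k j) = j" "fst (position ds k j) = ds k ! j"
  by (simp_all add: position_def block_no_def place_no_def)

lemma position_eq:
  assumes "s \<in> idx (seq_word ds)"
  shows "position ds (block_no s) (place_no s) = s"
  using assms by (simp add: position_def seq_word_simps block_no_def place_no_def prod_eq_iff)

definition block :: "(nat \<Rightarrow> 'l list) \<Rightarrow> nat \<Rightarrow> ('l \<times> nat) set" where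
  "block ds k = {s \<in> idx (seq_word ds). block_no s = k}"

lemma block_eq: "block ds k = position ds k ` {..<length (ds k)}"
proof (intro equalityI subsetI)
  fix s assume s: "s \<in> block ds k"
  then have "s = position ds k (place_no s)" "place_no s < length (ds k)"
    using position_eq[of s ds] by (auto simp: block_def seq_word_simps)
  then show "s \<in> position ds k ` {..<length (ds k)}" by (metis imageI lessThan_iff)
next
  fix s assume "s \<in> position ds k ` {..<length (ds k)}"
  then obtain j where "j < length (ds k)" "s = position ds k j" by blast
  then show "s \<in> block ds k" by (simp add: block_def seq_word_simps)
qed

lemma finite_block: "finite (block ds k)"
  by (simp add: block_eq)

text \<open>By the second hypothesis each label occurs in at most one of the lists, so its fibre
  lies in a finite block.\<close>

lemma seq_word_in_words:
  assumes lab: "\<And>k. set (ds k) \<subseteq> \<Lambda>" and fin: "\<And>l. \<exists>k. \<forall>i. l \<in> set (ds i) \<longrightarrow> i = k"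
  shows "seq_word ds \<in> words \<Lambda>"
  unfolding words_iff
proof (intro conjI ballI impI)
  show "le (seq_word ds) \<subseteq> idx (seq_word ds) \<times> idx (seq_word ds)"
    by (rule subrelI) (simp add: seq_word_simps(2))
  show "(s, s) \<in> le (seq_word ds)" if "s \<in> idx (seq_word ds)" for s
    using that by (simp add: seq_word_simps(2))
  show "(s, u) \<in> le (seq_word ds)" if "(s, t) \<in> le (seq_word ds)" "(t, u) \<in> le (seq_word ds)" for s t u
    using that unfolding seq_word_simps(2) by linarith
  show "(s, t) \<in> le (seq_word ds) \<or> (t, s) \<in> le (seq_word ds)"
    if "s \<in> idx (seq_word ds)" "t \<in> idx (seq_word ds)" for s t
    using that unfolding seq_word_simps(2) by linarith
  show "s = t" if "(s, t) \<in> le (seq_word ds)" "(t, s) \<in> le (seq_word ds)" for s t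
  proof -
    have "block_no s = block_no t" "place_no s = place_no t"
      using that unfolding seq_word_simps(2) by linarith+
    then show ?thesis using that position_eq unfolding seq_word_simps(2) by metis
  qed
  show "lab (seq_word ds) s \<in> \<Lambda>" if "s \<in> idx (seq_word ds)" for s
  proof -
    have "fst s \<in> set (ds (block_no s))" using that by (simp add: seq_word_simps)
    then show ?thesis using lab by (auto simp: seq_word_simps)
  qed
  show "finite {s \<in> idx (seq_word ds). lab (seq_word ds) s = l}" for l
  proof -
    obtain k where k: "\<And>i. l \<in> set (ds i) \<Longrightarrow> i = k" using fin by blast
    have "{s \<in> idx (seq_word ds). lab (seq_word ds) s = l} \<subseteq> block ds k"
    proof
      fix s assume "s \<in> {s \<in> idx (seq_word ds). lab (seq_word ds) s = l}"
      then have s: "s \<in> idx (seq_word ds)" "fst s = l" by (simp_all add: seq_word_simps(3))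
      then have "l \<in> set (ds (block_no s))" by (auto simp: seq_word_simps)
      then show "s \<in> block ds k" using s k unfolding block_def by blast
    qed
    then show ?thesis using finite_block finite_subset by blast
  qed
qed

definition initial_part :: "(nat \<Rightarrow> 'l list) \<Rightarrow> nat \<Rightarrow> ('l \<times> nat) set" where
  "initial_part ds k = {s \<in> idx (seq_word ds). block_no s < k}"

lemma initial_part_Suc: "initial_part ds (Suc k) = initial_part ds k \<union> block ds k"
  by (auto simp: initial_part_def block_def less_Suc_eq)

lemma finite_initial_part: "finite (initial_part ds k)"
proof (induction k)
  case 0
  then show ?case by (simp add: initial_part_def)
next
  case (Suc k)
  then show ?case by (simp add: initial_part_Suc finite_block)
qed

lemma initial_part_idx: "initial_part ds k \<subseteq> idx (seq_word ds)" "block ds k \<subseteq> idx (seq_word ds)"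
  by (auto simp: initial_part_def block_def)

lemma initial_part_covers:
  assumes "finite C" "C \<subseteq> idx (seq_word ds)"
  obtains k where "\<And>n. k \<le> n \<Longrightarrow> C \<subseteq> initial_part ds n"
proof
  show "C \<subseteq> initial_part ds n" if n: "Suc (Max (insert 0 (block_no ` C))) \<le> n" for n
  proof
    fix s assume s: "s \<in> C"
    have "block_no s \<le> Max (insert 0 (block_no ` C))" using assms(1) s by (intro Max_ge) auto
    then show "s \<in> initial_part ds n" using s assms(2) n by (auto simp: initial_part_def)
  qed
qed

lemma part_prod_block:
  assumes f: "seq_word ds \<in> words Elem"
  shows "part_prod (seq_word ds) (block ds k) = elem_prod (ds k)"
proof -
  have "inj_on (position ds k) A" for A
    by (rule inj_onI) (metis position_simps(2))
  then have "enum (seq_word ds) (block ds k) (map (position ds k) [0..<length (ds k)])"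
    unfolding enum_def block_eq
    by (simp add: distinct_map atLeast0LessThan sorted_wrt_map sorted_wrt_iff_nth_less seq_word_simps)
  then have "sorted_positions (seq_word ds) (block ds k) = map (position ds k) [0..<length (ds k)]"
    by (rule sorted_positions_eq[OF f])
  moreover have "map (lab (seq_word ds)) (map (position ds k) [0..<length (ds k)]) = ds k"
    by (rule nth_equalityI) (simp_all add: seq_word_simps)
  ultimately show ?thesis by (simp only: part_prod_def)
qed

lemma part_prod_initial_part_Suc:
  assumes f: "seq_word ds \<in> words Elem"
  shows "part_prod (seq_word ds) (initial_part ds (Suc k)) =
    part_prod (seq_word ds) (initial_part ds k) \<cdot> elem_prod (ds k)"
  unfolding initial_part_Suc part_prod_block[OF f, symmetric]
  by (rule part_prod_union[OF f finite_initial_part initial_part_idx(1) finite_block initial_part_idx(2)])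
    (auto simp: initial_part_def block_def seq_word_simps(2))

text \<open>Block k alters only letters between \<open>P k\<close> and \<open>P (Suc k)\<close> and
  multiplies them by letters below the upper end. Since the intervals adjoin, the word is block
  triangular for the grading by intervals.\<close>

lemma seq_word_in_S_Elem:
  assumes ds: "\<And>k. set (ds k) \<subseteq> elem_range (P k) (P (Suc k))" and P: "mono P"
  shows "seq_word ds \<in> S_Elem"
proof -
  \<comment> \<open>The number of the interval containing \<open>n\<close>, where indices below
    \<open>P 0\<close> count as belonging to the first. An \<open>n\<close> above all bounds has no
    specified value, but no such letter occurs in the word.\<close>
  define b where "b n = (LEAST j. n < P (Suc j))" for n
  have b1: "b (fst (fst e)) = k" and b2: "b (fst (snd e)) \<le> k" if "e \<in> set (ds k)" for e k
  proof -
    have e: "P k \<le> fst (fst e)" "fst (fst e) < P (Suc k)" "fst (snd e) < P (Suc k)"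
      using ds[of k] that by (auto simp: elem_range_def)
    show "b (fst (fst e)) = k"
      unfolding b_def
    proof (rule Least_equality)
      fix i assume i: "fst (fst e) < P (Suc i)"
      show "k \<le> i"
      proof (rule ccontr)
        assume "\<not> k \<le> i"
        then have "P (Suc i) \<le> P k" using P by (intro monoD[OF P]) simp
        then show False using i e(1) by simp
      qed
    qed (rule e(2))
    show "b (fst (snd e)) \<le> k" unfolding b_def by (rule Least_le) (rule e(3))
  qed
  have f: "seq_word ds \<in> words Elem"
  proof (rule seq_word_in_words)
    show "set (ds k) \<subseteq> Elem" for k using ds[of k] elem_range_Elem by blast
    show "\<exists>k. \<forall>i. l \<in> set (ds i) \<longrightarrow> i = k" for l using b1[of l] by blast
  qed
  have mem: "fst s \<in> set (ds (block_no s))" if "s \<in> idx (seq_word ds)" for s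
    using that by (simp add: seq_word_simps)
  show ?thesis
  proof (rule block_triangular_in_S_Elem[OF f, of b])
    show "\<forall>s\<in>idx (seq_word ds). b (fst (lab2 (seq_word ds) s)) \<le> b (fst (lab1 (seq_word ds) s))"
      using b1[OF mem] b2[OF mem] by (simp add: seq_word_simps(3))
    show "finite {s \<in> idx (seq_word ds). b (fst (lab1 (seq_word ds) s)) = k}" for k
    proof (rule finite_subset[OF _ finite_block])
      show "{s \<in> idx (seq_word ds). b (fst (lab1 (seq_word ds) s)) = k} \<subseteq> block ds k"
        using b1[OF mem] by (auto simp: seq_word_simps(3) block_def)
    qed
  qed
qed

section \<open>Factorization of an automorphism into two infinite products\<close>

lemma fixes_below_inv:
  assumes "\<gamma> \<in> carrier Aut_F_omega" "fixes_below m \<gamma>"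
  shows "fixes_below m (inv\<^sub>A \<gamma>)"
  using assms Aut_inv_apply[of \<gamma>] by (simp add: fixes_below_def)

lemma fixes_below_word:
  assumes \<gamma>: "\<gamma> \<in> carrier Aut_F_omega" "fixes_below m \<gamma>" and w: "reduced w" "\<forall>z\<in>set w. fst z < m"
  shows "\<gamma> w = w"
proof -
  have "\<gamma> \<in> stabilizer_of {z. fst z < m}" using \<gamma> by (simp add: stabilizer_of_def fixes_below_def)
  then show ?thesis by (rule Aut_fix_word[OF _ w(1)]) (use w(2) in auto)
qed

text \<open>Because of the inversion, consecutive corrections act from opposite sides of the original automorphism.\<close>

lemma zigzag:
  assumes \<alpha>: "\<alpha> \<in> carrier Aut_F_omega"
  obtains \<gamma> :: "nat \<Rightarrow> letter list \<Rightarrow> letter list" and p :: "nat \<Rightarrow> nat" and es where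
    "\<gamma> 0 = \<alpha>" "\<And>k. \<gamma> k \<in> carrier Aut_F_omega" "\<And>k. fixes_below (p k) (\<gamma> k)"
    "\<And>k. p k \<le> p (Suc k)" "\<And>k. p (Suc k) < p (Suc (Suc k))"
    "\<And>k. set (es k) \<subseteq> elem_range (p k) (p (Suc (Suc k)))"
    "\<And>k. \<gamma> (Suc k) = inv\<^sub>A (elem_prod (es k) \<cdot> \<gamma> k)"
proof -
  \<comment> \<open>A state consists of the current automorphism, the level below which it fixes all
    letters, and the level that the next correction must reach. The latter is chosen one step
    ahead.\<close>
  define Pr where "Pr n x \<longleftrightarrow> fst x \<in> carrier Aut_F_omega \<and> fixes_below (fst (snd x)) (fst x) \<and>
      fst (snd x) \<le> snd (snd x) \<and> (n = 0 \<longrightarrow> x = (\<alpha>, 0, 0))"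
    for n :: nat and x :: "(letter list \<Rightarrow> letter list) \<times> nat \<times> nat"
  define Q where "Q x y \<longleftrightarrow> fst (snd y) = snd (snd x) \<and> snd (snd x) < snd (snd y) \<and>
      (\<exists>es. set es \<subseteq> elem_range (fst (snd x)) (snd (snd y)) \<and>
        fst y = inv\<^sub>A (elem_prod es \<cdot> fst x))"
    for x y :: "(letter list \<Rightarrow> letter list) \<times> nat \<times> nat"
  have "\<exists>F. \<forall>n. Pr n (F n) \<and> Q (F n) (F (Suc n))"
  proof (rule dependent_nat_choice)
    show "\<exists>x. Pr 0 x"
      using \<alpha> by (intro exI[of _ "(\<alpha>, 0, 0)"]) (simp add: Pr_def fixes_below_def)
    fix x n assume x: "Pr n x"
    let ?\<gamma> = "fst x" and ?p = "fst (snd x)" and ?q = "snd (snd x)"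
    have \<gamma>: "?\<gamma> \<in> carrier Aut_F_omega" "fixes_below ?p ?\<gamma>" "?p \<le> ?q" using x by (simp_all add: Pr_def)
    obtain N es where N: "?q \<le> N" "set es \<subseteq> elem_range ?p N" "fixes_below ?q (elem_prod es \<cdot> ?\<gamma>)"
      using nielsen[OF \<gamma>] by blast
    have "set es \<subseteq> Elem" using N(2) elem_range_Elem by blast
    then have \<delta>: "elem_prod es \<cdot> ?\<gamma> \<in> carrier Aut_F_omega" using \<gamma>(1) by simp
    \<comment> \<open>\<open>Suc N\<close> becomes the target of the next step and thus the starting
      level of the step after it, which acts on the same side of the original automorphism. So
      corrections of one side have adjoining ranges; the successor makes the levels increase
      strictly.\<close>
    let ?y = "(inv\<^sub>A (elem_prod es \<cdot> ?\<gamma>), ?q, Suc N)"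
    have "Pr (Suc n) ?y"
      using fixes_below_inv[OF \<delta> N(3)] \<delta> N(1) by (simp add: Pr_def)
    moreover have "Q x ?y"
      using N(1,2) elem_range_mono[of ?p ?p N "Suc N"] unfolding Q_def by (intro conjI exI[of _ es]) auto
    ultimately show "\<exists>y. Pr (Suc n) y \<and> Q x y" by blast
  qed
  then obtain F where F: "\<And>n. Pr n (F n)" "\<And>n. Q (F n) (F (Suc n))" by blast
  have "\<forall>n. \<exists>es. set es \<subseteq> elem_range (fst (snd (F n))) (snd (snd (F (Suc n)))) \<and>
      fst (F (Suc n)) = inv\<^sub>A (elem_prod es \<cdot> fst (F n))"
    using F(2) unfolding Q_def by blast
  then obtain es where es: "\<And>n. set (es n) \<subseteq> elem_range (fst (snd (F n))) (snd (snd (F (Suc n))))"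
      "\<And>n. fst (F (Suc n)) = inv\<^sub>A (elem_prod (es n) \<cdot> fst (F n))"
    by metis
  have q: "snd (snd (F n)) = fst (snd (F (Suc n)))" "snd (snd (F n)) < snd (snd (F (Suc n)))" for n
    using F(2)[of n] by (simp_all add: Q_def)
  show ?thesis
  proof (rule that[of "\<lambda>n. fst (F n)" "\<lambda>n. fst (snd (F n))" es])
    show "fst (F 0) = \<alpha>" using F(1)[of 0] by (simp add: Pr_def)
    show "fst (F k) \<in> carrier Aut_F_omega" "fixes_below (fst (snd (F k))) (fst (F k))" for k
      using F(1)[of k] by (simp_all add: Pr_def)
    show "fst (snd (F k)) \<le> fst (snd (F (Suc k)))" for k
      using F(1)[of k] q(1)[of k] by (simp add: Pr_def)
    show "fst (snd (F (Suc k))) < fst (snd (F (Suc (Suc k))))" for k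
      using q(2)[of k] by (simp add: q(1))
    show "set (es k) \<subseteq> elem_range (fst (snd (F k))) (fst (snd (F (Suc (Suc k)))))" for k
      using es(1)[of k] by (simp add: q(1))
    show "fst (F (Suc k)) = inv\<^sub>A (elem_prod (es k) \<cdot> fst (F k))" for k
      by (rule es(2))
  qed
qed

lemma alpha_surj:
  assumes \<alpha>: "\<alpha> \<in> carrier Aut_F_omega"
  shows "\<exists>f\<in>S_Elem. alpha f = \<alpha>"
proof -
  obtain \<gamma> :: "nat \<Rightarrow> letter list \<Rightarrow> letter list" and p :: "nat \<Rightarrow> nat" and es where
    \<gamma>0: "\<gamma> 0 = \<alpha>" and \<gamma>A: "\<And>k. \<gamma> k \<in> carrier Aut_F_omega" and fixed: "\<And>k. fixes_below (p k) (\<gamma> k)"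
    and p1: "\<And>k. p k \<le> p (Suc k)" and p2: "\<And>k. p (Suc k) < p (Suc (Suc k))"
    and es: "\<And>k. set (es k) \<subseteq> elem_range (p k) (p (Suc (Suc k)))"
    and \<gamma>S: "\<And>k. \<gamma> (Suc k) = inv\<^sub>A (elem_prod (es k) \<cdot> \<gamma> k)"
    by (rule zigzag[OF \<alpha>]) blast
  \<comment> \<open>The even-numbered corrections act on the left of the original automorphism and
    the odd-numbered ones on the right. Their inverses, in order, form the two infinite
    words.\<close>
  define ds where "ds k = einv (es (2 * k))" for k
  define ds' where "ds' k = einv (es (Suc (2 * k)))" for k
  have pm: "mono p" using p1 by (simp add: mono_iff_le_Suc)
  have f: "seq_word ds \<in> S_Elem"
    by (rule seq_word_in_S_Elem[of ds "\<lambda>k. p (2 * k)"])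
      (use einv_elem_range[OF es] pm in \<open>auto simp: ds_def mono_def\<close>)
  have g': "seq_word ds' \<in> S_Elem"
    by (rule seq_word_in_S_Elem[of ds' "\<lambda>k. p (Suc (2 * k))"])
      (use einv_elem_range[OF es] pm in \<open>auto simp: ds'_def mono_def\<close>)
  have g: "bar (seq_word ds') \<in> S_Elem" by (rule bar_S_Elem[OF g'])
  note fw = S_Elem_words[OF f] and gw = S_Elem_words[OF g']
  interpret f: good_word "seq_word ds" using f by (simp add: S_Elem_iff)
  interpret g: good_word "bar (seq_word ds')" using g by (simp add: S_Elem_iff)
  let ?A = "\<lambda>k. part_prod (seq_word ds) (initial_part ds k)"
  let ?B = "\<lambda>k. part_prod (seq_word ds') (initial_part ds' k)"
  have A: "?A k \<in> carrier Aut_F_omega" for k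
    by (rule part_prod_in_Aut[OF fw finite_initial_part initial_part_idx(1)])
  have B: "?B k \<in> carrier Aut_F_omega" for k
    by (rule part_prod_in_Aut[OF gw finite_initial_part initial_part_idx(1)])
  have esE: "set (es k) \<subseteq> Elem" for k using es elem_range_Elem by blast
  have eA: "elem_prod (es k) \<in> carrier Aut_F_omega" for k using esE by simp
  have A_Suc: "?A (Suc k) = ?A k \<cdot> inv\<^sub>A (elem_prod (es (2 * k)))" for k
    using part_prod_initial_part_Suc[OF fw, of k] by (simp add: ds_def elem_prod_einv[OF esE])
  have B_Suc: "?B (Suc k) = ?B k \<cdot> inv\<^sub>A (elem_prod (es (Suc (2 * k))))" for k
    using part_prod_initial_part_Suc[OF gw, of k] by (simp add: ds'_def elem_prod_einv[OF esE])
  \<comment> \<open>Two steps of the alternation move one correction to either end, with both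
    inversions cancelling out. The middle factor fixes more and more letters.\<close>
  have factor: "\<alpha> = ?A k \<cdot> \<gamma> (2 * k) \<cdot> inv\<^sub>A (?B k)" for k
  proof (induction k)
    case 0
    have "initial_part ds 0 = {}" "initial_part ds' 0 = {}" by (simp_all add: initial_part_def)
    then show ?case using \<alpha> by (simp add: part_prod_empty fw gw \<gamma>0)
  next
    case (Suc k)
    let ?d = "elem_prod (es (2 * k))" and ?e = "elem_prod (es (Suc (2 * k)))" and ?c = "\<gamma> (2 * Suc k)"
    have "?c = inv\<^sub>A (?e \<cdot> inv\<^sub>A (?d \<cdot> \<gamma> (2 * k)))"
      using \<gamma>S[of "Suc (2 * k)"] \<gamma>S[of "2 * k"] by simp
    also have "\<dots> = ?d \<cdot> \<gamma> (2 * k) \<cdot> inv\<^sub>A ?e"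
      using eA \<gamma>A by (simp add: Aut.inv_mult_group)
    finally have c: "?c = ?d \<cdot> \<gamma> (2 * k) \<cdot> inv\<^sub>A ?e" .
    have cancel: "inv\<^sub>A u \<cdot> (u \<cdot> v) = v"
      if "u \<in> carrier Aut_F_omega" "v \<in> carrier Aut_F_omega" for u v
      using that by (simp add: Aut.m_assoc[symmetric])
    have "?A (Suc k) \<cdot> ?c \<cdot> inv\<^sub>A (?B (Suc k)) =
        ?A k \<cdot> \<gamma> (2 * k) \<cdot> inv\<^sub>A (?B k)"
      unfolding A_Suc B_Suc c using A[of k] B[of k] eA \<gamma>A
      by (simp add: Aut.m_assoc Aut.inv_mult_group cancel)
    then show ?case using Suc by simp
  qed
  have fg: "concat_word (seq_word ds) (bar (seq_word ds')) \<in> S_Elem" by (rule concat_S_Elem[OF f g])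
  \<comment> \<open>The levels are known to increase strictly only from index 1 on; hence the shift
    by two.\<close>
  have p_unbounded: "n < p (n + 2)" for n
  proof (induction n)
    case (Suc n)
    then show ?case using p2[of "Suc n"] by simp
  qed (use p2[of 0] in \<open>simp add: numeral_2_eq_2\<close>)
  have "alpha (concat_word (seq_word ds) (bar (seq_word ds'))) = \<alpha>"
  proof (rule Aut_eqI[OF alpha_in_Aut[OF fg] \<alpha>])
    fix x :: letter
    let ?w = "alpha (seq_word ds) [x]"
    have w: "reduced ?w" by (rule alpha_reduced[OF f]) simp
    obtain k1 where k1: "\<And>n. k1 \<le> n \<Longrightarrow> f.support [x] \<subseteq> initial_part ds n"
      using initial_part_covers[OF f.support] by blast
    have "g.support ?w \<subseteq> idx (seq_word ds')" using g.support(2)[of ?w] by simp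
    then obtain k2 where k2: "\<And>n. k2 \<le> n \<Longrightarrow> g.support ?w \<subseteq> initial_part ds' n"
      using initial_part_covers[OF g.support(1)] by blast
    define m where "m = Max (insert 0 (fst ` set ?w))"
    \<comment> \<open>Large enough for the first k blocks to contain both supports and for every
      letter of \<open>?w\<close> to lie below \<open>p (2 * k)\<close>; the middle factor then acts
      trivially on \<open>?w\<close>.\<close>
    define k where "k = k1 + k2 + m + 2"
    have "m + 2 \<le> 2 * k" by (simp add: k_def)
    then have "m < p (2 * k)" using p_unbounded[of m] monoD[OF pm, of "m + 2" "2 * k"] by linarith
    moreover have "fst z \<le> m" if "z \<in> set ?w" for z
      unfolding m_def using that by (intro Max_ge) auto
    ultimately have small: "\<forall>z\<in>set ?w. fst z < p (2 * k)" by (meson le_less_trans)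
    have 1: "?w = ?A k [x]"
      by (rule f.alpha_part_prod[OF _ finite_initial_part initial_part_idx(1) k1]) (simp_all add: k_def)
    have 2: "\<gamma> (2 * k) ?w = ?w" by (rule fixes_below_word[OF \<gamma>A fixed w small])
    have "alpha (bar (seq_word ds')) ?w = part_prod (bar (seq_word ds')) (initial_part ds' k) ?w"
      by (rule g.alpha_part_prod[OF w finite_initial_part _ k2]) (simp_all add: k_def initial_part_idx)
    also have "\<dots> = (inv\<^sub>A (?B k)) ?w"
      by (simp add: part_prod_bar[OF gw finite_initial_part initial_part_idx(1)])
    finally have 3: "alpha (bar (seq_word ds')) ?w = (inv\<^sub>A (?B k)) ?w" .
    have "\<alpha> [x] = (?A k \<cdot> \<gamma> (2 * k) \<cdot> inv\<^sub>A (?B k)) [x]"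
      using factor[of k] by (rule arg_cong)
    also have "\<dots> = (inv\<^sub>A (?B k)) (\<gamma> (2 * k) (?A k [x]))"
      using A[of k] B[of k] \<gamma>A[of "2 * k"] by (simp add: mult_Aut_apply)
    also have "\<dots> = alpha (bar (seq_word ds')) ?w" using 1 2 3 by simp
    also have "\<dots> = alpha (concat_word (seq_word ds) (bar (seq_word ds'))) [x]"
      by (rule alpha_concat[OF f g, symmetric]) simp
    finally show "alpha (concat_word (seq_word ds) (bar (seq_word ds'))) [x] = \<alpha> [x]" by simp
  qed
  then show ?thesis using fg by blast
qed

lemma Psi_epi: "Psi \<in> epi G_Elem Aut_F_omega"
proof -
  have "carrier Aut_F_omega \<subseteq> Psi ` carrier G_Elem"
  proof
    fix \<alpha> assume "\<alpha> \<in> carrier Aut_F_omega"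
    then obtain f where "f \<in> S_Elem" "alpha f = \<alpha>" using alpha_surj by blast
    then show "\<alpha> \<in> Psi ` carrier G_Elem"
      using Psi_cls cls_in_G by (metis imageI)
  qed
  then show ?thesis using Psi_hom Psi.hom_closed by (auto simp: epi_def)
qed

section \<open>The relators\<close>

text \<open>In the inverse-free form the two sides can be compared letter by letter.\<close>

lemma commutator_eqI:
  assumes "group H" "u \<in> carrier H" "v \<in> carrier H" "w \<in> carrier H"
    and eq: "u \<otimes>\<^bsub>H\<^esub> v = w \<otimes>\<^bsub>H\<^esub> (v \<otimes>\<^bsub>H\<^esub> u)"
  shows "commutator H u v = w"
proof -
  interpret H: group H by (rule assms(1))
  have "commutator H u v = (u \<otimes>\<^bsub>H\<^esub> v) \<otimes>\<^bsub>H\<^esub> inv\<^bsub>H\<^esub> (v \<otimes>\<^bsub>H\<^esub> u)"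
    unfolding commutator_def using assms(2,3) by (simp add: H.inv_mult_group H.m_assoc)
  also have "\<dots> = w \<otimes>\<^bsub>H\<^esub> ((v \<otimes>\<^bsub>H\<^esub> u) \<otimes>\<^bsub>H\<^esub> inv\<^bsub>H\<^esub> (v \<otimes>\<^bsub>H\<^esub> u))"
    unfolding eq by (rule H.m_assoc) (use assms in simp_all)
  also have "(v \<otimes>\<^bsub>H\<^esub> u) \<otimes>\<^bsub>H\<^esub> inv\<^bsub>H\<^esub> (v \<otimes>\<^bsub>H\<^esub> u) = \<one>\<^bsub>H\<^esub>"
    by (rule H.r_inv) (use assms in simp_all)
  finally show ?thesis using assms by simp
qed

lemma commutator_closed:
  "group H \<Longrightarrow> u \<in> carrier H \<Longrightarrow> v \<in> carrier H \<Longrightarrow> commutator H u v \<in> carrier H"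
  by (simp add: commutator_def group.is_monoid monoid.m_closed group.inv_closed)

lemma Psi_commutator:
  assumes "u \<in> carrier G_Elem" "v \<in> carrier G_Elem"
  shows "Psi (commutator G_Elem u v) = commutator Aut_F_omega (Psi u) (Psi v)"
  using assms by (simp add: commutator_def)

text \<open>One letter of each inverse pair determines an automorphism, so the sign can be chosen
  for which an elementary automorphism appends its multiplier on the right.\<close>

lemma Aut_eqI_half:
  assumes "\<alpha> \<in> carrier Aut_F_omega" "\<beta> \<in> carrier Aut_F_omega"
    and half: "\<And>x :: letter. \<exists>y. fst y = fst x \<and> \<alpha> [y] = \<beta> [y]"
  shows "\<alpha> = \<beta>"
proof (rule Aut_eqI[OF assms(1,2)])
  fix x :: letter
  obtain y where y: "fst y = fst x" "\<alpha> [y] = \<beta> [y]" using half[of x] by blast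
  then have "x = y \<or> x = linv y" using fst_eq_letter by metis
  then show "\<alpha> [x] = \<beta> [x]"
    using y(2) hom_F_linv[OF Aut_hom[OF assms(1)], of y] hom_F_linv[OF Aut_hom[OF assms(2)], of y] by auto
qed

lemma elem_aut_self: "independent a b \<Longrightarrow> elem_aut (a, b) [a] = [a, b]"
  by (simp add: elem_aut_letter)

lemma elem_aut_other: "independent a b \<Longrightarrow> fst z \<noteq> fst a \<Longrightarrow> elem_aut (a, b) [z] = [z]"
  by (rule elem_aut_fix) (simp_all add: Elem_def)

lemma elem_aut_pair:
  assumes "e \<in> Elem" "y \<noteq> linv x"
  shows "elem_aut e [x, y] = reduce (elem_aut e [x] @ elem_aut e [y])"
  using hom_F_word[OF Aut_hom[OF elem_aut_in_Aut[OF assms(1)]], of x y] assms(2) linv_swap[of y x] by auto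

text \<open>The hypotheses admit c = linv a. Then one factor multiplies \<open>a\<close> on the
  right and the other multiplies it on the left, and these operations commute. In the remaining case
  each factor fixes the letters that the other one alters or inserts.\<close>

lemma relation_R2:
  assumes ab: "independent a b" and cd: "independent c d" and a: "a \<notin> {c, d, linv d}" and b: "b \<notin> {c, linv c}"
  shows "elem_aut (a, b) \<cdot> elem_aut (c, d) = elem_aut (c, d) \<cdot> elem_aut (a, b)"
proof -
  have E: "(a, b) \<in> Elem" "(c, d) \<in> Elem" using ab cd by (simp_all add: Elem_def)
  note A = E[THEN elem_aut_in_Aut]
  have ad: "fst a \<noteq> fst d" and bc: "fst b \<noteq> fst c"
    using a b by (auto simp: fst_eq_letter)
  have ab': "fst a \<noteq> fst b" and cd': "fst c \<noteq> fst d" using ab cd by (simp_all add: independent_iff)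
  have step: "(elem_aut e \<cdot> elem_aut e') [x] = elem_aut e' (elem_aut e [x])"
    if "e \<in> Elem" "e' \<in> Elem" for e e' x
    using that by (simp add: mult_Aut_apply)
  show ?thesis
  proof (rule Aut_eqI_half)
    fix x :: letter
    show "\<exists>y. fst y = fst x \<and> (elem_aut (a, b) \<cdot> elem_aut (c, d)) [y] =
        (elem_aut (c, d) \<cdot> elem_aut (a, b)) [y]"
    proof (cases "fst x = fst a")
      case xa: True
      have nab: "b \<noteq> linv a" using ab' by auto
      have 1: "elem_aut (c, d) [b] = [b]" by (rule elem_aut_other[OF cd bc])
      have 2: "elem_aut (c, d) [a, b] = reduce (elem_aut (c, d) [a] @ [b])"
        using elem_aut_pair[OF E(2) nab] 1 by simp
      show ?thesis
      proof (cases "fst a = fst c")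
        case True
        then have ac: "linv c = a" using a fst_eq_letter[of a c] by auto
        have 3: "elem_aut (c, d) [a] = [linv d, a]"
          using elem_aut_letter[OF cd, of a] ac a by auto
        have da: "linv d \<noteq> linv a" using ad by auto
        have 4: "elem_aut (a, b) [linv d] = [linv d]" using ad by (intro elem_aut_other[OF ab]) simp
        have 5: "elem_aut (a, b) [linv d, a] = reduce ([linv d] @ [a, b])"
          using elem_aut_pair[OF E(1), of a "linv d"] 4 elem_aut_self[OF ab] ad by (auto simp: linv_swap)
        show ?thesis
          using xa by (intro exI[of _ a]) (simp add: step E elem_aut_self[OF ab] 2 3 5)
      next
        case False
        have 3: "elem_aut (c, d) [a] = [a]" by (rule elem_aut_other[OF cd False])
        have 4: "reduce [a, b] = [a, b]" using nab by (simp add: reduced_Cons)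
        show ?thesis
          using xa by (intro exI[of _ a]) (simp add: step E elem_aut_self[OF ab] 2 3 4)
      qed
    next
      case xa: False
      show ?thesis
      proof (cases "fst x = fst c")
        case True
        have ac: "fst c \<noteq> fst a" using xa True by simp
        have 1: "elem_aut (a, b) [c] = [c]" by (rule elem_aut_other[OF ab ac])
        have 2: "elem_aut (a, b) [d] = [d]" by (rule elem_aut_other[OF ab]) (use ad in simp)
        have ncd: "d \<noteq> linv c" using cd' by auto
        have 3: "elem_aut (a, b) [c, d] = [c, d]"
          using elem_aut_pair[OF E(1) ncd] 1 2 ncd by (simp add: reduced_Cons)
        show ?thesis
          using True by (intro exI[of _ c]) (simp add: step E elem_aut_self[OF cd] 1 3)
      next
        case False
        show ?thesis
          using elem_aut_other[OF ab xa] elem_aut_other[OF cd False] by (intro exI[of _ x]) (simp add: step E)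
      qed
    qed
  qed (use A in simp_all)
qed

text \<open>With the action on the right, both sides send a to a b c and b to b c, and fix the other
  basis elements.\<close>

lemma relation_R3:
  assumes ab: "independent a b" and bc: "independent b c" and ac: "independent a c"
  shows "elem_aut (a, b) \<cdot> elem_aut (b, c) =
    elem_aut (a, c) \<cdot> (elem_aut (b, c) \<cdot> elem_aut (a, b))"
proof -
  have E: "(a, b) \<in> Elem" "(b, c) \<in> Elem" "(a, c) \<in> Elem" using ab bc ac by (simp_all add: Elem_def)
  note A = E[THEN elem_aut_in_Aut]
  have n: "fst a \<noteq> fst b" "fst b \<noteq> fst c" "fst a \<noteq> fst c" using ab bc ac by (simp_all add: independent_iff)
  have l: "(elem_aut (a, b) \<cdot> elem_aut (b, c)) [x] = elem_aut (b, c) (elem_aut (a, b) [x])" for x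
    using A by (simp add: mult_Aut_apply)
  have r: "(elem_aut (a, c) \<cdot> (elem_aut (b, c) \<cdot> elem_aut (a, b))) [x] =
      elem_aut (a, b) (elem_aut (b, c) (elem_aut (a, c) [x]))" for x
    using A hom_F_reduced[OF Aut_hom[OF A(3)], of "[x]"] by (simp add: mult_Aut_apply)
  have nl: "b \<noteq> linv a" "c \<noteq> linv a" "c \<noteq> linv b" using n by auto
  have 1: "elem_aut (b, c) [a] = [a]" "elem_aut (b, c) [c] = [c]" "elem_aut (a, b) [c] = [c]"
      "elem_aut (a, b) [b] = [b]" "elem_aut (a, c) [b] = [b]"
    using n by (simp_all add: elem_aut_other ab bc ac)
  have 2: "elem_aut (b, c) [a, b] = [a, b, c]"
    using elem_aut_pair[OF E(2) nl(1)] 1 nl by (simp add: elem_aut_self bc reduced_Cons)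
  have 3: "elem_aut (b, c) [a, c] = [a, c]"
    using elem_aut_pair[OF E(2) nl(2)] 1 nl by (simp add: reduced_Cons)
  have 4: "elem_aut (a, b) [a, c] = [a, b, c]"
    using elem_aut_pair[OF E(1) nl(2)] 1 nl by (simp add: elem_aut_self ab reduced_Cons)
  have 5: "elem_aut (a, b) [b, c] = [b, c]"
    using elem_aut_pair[OF E(1) nl(3)] 1 nl by (simp add: reduced_Cons)
  show ?thesis
  proof (rule Aut_eqI_half)
    fix x :: letter
    consider "fst x = fst a" | "fst x = fst b" | "fst x \<noteq> fst a" "fst x \<noteq> fst b" by blast
    then show "\<exists>y. fst y = fst x \<and> (elem_aut (a, b) \<cdot> elem_aut (b, c)) [y] =
        (elem_aut (a, c) \<cdot> (elem_aut (b, c) \<cdot> elem_aut (a, b))) [y]"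
    proof cases
      case 1
      then show ?thesis
        by (intro exI[of _ a]) (simp add: l r elem_aut_self ab ac 2 3 4)
    next
      case c: 2
      then show ?thesis
        using 1 by (intro exI[of _ b]) (simp add: l r elem_aut_self bc 5)
    next
      case 3
      then show ?thesis
        by (intro exI[of _ x]) (simp add: l r elem_aut_other ab bc ac)
    qed
  qed (use A in simp_all)
qed

section \<open>Monomial automorphisms and the relations \<open>R4\<close> and
  \<open>R5\<close>\<close>

lemma sigma_linv: "independent a b \<Longrightarrow> sigma a b (linv c) = linv (sigma a b c)"
  using independent_neqs[of a b] by (auto simp: sigma_def linv_swap)

text \<open>The letters run through the cycle a, linv b, linv a, b.\<close>

lemma sigma_sigma:
  assumes "independent a b"
  shows "sigma a b (sigma a b (sigma a b (sigma a b c))) = c"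
  using independent_neqs[OF assms] by (auto simp: sigma_def linv_swap)

lemma sigma_inj: "independent a b \<Longrightarrow> sigma a b c = sigma a b d \<longleftrightarrow> c = d"
  by (metis sigma_sigma)

lemma fst_sigma_eq: "independent a b \<Longrightarrow> fst (sigma a b c) = fst (sigma a b d) \<longleftrightarrow> fst c = fst d"
  by (simp add: fst_eq_letter sigma_linv[symmetric] sigma_inj)

text \<open>Conjugation by a monomial automorphism renames the letters of an elementary one; the
  fourth power is trivial because the underlying permutation of letters has order dividing
  four.\<close>

lemma mono_relations:
  assumes ab: "independent a b" and W: "W \<in> carrier Aut_F_omega" "\<And>z. W [z] = [sigma a b z]"
  shows "independent c d \<Longrightarrow>
      elem_aut (c, d) \<cdot> W = W \<cdot> elem_aut (sigma a b c, sigma a b d)"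
    and "W [^]\<^bsub>Aut_F_omega\<^esub> (4::nat) = \<one>\<^sub>A"
proof -
  assume cd: "independent c d"
  then have cd': "independent (sigma a b c) (sigma a b d)"
    by (simp add: independent_iff fst_sigma_eq[OF ab])
  have E: "(c, d) \<in> Elem" "(sigma a b c, sigma a b d) \<in> Elem" using cd cd' by (simp_all add: Elem_def)
  note A = E[THEN elem_aut_in_Aut]
  show "elem_aut (c, d) \<cdot> W = W \<cdot> elem_aut (sigma a b c, sigma a b d)"
  proof (rule Aut_eqI_half)
    fix x :: letter
    show "\<exists>y. fst y = fst x \<and> (elem_aut (c, d) \<cdot> W) [y] =
        (W \<cdot> elem_aut (sigma a b c, sigma a b d)) [y]"
    proof (cases "fst x = fst c")
      case True
      have "c \<noteq> linv d" using independent_neqs[OF cd] by simp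
      then have "W [c, d] = reduce ([sigma a b c] @ [sigma a b d])"
        using hom_F_word[OF Aut_hom[OF W(1)]] W(2) by simp
      then have "W [c, d] = [sigma a b c, sigma a b d]"
        using independent_neqs[OF cd'] by (simp add: reduced_Cons)
      then show ?thesis
        using True A W by (intro exI[of _ c]) (simp add: mult_Aut_apply elem_aut_self cd cd')
    next
      case False
      then have "fst (sigma a b x) \<noteq> fst (sigma a b c)" by (simp add: fst_sigma_eq[OF ab])
      then show ?thesis
        using False A W by (intro exI[of _ x]) (simp add: mult_Aut_apply elem_aut_other cd cd')
    qed
  qed (use A W in simp_all)
next
  have "W [^]\<^bsub>Aut_F_omega\<^esub> (4::nat) = W \<cdot> W \<cdot> W \<cdot> W"
    using W(1) by (simp add: numeral_eq_Suc)
  moreover have "W \<cdot> W \<cdot> W \<cdot> W = \<one>\<^sub>A"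
    by (rule Aut_eqI) (use W in \<open>simp_all add: mult_Aut_apply one_Aut_apply sigma_sigma ab\<close>)
  ultimately show "W [^]\<^bsub>Aut_F_omega\<^esub> (4::nat) = \<one>\<^sub>A" by simp
qed

lemma wgen_in_G: "independent a b \<Longrightarrow> wgen a b \<in> carrier G_Elem"
  unfolding wgen_def by (intro G.m_closed G.inv_closed Egen_in_G) (simp_all add: independent_iff)

lemma Psi_wgen:
  assumes ab: "independent a b"
  shows "Psi (wgen a b) [z] = [sigma a b z]"
proof -
  have i: "independent b a" "independent (linv a) b" "independent (linv b) a"
    using ab by (auto simp: independent_iff)
  have E: "(b, a) \<in> Elem" "(linv a, b) \<in> Elem" "(linv b, a) \<in> Elem" "(linv b, linv a) \<in> Elem"
    using i by (simp_all add: Elem_def independent_iff)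
  note A = E[THEN elem_aut_in_Aut]
  have "Psi (wgen a b) = elem_aut (b, a) \<cdot> elem_aut (linv a, b)
      \<cdot> inv\<^sub>A (elem_aut (linv b, a))"
    unfolding wgen_def using Egen_in_G[OF i(1)] Egen_in_G[OF i(2)] Egen_in_G[OF i(3)]
    by (simp add: Psi_Egen i)
  also have "inv\<^sub>A (elem_aut (linv b, a)) = elem_aut (linv b, linv a)"
    using inv_elem_aut[OF E(3)] by (simp add: elem_inv_def)
  also have "elem_aut (b, a) \<cdot> elem_aut (linv a, b) \<cdot> elem_aut (linv b, linv a) =
      elem_prod (mono_word a b)"
    using A by (simp add: mono_word_def Aut.m_assoc)
  finally show ?thesis using elem_prod_mono_word[OF ab] by simp
qed

text \<open>Each relation is transported through \<open>Psi\<close> and becomes an identity between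
  automorphisms. Membership in the carrier is recorded as well, so that the relators belong to the
  group.\<close>

lemma relations_hold:
  assumes "(U, V) \<in> relations"
  shows "U \<in> carrier G_Elem \<and> V \<in> carrier G_Elem \<and> Psi U = Psi V"
  using assms
proof cases
  case (R1 a b)
  have i: "independent a (linv b)" using R1(3) by (simp add: independent_iff)
  have "inv\<^sub>A (elem_aut (a, b)) = elem_aut (a, linv b)"
    using inv_elem_aut[of "(a, b)"] R1(3) by (simp add: Elem_def elem_inv_def)
  then show ?thesis
    using Egen_in_G[OF R1(3)] Egen_in_G[OF i] by (simp add: R1(1,2) Psi_Egen R1(3) i)
next
  case (R2 a b c d)
  have E: "elem_aut (a, b) \<in> carrier Aut_F_omega" "elem_aut (c, d) \<in> carrier Aut_F_omega"
    using R2(3,4) by (simp_all add: Elem_def)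
  note g = Egen_in_G[OF R2(3)] Egen_in_G[OF R2(4)]
  have "Psi U = commutator Aut_F_omega (elem_aut (a, b)) (elem_aut (c, d))"
    unfolding R2(1) by (simp add: Psi_commutator g Psi_Egen R2(3,4))
  also have "\<dots> = \<one>\<^sub>A"
    by (rule commutator_eqI[OF group_Aut E]) (use relation_R2[OF R2(3-6)] E in simp_all)
  finally show ?thesis
    using commutator_closed[OF group_G g] unfolding R2(1,2) by simp
next
  case (R3 a b c)
  have i: "independent a c" using R3(5) by (auto simp: independent_def linv_swap)
  have E: "elem_aut (a, b) \<in> carrier Aut_F_omega" "elem_aut (b, c) \<in> carrier Aut_F_omega"
      "elem_aut (a, c) \<in> carrier Aut_F_omega"
    using R3(3,4) i by (simp_all add: Elem_def)
  note g = Egen_in_G[OF R3(3)] Egen_in_G[OF R3(4)]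
  have "Psi U = commutator Aut_F_omega (elem_aut (a, b)) (elem_aut (b, c))"
    unfolding R3(1) by (simp add: Psi_commutator g Psi_Egen R3(3,4))
  also have "\<dots> = elem_aut (a, c)"
    by (rule commutator_eqI[OF group_Aut E relation_R3[OF R3(3,4) i]])
  finally show ?thesis
    using commutator_closed[OF group_G g] Egen_in_G[OF i] unfolding R3(1,2) by (simp add: Psi_Egen i)
next
  case (R4 a b c d)
  have i: "independent (sigma a b c) (sigma a b d)"
    using R4(4) by (simp add: independent_iff fst_sigma_eq[OF R4(3)])
  have E: "elem_aut (c, d) \<in> carrier Aut_F_omega" "elem_aut (sigma a b c, sigma a b d) \<in> carrier Aut_F_omega"
    using R4(4) i by (simp_all add: Elem_def)
  note g = wgen_in_G[OF R4(3)] Egen_in_G[OF R4(4)]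
  have W: "Psi (wgen a b) \<in> carrier Aut_F_omega" using g(1) by simp
  have "Psi U = inv\<^sub>A (Psi (wgen a b)) \<cdot> (elem_aut (c, d) \<cdot> Psi (wgen a b))"
    unfolding R4(1) using g E W by (simp add: Psi_Egen R4(4) Aut.m_assoc)
  also have "\<dots> = elem_aut (sigma a b c, sigma a b d)"
    unfolding mono_relations(1)[OF R4(3) W Psi_wgen[OF R4(3)] R4(4)]
    using W E by (simp add: Aut.m_assoc[symmetric])
  finally show ?thesis
    using g Egen_in_G[OF i] unfolding R4(1,2) by (simp add: Psi_Egen i)
next
  case (R5 a b)
  note g = wgen_in_G[OF R5(3)]
  have W: "Psi (wgen a b) \<in> carrier Aut_F_omega" using g by simp
  have "Psi U = Psi (wgen a b) [^]\<^bsub>Aut_F_omega\<^esub> (4::nat)"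
    unfolding R5(1) using g by (simp add: Psi.hom_nat_pow)
  then show ?thesis
    using mono_relations(2)[OF R5(3) W Psi_wgen[OF R5(3)]] g unfolding R5(1,2) by simp
qed

lemma R_fin_kernel: "R_fin \<subseteq> kernel G_Elem Aut_F_omega Psi"
proof
  fix r assume "r \<in> R_fin"
  then obtain U V where r: "(U, V) \<in> relations" "r = U \<otimes>\<^bsub>G_Elem\<^esub> inv\<^bsub>G_Elem\<^esub> V"
    unfolding R_fin_def by auto
  have UV: "U \<in> carrier G_Elem" "V \<in> carrier G_Elem" "Psi U = Psi V" using relations_hold[OF r(1)] by blast+
  then have "Psi r = \<one>\<^sub>A" unfolding r(2) by simp
  then show "r \<in> kernel G_Elem Aut_F_omega Psi" using UV unfolding r(2) kernel_def by simp
qed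

lemma R_fin_carrier: "R_fin \<subseteq> carrier G_Elem"
  using R_fin_kernel by (auto simp: kernel_def)

lemma countable_R_fin: "countable R_fin"
proof -
  have "relations \<subseteq>
      (\<lambda>(a, b). (inv\<^bsub>G_Elem\<^esub> (Egen a b), Egen a (linv b))) ` UNIV \<union>
      (\<lambda>(a, b, c, d). (commutator G_Elem (Egen a b) (Egen c d), \<one>\<^bsub>G_Elem\<^esub>)) ` UNIV \<union>
      (\<lambda>(a, b, c). (commutator G_Elem (Egen a b) (Egen b c), Egen a c)) ` UNIV \<union>
      (\<lambda>(a, b, c, d). (inv\<^bsub>G_Elem\<^esub> (wgen a b) \<otimes>\<^bsub>G_Elem\<^esub> Egen c d \<otimes>\<^bsub>G_Elem\<^esub> wgen a b,
        Egen (sigma a b c) (sigma a b d))) ` UNIV \<union>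
      (\<lambda>(a, b). (wgen a b [^]\<^bsub>G_Elem\<^esub> (4::nat), \<one>\<^bsub>G_Elem\<^esub>)) ` UNIV" (is "_ \<subseteq> ?R1 \<union> ?R2 \<union> ?R3 \<union> ?R4 \<union> ?R5")
  proof (rule subrelI)
    fix U V assume "(U, V) \<in> relations"
    then show "(U, V) \<in> ?R1 \<union> ?R2 \<union> ?R3 \<union> ?R4 \<union> ?R5"
    proof cases
      case (R1 a b)
      then have "(U, V) \<in> ?R1" by (intro image_eqI[of _ _ "(a, b)"]) simp_all
      then show ?thesis by blast
    next
      case (R2 a b c d)
      then have "(U, V) \<in> ?R2" by (intro image_eqI[of _ _ "(a, b, c, d)"]) simp_all
      then show ?thesis by blast
    next
      case (R3 a b c)
      then have "(U, V) \<in> ?R3" by (intro image_eqI[of _ _ "(a, b, c)"]) simp_all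
      then show ?thesis by blast
    next
      case (R4 a b c d)
      then have "(U, V) \<in> ?R4" by (intro image_eqI[of _ _ "(a, b, c, d)"]) simp_all
      then show ?thesis by blast
    next
      case (R5 a b)
      then have "(U, V) \<in> ?R5" by (intro image_eqI[of _ _ "(a, b)"]) simp_all
      then show ?thesis by blast
    qed
  qed
  then have "countable relations" by (rule countable_subset) simp
  then show ?thesis unfolding R_fin_def by (rule countable_image)
qed

lemma countable_natLeq: "countable A \<Longrightarrow> |A| \<le>o natLeq"
  unfolding countable_card_of_nat using card_of_nat ordLeq_ordIso_trans by blast

section \<open>The kernel is the closure of the normal closure\<close>

lemma subgroup_normal_closure:
  assumes "R_fin \<subseteq> carrier G_Elem"
  shows "subgroup (normal_closure G_Elem R_fin) G_Elem"
  unfolding normal_closure_def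
proof (rule G.subgroups_Inter)
  show "subgroup N G_Elem" if "N \<in> {N. N \<lhd> G_Elem \<and> R_fin \<subseteq> N}" for N
    using that normal_imp_subgroup by blast
  \<comment> \<open>The kernel of \<open>Psi\<close> is a member of the family, so the intersection
    is not over the empty set.\<close>
  show "{N. N \<lhd> G_Elem \<and> R_fin \<subseteq> N} \<noteq> {}"
    using R_fin_kernel Psi.normal_kernel by blast
qed

lemma R_fin_normal_closure: "R_fin \<subseteq> normal_closure G_Elem R_fin"
  unfolding normal_closure_def by blast

lemma normal_closure_kernel: "normal_closure G_Elem R_fin \<subseteq> kernel G_Elem Aut_F_omega Psi"
  unfolding normal_closure_def using R_fin_kernel Psi.normal_kernel by blast

lemma letter_proj_Egen_trivial:
  assumes A: "finite_symmetric Elem elem_inv A" and ab: "independent a b" "(a, b) \<notin> A"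
  shows "letter_proj elem_inv A (Egen a b) = \<one>\<^bsub>BF A elem_inv\<^esub>"
proof -
  note A' = finite_symmetricD[OF A]
  interpret A: big_free A elem_inv by (rule E.big_free_subset[OF A'(1,3)])
  have w: "one_letter (a, b) \<in> words Elem" using ab(1) by (intro one_letter_in_words) (simp add: Elem_def)
  have "is_iso id (restr A (one_letter (a, b))) (idx (restr A (one_letter (a, b)))) empty_word"
    using ab(2) by (simp add: is_iso_def bij_betw_def)
  then have "word_class A elem_inv (restr A (one_letter (a, b))) = word_class A elem_inv empty_word"
    by (intro A.cls_eq_cancels is_iso_cancels restr_in_words[OF w] empty_in_words)
  then show ?thesis
    unfolding Egen_def E.letter_proj_cls[OF A'(1,3) w] A.one_BF .
qed

lemma letter_proj_Egen_relator:
  assumes A: "finite_symmetric Elem elem_inv A" and ac: "independent a c"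
  shows "letter_proj elem_inv A (Egen a c) \<in> letter_proj elem_inv A ` normal_closure G_Elem R_fin"
proof -
  note A' = finite_symmetricD[OF A]
  interpret h: group_hom "BF Elem elem_inv" "BF A elem_inv" "letter_proj elem_inv A"
    by (rule E.letter_proj_hom[OF A'(1,3)])
  let ?N = "normal_closure G_Elem R_fin"
  let ?used = "fst ` fst ` A \<union> fst ` snd ` A \<union> {fst a, fst c}"
  have "finite ?used" using A'(2) by simp
  then obtain n where n: "n \<notin> ?used" using ex_new_if_finite infinite_UNIV_nat by metis
  let ?b = "(n, True)"
  have i: "independent a ?b" "independent ?b c" using n by (auto simp: independent_iff)
  have notA: "(a, ?b) \<notin> A" "(?b, c) \<notin> A" using n by force+
  note g = Egen_in_G[OF i(1)] Egen_in_G[OF i(2)] Egen_in_G[OF ac]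
  have BF: "x \<in> carrier (BF Elem elem_inv)" if "x \<in> carrier G_Elem" for x
    using subgroup.subset[OF subgroup_G] that by (auto simp: carrier_G)
  let ?r = "commutator G_Elem (Egen a ?b) (Egen ?b c) \<otimes>\<^bsub>G_Elem\<^esub> inv\<^bsub>G_Elem\<^esub> (Egen a c)"
  have "a \<notin> {c, linv c}" using independent_neqs[OF ac] by blast
  then have "(commutator G_Elem (Egen a ?b) (Egen ?b c), Egen a c) \<in> relations"
    by (rule relations.R3[OF i])
  from imageI[OF this, of "\<lambda>(U, V). U \<otimes>\<^bsub>G_Elem\<^esub> inv\<^bsub>G_Elem\<^esub> V"]
  have "?r \<in> R_fin" unfolding R_fin_def case_prod_conv .
  then have r: "?r \<in> ?N" using R_fin_normal_closure by blast
  \<comment> \<open>The relator ends in the inverse of \<open>Egen a c\<close> and projects to the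
    inverse of the desired letter; hence its own inverse is taken.\<close>
  then have "inv\<^bsub>G_Elem\<^esub> ?r \<in> ?N"
    using subgroup.m_inv_closed[OF subgroup_normal_closure[OF R_fin_carrier]] by blast
  moreover have "letter_proj elem_inv A (inv\<^bsub>G_Elem\<^esub> ?r) = letter_proj elem_inv A (Egen a c)"
  proof -
    have rG: "?r \<in> carrier G_Elem" using r subgroup.subset[OF subgroup_normal_closure[OF R_fin_carrier]] by blast
    have "?r = Egen a ?b \<otimes>\<^bsub>BF Elem elem_inv\<^esub> Egen ?b c \<otimes>\<^bsub>BF Elem elem_inv\<^esub> inv\<^bsub>BF Elem elem_inv\<^esub> (Egen a ?b)
        \<otimes>\<^bsub>BF Elem elem_inv\<^esub> inv\<^bsub>BF Elem elem_inv\<^esub> (Egen ?b c) \<otimes>\<^bsub>BF Elem elem_inv\<^esub> inv\<^bsub>BF Elem elem_inv\<^esub> (Egen a c)"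
      unfolding commutator_def mult_G_BF inv_G_BF[OF g(1)] inv_G_BF[OF g(2)] inv_G_BF[OF g(3)] ..
    then have "letter_proj elem_inv A ?r = inv\<^bsub>BF A elem_inv\<^esub> (letter_proj elem_inv A (Egen a c))"
      using BF[OF g(1)] BF[OF g(2)] BF[OF g(3)]
      by (simp add: letter_proj_Egen_trivial[OF A i(1) notA(1)] letter_proj_Egen_trivial[OF A i(2) notA(2)])
    then show ?thesis
      using BF[OF rG] BF[OF g(3)] by (simp add: inv_G_BF[OF rG])
  qed
  ultimately show ?thesis by (metis imageI)
qed

text \<open>The image of a subgroup is a subgroup, and over a finite alphabet every word is a finite
  product of letters, so it suffices to hit the letters. As \<open>x\<close> is arbitrary, this is
  density for the natural topology.\<close>

lemma letter_proj_normal_closure: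
  assumes A: "finite_symmetric Elem elem_inv A" and x: "x \<in> carrier G_Elem"
  shows "letter_proj elem_inv A x \<in> letter_proj elem_inv A ` normal_closure G_Elem R_fin"
proof -
  note A' = finite_symmetricD[OF A]
  interpret A: big_free A elem_inv by (rule E.big_free_subset[OF A'(1,3)])
  interpret h: group_hom "BF Elem elem_inv" "BF A elem_inv" "letter_proj elem_inv A"
    by (rule E.letter_proj_hom[OF A'(1,3)])
  let ?N = "normal_closure G_Elem R_fin"
  obtain f where f: "f \<in> S_Elem" "x = cls f" using x by (auto simp: carrier_G)
  note fw = S_Elem_words[OF f(1)]
  have "subgroup ?N (BF Elem elem_inv)"
    using group.incl_subgroup[OF E.group_BF subgroup_G] subgroup_normal_closure[OF R_fin_carrier]
    by (simp add: G_Elem_def BF_sub_def)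
  then have H: "subgroup (letter_proj elem_inv A ` ?N) (BF A elem_inv)"
    by (rule h.subgroup_img_is_subgroup)
  have "word_class A elem_inv (restr A f) \<in> letter_proj elem_inv A ` ?N"
  proof (rule A.finite_word_in_subgroup[OF H restr_in_words[OF fw] finite_restr[OF fw A'(2)]])
    fix s assume s: "s \<in> idx (restr A f)"
    obtain a c where ac: "lab f s = (a, c)" by (cases "lab f s")
    have acA: "(a, c) \<in> A" using s ac by simp
    then have i: "independent a c" using A'(1) by (auto simp: Elem_def)
    have w: "one_letter (a, c) \<in> words Elem" using i by (intro one_letter_in_words) (simp add: Elem_def)
    have "is_iso id (restr A (one_letter (a, c))) (idx (restr A (one_letter (a, c)))) (one_letter (a, c))"
      using acA by (simp add: is_iso_def bij_betw_def)
    then have "word_class A elem_inv (restr A (one_letter (a, c))) = word_class A elem_inv (one_letter (a, c))"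
      using acA by (intro A.cls_eq_cancels is_iso_cancels restr_in_words[OF w] one_letter_in_words)
    then have "word_class A elem_inv (one_letter (a, c)) = letter_proj elem_inv A (Egen a c)"
      unfolding Egen_def E.letter_proj_cls[OF A'(1,3) w] by simp
    then show "word_class A elem_inv (one_letter (lab (restr A f) s)) \<in> letter_proj elem_inv A ` ?N"
      using letter_proj_Egen_relator[OF A i] ac by simp
  qed
  then show ?thesis unfolding f(2) E.letter_proj_cls[OF A'(1,3) fw] .
qed

lemma kernel_eq_closure:
  "kernel G_Elem Aut_F_omega Psi = T_Elem closure_of (normal_closure G_Elem R_fin)"
proof
  let ?K = "kernel G_Elem Aut_F_omega Psi" and ?N = "normal_closure G_Elem R_fin"
  show "T_Elem closure_of ?N \<subseteq> ?K"
    by (rule closure_of_minimal[OF normal_closure_kernel kernel_closed])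
  show "?K \<subseteq> T_Elem closure_of ?N"
  proof
    fix x assume "x \<in> ?K"
    then have x: "x \<in> carrier G_Elem" "Psi x = \<one>\<^sub>A" by (simp_all add: kernel_def)
    have "\<exists>n\<in>M. x \<otimes>\<^bsub>G_Elem\<^esub> n \<in> ?N" if M: "M \<in> base" for M
    proof -
      obtain Y A where YA: "M = U_nbhd Y A" "finite_symmetric Elem elem_inv A"
        using M unfolding base_def by blast
      note A' = finite_symmetricD[OF YA(2)]
      interpret h: group_hom "BF Elem elem_inv" "BF A elem_inv" "letter_proj elem_inv A"
        by (rule E.letter_proj_hom[OF A'(1,3)])
      obtain \<nu> where \<nu>: "\<nu> \<in> ?N" "letter_proj elem_inv A x = letter_proj elem_inv A \<nu>"
        using letter_proj_normal_closure[OF YA(2) x(1)] by blast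
      have \<nu>G: "\<nu> \<in> carrier G_Elem" "Psi \<nu> = \<one>\<^sub>A"
        using \<nu>(1) normal_closure_kernel by (auto simp: kernel_def)
      have BF: "y \<in> carrier (BF Elem elem_inv)" if "y \<in> carrier G_Elem" for y
        using subgroup.subset[OF subgroup_G] that by (auto simp: carrier_G)
      let ?n = "inv\<^bsub>G_Elem\<^esub> x \<otimes>\<^bsub>G_Elem\<^esub> \<nu>"
      have "?n \<in> ker_proj Elem elem_inv A"
        unfolding ker_proj_def kernel_def mult_G_BF inv_G_BF[OF x(1)]
        using BF[OF x(1)] BF[OF \<nu>G(1)] \<nu>(2) by simp
      moreover have "Psi ?n \<in> stabilizer_of Y"
        using x \<nu>G subgroup.one_closed[OF subgroup_stabilizer] by simp
      ultimately have "?n \<in> M" unfolding YA(1) in_U_nbhd using x(1) \<nu>G(1) by simp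
      moreover have "x \<otimes>\<^bsub>G_Elem\<^esub> ?n = \<nu>" using x(1) \<nu>G(1) by (simp add: G.m_assoc[symmetric])
      ultimately show ?thesis using \<nu>(1) by metis
    qed
    then show "x \<in> T_Elem closure_of ?N"
      unfolding T_Elem_base T.in_closure using x(1) by blast
  qed
qed

lemma smallest_closed_normal_kernel:
  "smallest_closed_normal G_Elem T_Elem R_fin (kernel G_Elem Aut_F_omega Psi)"
  unfolding smallest_closed_normal_def
proof (intro conjI allI impI)
  show "kernel G_Elem Aut_F_omega Psi \<lhd> G_Elem" by (rule Psi.normal_kernel)
  show "closedin T_Elem (kernel G_Elem Aut_F_omega Psi)" by (rule kernel_closed)
  show "R_fin \<subseteq> kernel G_Elem Aut_F_omega Psi" by (rule R_fin_kernel)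
  fix N assume N: "N \<lhd> G_Elem \<and> closedin T_Elem N \<and> R_fin \<subseteq> N"
  then have "normal_closure G_Elem R_fin \<subseteq> N" unfolding normal_closure_def by blast
  then show "kernel G_Elem Aut_F_omega Psi \<subseteq> N"
    unfolding kernel_eq_closure by (rule closure_of_minimal) (use N in blast)
qed

theorem theorem4p8p11:
  shows "kernel G_Elem Aut_F_omega Psi = T_Elem closure_of (normal_closure G_Elem R_fin)
    \<and> generalized_presentation_of_type natLeq Aut_F_omega Elem elem_inv S_Elem T_Elem R_fin"
proof
  show "kernel G_Elem Aut_F_omega Psi = T_Elem closure_of (normal_closure G_Elem R_fin)"
    by (rule kernel_eq_closure)
  have "free_involution Elem elem_inv"
    by (simp add: free_involution_def elem_inv_neq)
  moreover have "one_letter ` Elem \<subseteq> S_Elem" using one_letter_S_Elem by blast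
  moreover have "|Elem| \<le>o natLeq" "|R_fin| \<le>o natLeq"
    by (simp_all add: countable_natLeq countable_R_fin)
  ultimately show "generalized_presentation_of_type natLeq Aut_F_omega Elem elem_inv S_Elem T_Elem R_fin"
    unfolding generalized_presentation_of_type_def generalized_presentation_def G_Elem_def[symmetric]
    using group_Aut admissible_S_Elem admissible_T_Elem R_fin_carrier Psi_epi smallest_closed_normal_kernel
    by blast
qed

end
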